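(* Let $d\ge1$ be an integer, $q\in(1/2,1)$, $R_{\max},R_{\min},r,L>0$ and $\varepsilon>0$. Then for every $0<\alpha<\frac{\min\{1,r,R_{\min}\}}{2}$ there exist a positive integer $$n=\tilde O\left(\frac{\mathrm{poly}(R_{\max}+r+1)}{\mathrm{poly}(R_{\min})}\left(\frac{d^2}{\alpha^{14}L^2}+\frac{d^4}{\varepsilon^2\alpha^8L}+\frac{d^4}{\varepsilon^2\alpha^2\min\{r,R_{\min}\}^2L}\right)\right)$$ and an $\varepsilon$-differentially private algorithm $\mathcal{A}$ on $(\mathbb{R}^d)^n$ with values in $\mathbb{R}^d$ such that the following holds for every $\mathcal{D}\in A_q(R_{\max},R_{\min},r,L)$ for which $F_q(\mathcal{D})$ contains a ball of radius $R_{\min}$ around its Steiner point $S(F_q(\mathcal{D}))$: if $X=(X_1,\dots,X_n)$ is sampled i.i.d. from $\mathcal{D}$ and $U_q$ is a random vector uniform on $F_q(\mathcal{D})$, then $$\frac1d\,W_2^2(\mathcal{A}(X),U_q)\le\alpha .$$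
   Context: **Quantiles, floating body.** For a real random variable $Y$, $Q_q(Y)=\inf\{t\in\mathbb{R}:\mathbb{P}(Y\le t)\ge q\}$. For a random vector $X\sim\mathcal{D}$ in $\mathbb{R}^d$, $F_q(\mathcal{D})=F_q(X)=\bigcap_{\theta\in\mathbb{S}^{d-1}}\{x\in\mathbb{R}^d:\langle x,\theta\rangle\le Q_q(\langle X,\theta\rangle)\}$. **Steiner point.** For a convex body $K\subset\mathbb{R}^d$ with support function $h_K(\theta)=\max_{x\in K}\langle x,\theta\rangle$, $S(K)=d\int_{\mathbb{S}^{d-1}}\theta\,h_K(\theta)\,d\sigma(\theta)$, where $\sigma$ is the normalized Haar measure on $\mathbb{S}^{d-1}$. **Wasserstein distance.** $W_2(X,Y)=\inf(\mathbb{E}\|X-Y\|_2^2)^{1/2}$, the infimum over all couplings of (the laws of) $X$ and $Y$; the law of $\mathcal{A}(X)$ is taken over both the sample and the internal randomness. **Admissible laws.** Fix a polynomial $\mathfrak p(n,d)$. A distribution $\mathcal{D}$ on $\mathbb{R}^d$ belongs to $A_q(R_{\max},R_{\min},r,L)$ if, for $X\sim\mathcal{D}$: (1) $Q_q(\langle X,\theta\rangle)\in[-R_{\max},R_{\max}]$ for all $\theta\in\mathbb{S}^{d-1}$; (2) there is $c\in\mathbb{R}^d$ with $|Q_q(\langle X,\theta\rangle)-\langle c,\theta\rangle|\ge R_{\min}$ for all $\theta\in\mathbb{S}^{d-1}$; (3) for every $\theta\in\mathbb{S}^{d-1}$ the density $f_\theta$ of $\langle X,\theta\rangle$ exists and $f_\theta(t)\ge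 L$ for all $t\in[Q_q(\langle X,\theta\rangle)-r,Q_q(\langle X,\theta\rangle)+r]$; (4) if $X_1,\dots,X_n$ are i.i.d. from $\mathcal{D}$, then with high probability, namely at least $1-e^{-n}$, $\|X_i\|_2\le\mathfrak p(n,d)$ for all $i\in[n]$. **Privacy.** A randomized algorithm $\mathcal{A}$ on $(\mathbb{R}^d)^n$ is $\varepsilon$-differentially private if for all measurable subsets $S$ of the output space and all $X,X'\in(\mathbb{R}^d)^n$, $\mathbb{P}(\mathcal{A}(X)\in S)\le e^{\varepsilon d_H(X,X')}\mathbb{P}(\mathcal{A}(X')\in S)$, where $d_H(X,X')=|\{i:X_i\ne X_i'\}|$. **Asymptotic notation.** $\mathrm{poly}(\cdot)$ stands for fixed universal positive powers of its argument (possibly different in the two occurrences). $\tilde O$ omits multiplicative constants and logarithmic factors in all parameters: $n=\tilde O(g)$ means $n\le C\,g\,(\log(2+\Pi))^{C}$, where $\Pi$ is the sum of all numerical parameters of the problem and their reciprocals, and $C$ depends only on the polynomial $\mathfrak p$.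
   Formalization: The bound on n is claimed only when at least one distribution satisfies the hypotheses; otherwise (e.g. R_max=1, R_min→∞) the stated bound drops below 1 and no positive integer n can meet it, while the sampling guarantee is vacuous. *)

theory Defs
  imports "HOL-Probability.Probability" "HOL-Computational_Algebra.Polynomial"
begin

text \<open>
  The dimension \<open>d\<close> must range inside the scope of universal constants, so it cannot be a type.
  A vector of \<open>\<real>\<^sup>d\<close> is a function on \<open>{..<d}\<close>, extended by \<^const>\<open>undefined\<close>
  (an element of the space of \<open>rvec d\<close>), and \<open>rvec d\<close> carries the Borel sets.
\<close>

definition rvec :: "nat \<Rightarrow> (nat \<Rightarrow> real) measure" where
  "rvec d = PiM {..<d} (\<lambda>_. borel)"

definition lebesgue_rvec :: "nat \<Rightarrow> (nat \<Rightarrow> real) measure" where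
  "lebesgue_rvec d = PiM {..<d} (\<lambda>_. lborel)"

definition vinner :: "nat \<Rightarrow> (nat \<Rightarrow> real) \<Rightarrow> (nat \<Rightarrow> real) \<Rightarrow> real" where
  "vinner d x y = (\<Sum>i<d. x i * y i)"

definition vnorm :: "nat \<Rightarrow> (nat \<Rightarrow> real) \<Rightarrow> real" where
  "vnorm d x = sqrt (\<Sum>i<d. (x i)\<^sup>2)"

definition vcball :: "nat \<Rightarrow> (nat \<Rightarrow> real) \<Rightarrow> real \<Rightarrow> (nat \<Rightarrow> real) set" where
  "vcball d c \<rho> = {x \<in> space (rvec d). vnorm d (\<lambda>i. x i - c i) \<le> \<rho>}"

definition vsphere :: "nat \<Rightarrow> (nat \<Rightarrow> real) set" where
  "vsphere d = {\<theta> \<in> space (rvec d). vnorm d \<theta> = 1}"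

definition quantile :: "'a measure \<Rightarrow> ('a \<Rightarrow> real) \<Rightarrow> real \<Rightarrow> real" where
  "quantile M Y q = Inf {t. measure M {\<omega> \<in> space M. Y \<omega> \<le> t} \<ge> q}"

definition floating_body :: "nat \<Rightarrow> real \<Rightarrow> (nat \<Rightarrow> real) measure \<Rightarrow> (nat \<Rightarrow> real) set" where
  "floating_body d q D =
     {x \<in> space (rvec d). \<forall>\<theta>\<in>vsphere d. vinner d x \<theta> \<le> quantile D (\<lambda>y. vinner d y \<theta>) q}"

text \<open>
  Maps of \<open>\<real>\<^sup>d\<close> into itself that preserve the inner product are automatically linear and
  bijective: these are the elements of the orthogonal group.
\<close>

definition orthogonal_maps :: "nat \<Rightarrow> ((nat \<Rightarrow> real) \<Rightarrow> (nat \<Rightarrow> real)) set" where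
  "orthogonal_maps d =
     {T \<in> space (rvec d) \<rightarrow> space (rvec d).
        \<forall>x\<in>space (rvec d). \<forall>y\<in>space (rvec d). vinner d (T x) (T y) = vinner d x y}"

definition sphere_haar :: "nat \<Rightarrow> (nat \<Rightarrow> real) measure" where
  "sphere_haar d =
     (THE \<sigma>. prob_space \<sigma> \<and> sets \<sigma> = sets (restrict_space (rvec d) (vsphere d)) \<and>
            (\<forall>T\<in>orthogonal_maps d. distr \<sigma> \<sigma> T = \<sigma>))"

definition support_fun :: "nat \<Rightarrow> (nat \<Rightarrow> real) set \<Rightarrow> (nat \<Rightarrow> real) \<Rightarrow> real" where
  "support_fun d K \<theta> = (SUP x\<in>K. vinner d x \<theta>)"

definition steiner_point :: "nat \<Rightarrow> (nat \<Rightarrow> real) set \<Rightarrow> (nat \<Rightarrow> real)" where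
  "steiner_point d K =
     (\<lambda>i\<in>{..<d}. real d * (LINT \<theta>|sphere_haar d. \<theta> i * support_fun d K \<theta>))"

definition ennsqrt :: "ennreal \<Rightarrow> ennreal" where
  "ennsqrt x = (if x = \<infinity> then \<infinity> else ennreal (sqrt (enn2real x)))"

definition couplings :: "'a measure \<Rightarrow> 'b measure \<Rightarrow> ('a \<times> 'b) measure set" where
  "couplings M N =
     {\<gamma>. sets \<gamma> = sets (M \<Otimes>\<^sub>M N) \<and> distr \<gamma> M fst = M \<and> distr \<gamma> N snd = N}"

definition W2 :: "nat \<Rightarrow> (nat \<Rightarrow> real) measure \<Rightarrow> (nat \<Rightarrow> real) measure \<Rightarrow> ennreal" where
  "W2 d M N = (INF \<gamma>\<in>couplings M N.
     ennsqrt (\<integral>\<^sup>+ (x, y). ennreal ((vnorm d (\<lambda>i. x i - y i))\<^sup>2) \<partial>\<gamma>))"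

text \<open>
  \<open>P\<close> is a polynomial in the sample size \<open>n\<close> with coefficients that are polynomials in \<open>d\<close>.
  A density is determined only up to null sets; the third condition asks that some version of it
  satisfies the lower bound everywhere on the interval.
\<close>

definition admissible ::
  "real poly poly \<Rightarrow> nat \<Rightarrow> real \<Rightarrow> real \<Rightarrow> real \<Rightarrow> real \<Rightarrow> real \<Rightarrow> (nat \<Rightarrow> real) measure set" where
  "admissible P d q Rmax Rmin r L =
     {D. prob_space D \<and> sets D = sets (rvec d) \<and>
         (\<forall>\<theta>\<in>vsphere d. quantile D (\<lambda>x. vinner d x \<theta>) q \<in> {-Rmax..Rmax}) \<and>
         (\<exists>c\<in>space (rvec d). \<forall>\<theta>\<in>vsphere d.
            \<bar>quantile D (\<lambda>x. vinner d x \<theta>) q - vinner d c \<theta>\<bar> \<ge> Rmin) \<and>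
         (\<forall>\<theta>\<in>vsphere d. \<exists>f. distributed D lborel (\<lambda>x. vinner d x \<theta>) f \<and>
            (\<forall>t\<in>{quantile D (\<lambda>x. vinner d x \<theta>) q - r .. quantile D (\<lambda>x. vinner d x \<theta>) q + r}.
               f t \<ge> ennreal L)) \<and>
         (\<forall>n\<ge>1. measure (PiM {..<n} (\<lambda>_. D))
            {X \<in> space (PiM {..<n} (\<lambda>_. D)).
               \<forall>i<n. vnorm d (X i) \<le> poly (poly P [:real n:]) (real d)}
            \<ge> 1 - exp (- real n))}"

text \<open>
  A randomized algorithm maps a data set to the law of its output; measurability makes the law of
  the output on random data meaningful.
\<close>

definition randomized_algorithms ::
  "nat \<Rightarrow> nat \<Rightarrow> ((nat \<Rightarrow> nat \<Rightarrow> real) \<Rightarrow> (nat \<Rightarrow> real) measure) set" where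
  "randomized_algorithms n d = measurable (PiM {..<n} (\<lambda>_. rvec d)) (prob_algebra (rvec d))"

definition hamming_dist :: "nat \<Rightarrow> (nat \<Rightarrow> 'a) \<Rightarrow> (nat \<Rightarrow> 'a) \<Rightarrow> nat" where
  "hamming_dist n X X' = card {i. i < n \<and> X i \<noteq> X' i}"

definition differentially_private ::
  "nat \<Rightarrow> nat \<Rightarrow> real \<Rightarrow> ((nat \<Rightarrow> nat \<Rightarrow> real) \<Rightarrow> (nat \<Rightarrow> real) measure) \<Rightarrow> bool" where
  "differentially_private n d \<epsilon> \<A> \<longleftrightarrow>
     (\<forall>S\<in>sets (rvec d). \<forall>X\<in>space (PiM {..<n} (\<lambda>_. rvec d)). \<forall>X'\<in>space (PiM {..<n} (\<lambda>_. rvec d)).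
        measure (\<A> X) S \<le> exp (\<epsilon> * real (hamming_dist n X X')) * measure (\<A> X') S)"

definition output_law ::
  "nat \<Rightarrow> ((nat \<Rightarrow> nat \<Rightarrow> real) \<Rightarrow> (nat \<Rightarrow> real) measure) \<Rightarrow> (nat \<Rightarrow> real) measure \<Rightarrow> (nat \<Rightarrow> real) measure"
  where "output_law n \<A> D = PiM {..<n} (\<lambda>_. D) \<bind> \<A>"

definition uniform_law :: "nat \<Rightarrow> (nat \<Rightarrow> real) set \<Rightarrow> (nat \<Rightarrow> real) measure" where
  "uniform_law d K = uniform_measure (lebesgue_rvec d) K"

text \<open>
  The bound expressed by a soft-O of \<open>g\<close>: constants and logarithmic factors in the listed parameters.
\<close>

definition soft_O :: "real \<Rightarrow> real list \<Rightarrow> real \<Rightarrow> real" where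
  "soft_O C params g = C * g * (ln (2 + (\<Sum>x\<leftarrow>params. x + 1 / x))) powr C"

end

theory Submission
  imports Defs
begin

text \<open>
  The algorithm is the exponential mechanism for halfspace depth. On a data set \<open>X\<close> it returns a point
  of the ball of radius \<open>Rmax\<close> with density proportional to \<open>exp (- \<epsilon> / 2 * u X x)\<close>, where \<open>u X x\<close> says by
  how much the depth of \<open>x\<close> in the sample falls short of \<open>n * (1 - q)\<close>. Depth is tested only in the
  directions of a finite net \<open>\<Theta>\<close> of the sphere. Changing one data point changes \<open>u\<close> by at most one, and
  this gives privacy (\<open>exponential_mechanism_private\<close>, \<open>depth_excess_sensitivity\<close>).

  For accuracy let \<open>Q \<theta>\<close> be the \<open>q\<close>-quantile of the marginal in direction \<open>\<theta>\<close>. Since the marginals have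
  density at least \<open>L\<close> near \<open>Q \<theta>\<close>, their distribution functions are at most \<open>q - L t / 2\<close> at \<open>Q \<theta> - t\<close> and
  at least \<open>q + L t / 2\<close> at \<open>Q \<theta> + t\<close>. Hoeffding's inequality at these two thresholds for each \<open>\<theta>\<close> in
  \<open>\<Theta>\<close> shows that, with high probability, the score vanishes where all constraints hold with margin
  \<open>t\<close> and is at least \<open>n L t / 4\<close> where one of them fails by more than \<open>t\<close> (\<open>prob_typical_samples\<close>,
  \<open>depth_excess_on_typical_samples\<close>). The tail bound on the norm makes quantiles of nearby directions
  close, so that the finitely many constraints of \<open>\<Theta>\<close> describe the floating body up to \<open>2 t\<close>
  (\<open>outer_polytope_margin\<close>). Because the floating body contains a ball of radius \<open>Rmin\<close>, a margin of \<open>2 t\<close>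
  is gained by a homothety of ratio \<open>1 - \<mu>\<close> with \<open>\<mu> = 2 t / Rmin\<close>. The output density is therefore
  constant on a slightly shrunk copy of the floating body, and almost all of its mass lies in a slightly
  enlarged one. So the output law and the uniform law share a common part of mass at least
  \<open>1 - 4 d \<mu>\<close>, and moving that part along the diagonal leaves a cost of at most \<open>4 d \<mu> (2 Rmax)\<^sup>2\<close> in squared
  distance (\<open>coupling_of_common_part\<close>, \<open>W2_depth_mechanism\<close>). The choice
  \<open>t = \<alpha> Rmin / (32 R\<^sup>2)\<close>, \<open>R = Rmax + r + 1\<close>, turns this into \<open>d \<alpha>\<close>.

  The failure probability and the mass far from the floating body both have the form
  \<open>A\<^sup>d exp (- B)\<close> with \<open>A\<close> polynomial in the parameters. They are negligible as soon as
  \<open>n\<close> is of order \<open>d / (L t)\<^sup>2 + d / (\<epsilon> L t)\<close> up to a logarithm. The first summand is dominated by the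
  first term of the claimed bound, the second by the geometric mean of the first two terms
  (\<open>sample_size_le\<close>).
\<close>

section \<open>Geometry and Lebesgue measure in coordinates\<close>

lemma space_rvec: "space (rvec d) = extensional {..<d}"
  by (simp add: rvec_def space_PiM PiE_UNIV_domain PiE_def)

lemma sets_lebesgue_rvec [simp, measurable_cong]: "sets (lebesgue_rvec d) = sets (rvec d)"
  unfolding lebesgue_rvec_def rvec_def by (intro sets_PiM_cong) auto

lemma space_lebesgue_rvec [simp]: "space (lebesgue_rvec d) = space (rvec d)"
  by (rule sets_eq_imp_space_eq) simp

lemma sigma_finite_lebesgue_rvec: "sigma_finite_measure (lebesgue_rvec d)"
proof -
  interpret product_sigma_finite "\<lambda>_::nat. lborel :: real measure" ..
  show ?thesis unfolding lebesgue_rvec_def by (rule sigma_finite) simp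
qed

lemma emeasure_lebesgue_box:
  assumes "\<And>i. i < d \<Longrightarrow> A i \<in> sets borel"
  shows "emeasure (lebesgue_rvec d) (Pi\<^sub>E {..<d} A) = (\<Prod>i<d. emeasure lborel (A i))"
proof -
  interpret product_sigma_finite "\<lambda>_::nat. lborel :: real measure" ..
  show ?thesis unfolding lebesgue_rvec_def by (rule emeasure_PiM) (use assms in auto)
qed

lemma measurable_coord [measurable]: "i < d \<Longrightarrow> (\<lambda>x. x i) \<in> borel_measurable (rvec d)"
  unfolding rvec_def by (rule measurable_component_singleton) simp

lemma measurable_vinner [measurable]:
  assumes "f \<in> M \<rightarrow>\<^sub>M rvec d" "g \<in> M \<rightarrow>\<^sub>M rvec d"
  shows "(\<lambda>x. vinner d (f x) (g x)) \<in> borel_measurable M"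
  unfolding vinner_def
  by (intro borel_measurable_sum borel_measurable_times
        measurable_compose[OF assms(1) measurable_coord] measurable_compose[OF assms(2) measurable_coord]) auto

lemma vnorm_eq_L2: "vnorm d x = L2_set x {..<d}"
  by (simp add: vnorm_def L2_set_def)

lemma vnorm_nonneg [simp]: "0 \<le> vnorm d x"
  by (simp add: vnorm_eq_L2)

lemma vnorm_triangle: "vnorm d (\<lambda>i. x i - y i) \<le> vnorm d x + vnorm d y"
  using L2_set_triangle_ineq[of x "\<lambda>i. - y i" "{..<d}"]
  by (simp add: vnorm_eq_L2 L2_set_def)

lemma vinner_le_vnorm: "\<bar>vinner d x y\<bar> \<le> vnorm d x * vnorm d y"
proof -
  have "\<bar>vinner d x y\<bar> \<le> (\<Sum>i<d. \<bar>x i\<bar> * \<bar>y i\<bar>)"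
    unfolding vinner_def by (intro order.trans[OF sum_abs]) (simp add: abs_mult)
  also have "\<dots> \<le> vnorm d x * vnorm d y"
    unfolding vnorm_eq_L2 by (rule L2_set_mult_ineq)
  finally show ?thesis .
qed

lemma vinner_self: "vinner d x x = (vnorm d x)\<^sup>2"
  by (simp add: vinner_def vnorm_def sum_nonneg flip: power2_eq_square)

lemma vinner_diff_right: "vinner d x (\<lambda>i. y i - z i) = vinner d x y - vinner d x z"
  by (simp add: vinner_def algebra_simps sum_subtractf)

lemma coord_le_vnorm: "i < d \<Longrightarrow> \<bar>x i\<bar> \<le> vnorm d x"
  unfolding vnorm_eq_L2 using member_le_L2_set[of "{..<d}" i "\<lambda>i. \<bar>x i\<bar>"]
  by (simp add: L2_set_def)

lemma vnorm_le_of_coords: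
  assumes "\<And>i. i < d \<Longrightarrow> \<bar>x i\<bar> \<le> e" "0 \<le> e"
  shows "vnorm d x \<le> real d * e"
proof -
  have "vnorm d x \<le> (\<Sum>i<d. \<bar>x i\<bar>)" unfolding vnorm_eq_L2 by (rule L2_set_le_sum_abs)
  also have "\<dots> \<le> (\<Sum>i<d. e)" by (intro sum_mono) (use assms in auto)
  finally show ?thesis by simp
qed

text \<open>
  Rounding down the coordinates of \<open>k \<theta>\<close> splits the sphere into at most \<open>(2 k + 1)\<^sup>d\<close> cells. The net
  consists of one point of the sphere from each nonempty cell, and not of grid points, because the
  hypotheses on a law only speak about unit directions.
\<close>

lemma sphere_net:
  assumes "0 < k"
  obtains \<Theta> where "finite \<Theta>" "\<Theta> \<subseteq> vsphere d" "card \<Theta> \<le> (2 * k + 1) ^ d"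
    "\<And>\<theta>. \<theta> \<in> vsphere d \<Longrightarrow> \<exists>\<theta>'\<in>\<Theta>. vnorm d (\<lambda>i. \<theta> i - \<theta>' i) \<le> real d / real k"
proof -
  define cell where "cell \<theta> = (\<lambda>i\<in>{..<d}. \<lfloor>real k * \<theta> i\<rfloor>)" for \<theta> :: "nat \<Rightarrow> real"
  define rep where "rep v = (SOME \<theta>. \<theta> \<in> vsphere d \<and> cell \<theta> = v)" for v
  define \<Theta> where "\<Theta> = rep ` (cell ` vsphere d)"
  have rep: "rep (cell \<theta>) \<in> vsphere d \<and> cell (rep (cell \<theta>)) = cell \<theta>" if "\<theta> \<in> vsphere d" for \<theta>
    unfolding rep_def by (rule someI[of _ \<theta>]) (use that in auto)
  have sub: "cell ` vsphere d \<subseteq> (\<Pi>\<^sub>E i\<in>{..<d}. {- int k..int k})"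
  proof (intro subsetI, elim imageE)
    fix v \<theta> assume \<theta>: "v = cell \<theta>" "\<theta> \<in> vsphere d"
    have "\<lfloor>real k * \<theta> i\<rfloor> \<in> {- int k..int k}" if "i < d" for i
    proof -
      have "\<bar>\<theta> i\<bar> \<le> 1" using coord_le_vnorm[OF that, of \<theta>] \<theta> by (simp add: vsphere_def)
      then have "\<bar>real k * \<theta> i\<bar> \<le> real k" by (simp add: abs_mult mult_left_le)
      then have "- real k \<le> real k * \<theta> i" "real k * \<theta> i \<le> real k" by auto
      then show ?thesis by (auto simp: le_floor_iff floor_le_iff)
    qed
    then show "v \<in> (\<Pi>\<^sub>E i\<in>{..<d}. {- int k..int k})" using \<theta> by (auto simp: cell_def)
  qed
  have fin: "finite (\<Pi>\<^sub>E i\<in>{..<d}. {- int k..int k})" by (intro finite_PiE) auto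
  have "card (cell ` vsphere d) \<le> card (\<Pi>\<^sub>E i\<in>{..<d}. {- int k..int k})"
    by (rule card_mono[OF fin sub])
  also have "\<dots> = (2 * k + 1) ^ d" by (simp add: card_PiE nat_add_distrib nat_mult_distrib)
  finally have "card \<Theta> \<le> (2 * k + 1) ^ d"
    unfolding \<Theta>_def using card_image_le[OF finite_subset[OF sub fin], of rep] by linarith
  moreover have "finite \<Theta>" unfolding \<Theta>_def by (intro finite_imageI finite_subset[OF sub fin])
  moreover have "\<Theta> \<subseteq> vsphere d" unfolding \<Theta>_def using rep by auto
  moreover have "\<exists>\<theta>'\<in>\<Theta>. vnorm d (\<lambda>i. \<theta> i - \<theta>' i) \<le> real d / real k" if \<theta>: "\<theta> \<in> vsphere d" for \<theta>
  proof
    show "rep (cell \<theta>) \<in> \<Theta>" using \<theta> by (auto simp: \<Theta>_def)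
    have "\<bar>\<theta> i - rep (cell \<theta>) i\<bar> \<le> 1 / real k" if "i < d" for i
    proof -
      have "\<lfloor>real k * \<theta> i\<rfloor> = \<lfloor>real k * rep (cell \<theta>) i\<rfloor>"
        using rep[OF \<theta>] that by (auto simp: cell_def fun_eq_iff split: if_splits)
      then have "\<bar>real k * \<theta> i - real k * rep (cell \<theta>) i\<bar> \<le> 1" by linarith
      then have "real k * \<bar>\<theta> i - rep (cell \<theta>) i\<bar> \<le> 1"
        by (simp add: abs_mult flip: right_diff_distrib)
      then show ?thesis using assms by (simp add: field_simps)
    qed
    then show "vnorm d (\<lambda>i. \<theta> i - rep (cell \<theta>) i) \<le> real d / real k"
      using vnorm_le_of_coords[of d "\<lambda>i. \<theta> i - rep (cell \<theta>) i" "1 / real k"] by simp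
  qed
  ultimately show thesis by (intro that)
qed

text \<open>
  The homothety with centre \<open>c\<close> and ratio \<open>s\<close>, as a map into functions that are undefined outside \<open>{..<d}\<close>.
\<close>

definition vdilate :: "nat \<Rightarrow> (nat \<Rightarrow> real) \<Rightarrow> real \<Rightarrow> (nat \<Rightarrow> real) \<Rightarrow> (nat \<Rightarrow> real)" where
  "vdilate d c s x = (\<lambda>i\<in>{..<d}. c i + s * (x i - c i))"

lemma vdilate_space [simp]: "vdilate d c s x \<in> space (rvec d)"
  by (simp add: vdilate_def space_rvec)

lemma measurable_vdilate [measurable]: "vdilate d c s \<in> rvec d \<rightarrow>\<^sub>M rvec d"
proof -
  have "(\<lambda>x. \<lambda>i\<in>{..<d}. c i + s * (x i - c i)) \<in> rvec d \<rightarrow>\<^sub>M PiM {..<d} (\<lambda>_. borel)"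
    by (intro measurable_restrict borel_measurable_add borel_measurable_times borel_measurable_diff
        borel_measurable_const measurable_coord) auto
  moreover have "vdilate d c s = (\<lambda>x. \<lambda>i\<in>{..<d}. c i + s * (x i - c i))"
    by (simp add: vdilate_def fun_eq_iff)
  ultimately show ?thesis by (simp add: rvec_def)
qed

lemma vinner_vdilate: "vinner d (vdilate d c s x) \<theta> = (1 - s) * vinner d c \<theta> + s * vinner d x \<theta>"
proof -
  have "(\<Sum>i<d. (c i + s * (x i - c i)) * \<theta> i) = (1 - s) * (\<Sum>i<d. c i * \<theta> i) + s * (\<Sum>i<d. x i * \<theta> i)"
    by (simp add: sum_distrib_left algebra_simps sum.distrib sum_subtractf)
  then show ?thesis by (simp add: vinner_def vdilate_def)
qed

lemma vdilate_inverse: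
  assumes "s \<noteq> 0" "x \<in> space (rvec d)"
  shows "vdilate d c s (vdilate d c (1 / s) x) = x"
  using assms by (auto simp: vdilate_def space_rvec extensional_def fun_eq_iff)

lemma emeasure_lborel_affine_vimage:
  fixes s a :: real
  assumes "s > 0" "A \<in> sets borel"
  shows "ennreal s * emeasure lborel ((\<lambda>x. a + s * (x - a)) -` A) = emeasure lborel A"
proof -
  have "emeasure lborel A =
      emeasure (density (distr lborel borel (\<lambda>x. (a - s * a) + s * x)) (\<lambda>_. ennreal \<bar>s\<bar>)) A"
    using lborel_real_affine[of s "a - s * a"] assms by simp
  also have "\<dots> = ennreal s * emeasure (distr lborel borel (\<lambda>x. (a - s * a) + s * x)) A"
    using assms by (subst emeasure_density_const) auto
  also have "\<dots> = ennreal s * emeasure lborel ((\<lambda>x. (a - s * a) + s * x) -` A)"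
    using assms by (subst emeasure_distr) auto
  finally show ?thesis by (simp add: algebra_simps)
qed

text \<open>
  The scaling holds on boxes, one coordinate at a time, and boxes determine a product measure. Preimages
  are used in place of images because they are measurable without further argument.
\<close>

lemma emeasure_vdilate_vimage:
  assumes s: "s > 0" and F: "F \<in> sets (rvec d)"
  shows "ennreal (s ^ d) * emeasure (lebesgue_rvec d) (vdilate d c s -` F \<inter> space (rvec d))
    = emeasure (lebesgue_rvec d) F"
proof -
  interpret product_sigma_finite "\<lambda>_::nat. lborel :: real measure" ..
  let ?T = "vdilate d c s"
  define Q where "Q = scale_measure (ennreal (s ^ d)) (distr (lebesgue_rvec d) (rvec d) ?T)"
  have T: "?T \<in> lebesgue_rvec d \<rightarrow>\<^sub>M rvec d" by measurable
  have eQ: "emeasure Q A = ennreal (s ^ d) * emeasure (lebesgue_rvec d) (?T -` A \<inter> space (rvec d))"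
    if "A \<in> sets (rvec d)" for A
    using that T by (simp add: Q_def emeasure_distr)
  have "Q = PiM {..<d} (\<lambda>_. lborel)"
  proof (rule PiM_eqI)
    show "sets Q = sets (PiM {..<d} (\<lambda>_. lborel))"
      using sets_lebesgue_rvec[of d] unfolding lebesgue_rvec_def by (simp add: Q_def)
    fix A :: "nat \<Rightarrow> real set" assume "\<And>i. i \<in> {..<d} \<Longrightarrow> A i \<in> sets lborel"
    then have A: "A i \<in> sets borel" if "i < d" for i using that by auto
    let ?f = "\<lambda>i x. c i + s * (x - c i)"
    have box: "Pi\<^sub>E {..<d} A \<in> sets (rvec d)"
      unfolding rvec_def using A by (intro sets_PiM_I_finite) auto
    have "?T -` (Pi\<^sub>E {..<d} A) \<inter> space (rvec d) = Pi\<^sub>E {..<d} (\<lambda>i. ?f i -` A i)"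
      by (auto simp: vdilate_def space_rvec PiE_def Pi_iff)
    moreover have "?f i -` A i \<in> sets borel" if "i < d" for i
      using A[OF that] by (intro measurable_sets_borel[of _ borel]) auto
    ultimately have "emeasure Q (Pi\<^sub>E {..<d} A)
        = ennreal (s ^ d) * (\<Prod>i<d. emeasure lborel (?f i -` A i))"
      using box by (simp add: eQ emeasure_lebesgue_box)
    also have "\<dots> = (\<Prod>i<d. ennreal s * emeasure lborel (?f i -` A i))"
      using s by (simp add: prod.distrib ennreal_power)
    also have "\<dots> = (\<Prod>i<d. emeasure lborel (A i))"
      by (intro prod.cong refl emeasure_lborel_affine_vimage s A) auto
    finally show "emeasure Q (Pi\<^sub>E {..<d} A) = (\<Prod>i\<in>{..<d}. emeasure lborel (A i))" .
  qed simp
  then show ?thesis using eQ[OF F] by (simp add: lebesgue_rvec_def)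
qed

lemma emeasure_lebesgue_cube:
  assumes "0 \<le> e"
  shows "emeasure (lebesgue_rvec d) (\<Pi>\<^sub>E i\<in>{..<d}. {c i - e..c i + e}) = ennreal ((2 * e) ^ d)"
  using assms by (subst emeasure_lebesgue_box) (auto simp: ennreal_power)

lemma measurable_vnorm_diff [measurable]:
  assumes "f \<in> M \<rightarrow>\<^sub>M rvec d" "g \<in> M \<rightarrow>\<^sub>M rvec d"
  shows "(\<lambda>x. vnorm d (\<lambda>i. f x i - g x i)) \<in> borel_measurable M"
  unfolding vnorm_def
  by (rule measurable_compose[OF _ borel_measurable_sqrt])
     (intro borel_measurable_sum borel_measurable_diff borel_measurable_power
        measurable_compose[OF assms(1) measurable_coord] measurable_compose[OF assms(2) measurable_coord];
      simp)

lemma measurable_vnorm [measurable]: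
  assumes "f \<in> M \<rightarrow>\<^sub>M rvec d"
  shows "(\<lambda>x. vnorm d (f x)) \<in> borel_measurable M"
  unfolding vnorm_def
  by (rule measurable_compose[OF _ borel_measurable_sqrt])
     (intro borel_measurable_sum borel_measurable_power
        measurable_compose[OF assms(1) measurable_coord]; simp)

lemma sets_vcball [measurable]: "vcball d (\<lambda>_. 0) e \<in> sets (rvec d)"
  unfolding vcball_def by simp

text \<open>
  Together with \<open>emeasure_vcball_ge\<close> this compares balls with cubes. The comparison loses a factor of order
  \<open>d\<close> per dimension, which only matters under a logarithm.
\<close>

lemma emeasure_vcball_le:
  assumes "0 \<le> e"
  shows "emeasure (lebesgue_rvec d) (vcball d (\<lambda>_. 0) e) \<le> ennreal ((2 * e) ^ d)"
proof -
  have "vcball d (\<lambda>_. 0) e \<subseteq> (\<Pi>\<^sub>E i\<in>{..<d}. {0 - e..0 + e})"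
  proof
    fix x assume x: "x \<in> vcball d (\<lambda>_. 0) e"
    have "\<bar>x i\<bar> \<le> e" if "i < d" for i
      using coord_le_vnorm[OF that, of x] x by (simp add: vcball_def)
    then show "x \<in> (\<Pi>\<^sub>E i\<in>{..<d}. {0 - e..0 + e})"
      using x by (auto simp: vcball_def space_rvec PiE_def abs_le_iff minus_le_iff)
  qed
  moreover have "(\<Pi>\<^sub>E i\<in>{..<d}. {0 - e..0 + e}) \<in> sets (rvec d)"
    unfolding rvec_def by (intro sets_PiM_I_finite) auto
  ultimately show ?thesis
    using emeasure_mono[of "vcball d (\<lambda>_. 0) e" "\<Pi>\<^sub>E i\<in>{..<d}. {0 - e..0 + e}" "lebesgue_rvec d"]
      emeasure_lebesgue_cube[OF assms, of d "\<lambda>_. 0"] by simp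
qed

lemma emeasure_vcball_ge:
  assumes "0 \<le> e" "vcball d c e \<subseteq> F" "F \<in> sets (rvec d)" "1 \<le> d"
  shows "ennreal ((2 * e / real d) ^ d) \<le> emeasure (lebesgue_rvec d) F"
proof -
  let ?b = "\<Pi>\<^sub>E i\<in>{..<d}. {c i - e / real d..c i + e / real d}"
  have "?b \<subseteq> vcball d c e"
  proof
    fix x assume x: "x \<in> ?b"
    have "\<bar>x i - c i\<bar> \<le> e / real d" if "i < d" for i
    proof -
      have "x i \<in> {c i - e / real d..c i + e / real d}" using PiE_mem[OF x, of i] that by simp
      then show ?thesis unfolding abs_le_iff atLeastAtMost_iff by linarith
    qed
    then have "vnorm d (\<lambda>i. x i - c i) \<le> real d * (e / real d)"
      using assms(1) by (intro vnorm_le_of_coords) simp_all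
    moreover have "x \<in> space (rvec d)" using x by (simp add: space_rvec PiE_def)
    ultimately show "x \<in> vcball d c e" using assms(4) by (simp add: vcball_def)
  qed
  then have "emeasure (lebesgue_rvec d) ?b \<le> emeasure (lebesgue_rvec d) F"
    using assms(2,3) by (intro emeasure_mono) auto
  moreover have "emeasure (lebesgue_rvec d) ?b = ennreal ((2 * (e / real d)) ^ d)"
    by (rule emeasure_lebesgue_cube) (use assms(1) in simp)
  ultimately show ?thesis by simp
qed

section \<open>Couplings of laws with a common part\<close>

definition add_measure :: "'a measure \<Rightarrow> 'a measure \<Rightarrow> 'a measure" where
  "add_measure M N = measure_of (space M) (sets M) (\<lambda>A. emeasure M A + emeasure N A)"

lemma sets_add_measure [simp]: "sets (add_measure M N) = sets M"
  and space_add_measure [simp]: "space (add_measure M N) = space M"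
  by (simp_all add: add_measure_def)

lemma emeasure_add_measure:
  assumes "sets N = sets M" "A \<in> sets M"
  shows "emeasure (add_measure M N) A = emeasure M A + emeasure N A"
  unfolding add_measure_def
proof (rule emeasure_measure_of_sigma)
  show "sigma_algebra (space M) (sets M)" ..
  show "positive (sets M) (\<lambda>A. emeasure M A + emeasure N A)" by (simp add: positive_def)
  show "countably_additive (sets M) (\<lambda>A. emeasure M A + emeasure N A)"
  proof (rule countably_additiveI)
    fix A :: "nat \<Rightarrow> 'a set" assume A: "range A \<subseteq> sets M" "disjoint_family A"
    have "(\<Sum>i. emeasure M (A i) + emeasure N (A i)) = (\<Sum>i. emeasure M (A i)) + (\<Sum>i. emeasure N (A i))"
      by (intro suminf_add[symmetric]) auto
    also have "\<dots> = emeasure M (\<Union>i. A i) + emeasure N (\<Union>i. A i)"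
      using A assms by (simp add: suminf_emeasure)
    finally show "(\<Sum>i. emeasure M (A i) + emeasure N (A i)) = emeasure M (\<Union>i. A i) + emeasure N (\<Union>i. A i)" .
  qed
qed fact

text \<open>
  The common part \<open>w\<close> is moved along the diagonal, at no cost. The remainders \<open>M - w\<close> and \<open>N - w\<close> have equal
  mass, at most \<open>\<beta>\<close>, and are coupled independently; each unit of their mass pays at most \<open>C\<close>.
\<close>

lemma coupling_of_common_part:
  fixes c :: "'a \<times> 'a \<Rightarrow> ennreal"
  assumes "prob_space M" "prob_space N" "sets N = sets M" "sets w = sets M"
    and wM: "\<And>A. A \<in> sets M \<Longrightarrow> emeasure w A \<le> emeasure M A"
    and wN: "\<And>A. A \<in> sets M \<Longrightarrow> emeasure w A \<le> emeasure N A"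
    and w1: "1 - \<beta> \<le> emeasure w (space M)"
    and c: "c \<in> borel_measurable (M \<Otimes>\<^sub>M M)" "\<And>x. c (x, x) = 0"
    and B: "B \<in> sets M" "emeasure M B = 1" "emeasure N B = 1"
    and C: "\<And>x y. x \<in> B \<Longrightarrow> y \<in> B \<Longrightarrow> c (x, y) \<le> C"
  shows "\<exists>\<gamma>\<in>couplings M N. (\<integral>\<^sup>+p. c p \<partial>\<gamma>) \<le> C * \<beta>"
proof -
  interpret M: prob_space M by fact
  interpret N: prob_space N by fact
  have sp: "space N = space M" "space w = space M"
    using assms(3,4) by (auto dest: sets_eq_imp_space_eq)
  interpret w: finite_measure w
  proof
    show "emeasure w (space w) \<noteq> \<infinity>"
      using wM[of "space M"] M.emeasure_space_1 by (auto simp: sp top_unique)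
  qed
  define M' where "M' = diff_measure M w"
  define N' where "N' = diff_measure N w"
  define b where "b = 1 - emeasure w (space M)"
  have b: "b \<le> \<beta>"
    using w1 unfolding b_def
    by (metis add.commute ennreal_minus_le_iff ennreal_one_neq_top)
  have eM': "emeasure M' A = emeasure M A - emeasure w A" if "A \<in> sets M" for A
    unfolding M'_def using that assms(4) wM
    by (intro emeasure_diff_measure) (auto simp: M.finite_measure_axioms w.finite_measure_axioms)
  have eN': "emeasure N' A = emeasure N A - emeasure w A" if "A \<in> sets M" for A
    unfolding N'_def using that assms(3,4) wN
    by (intro emeasure_diff_measure) (auto simp: N.finite_measure_axioms w.finite_measure_axioms)
  have sM': "sets M' = sets M" "sets N' = sets M" "space M' = space M" "space N' = space M"
    using assms(3) sp by (auto simp: M'_def N'_def)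
  have bM: "emeasure M' (space M) = b"
    by (simp add: eM' b_def M.emeasure_space_1)
  have bN: "emeasure N' (space M) = b"
    using N.emeasure_space_1 by (simp add: eN' b_def sp)
  have bfin: "b \<noteq> \<top>" by (simp add: b_def)
  interpret M': finite_measure M' by standard (use bM bfin in \<open>simp add: sM'\<close>)
  interpret N': finite_measure N' by standard (use bN bfin in \<open>simp add: sM'\<close>)
  interpret P: pair_sigma_finite M' N' ..
  define \<gamma>1 where "\<gamma>1 = distr w (M \<Otimes>\<^sub>M M) (\<lambda>x. (x, x))"
  define \<gamma>2 where "\<gamma>2 = scale_measure (1 / b) (M' \<Otimes>\<^sub>M N')"
  define \<gamma> where "\<gamma> = add_measure \<gamma>1 \<gamma>2"
  have diag: "(\<lambda>x. (x, x)) \<in> w \<rightarrow>\<^sub>M M \<Otimes>\<^sub>M M"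
    using assms(4) by (intro measurable_Pair measurable_ident_sets) auto
  have sMN: "sets (M' \<Otimes>\<^sub>M N') = sets (M \<Otimes>\<^sub>M M)"
    by (intro sets_pair_measure_cong sM')
  have s\<gamma>: "sets \<gamma> = sets (M \<Otimes>\<^sub>M M)" by (simp add: \<gamma>_def \<gamma>1_def)
  have sp\<gamma>: "space \<gamma> = space M \<times> space M"
    using sets_eq_imp_space_eq[OF s\<gamma>] by (simp add: space_pair_measure)
  have e\<gamma>: "emeasure \<gamma> A = emeasure w {x \<in> space M. (x, x) \<in> A} + 1 / b * emeasure (M' \<Otimes>\<^sub>M N') A"
    if "A \<in> sets (M \<Otimes>\<^sub>M M)" for A
    using that sMN diag unfolding \<gamma>_def
    by (subst emeasure_add_measure)
       (auto simp: \<gamma>1_def \<gamma>2_def emeasure_distr sp vimage_def Int_def conj_commute)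
  \<comment> \<open>For \<open>b = 0\<close> the factor \<open>1 / b\<close> is infinite, but then \<open>x\<close> is zero and so is the product.\<close>
  have scale: "1 / b * (x * b) = x" if "x \<le> b" for x :: ennreal
  proof (cases "b = 0")
    case False
    then have "1 / b * (x * b) = x * b / b" by (simp add: ennreal_times_divide mult.commute)
    then show ?thesis using False bfin by (simp add: mult_divide_eq_ennreal)
  qed (use that in simp)
  have rect1: "emeasure \<gamma> (A \<times> space M) = emeasure M A" if A: "A \<in> sets M" for A
  proof -
    have "emeasure M' A \<le> b" using emeasure_space[of M' A] bM by (simp add: sM')
    moreover have "{x \<in> space M. (x, x) \<in> A \<times> space M} = A" using sets.sets_into_space[OF A] by auto
    moreover have "emeasure (M' \<Otimes>\<^sub>M N') (A \<times> space M) = emeasure M' A * b"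
      using A bN by (subst N'.emeasure_pair_measure_Times) (auto simp: sM')
    ultimately have "emeasure \<gamma> (A \<times> space M) = emeasure w A + emeasure M' A"
      using A by (subst e\<gamma>) (auto simp: scale)
    also have "\<dots> = emeasure M A" using wM[OF A] A by (simp add: eM' add_diff_inverse_ennreal)
    finally show ?thesis .
  qed
  have rect2: "emeasure \<gamma> (space M \<times> A) = emeasure N A" if A: "A \<in> sets M" for A
  proof -
    have "emeasure N' A \<le> b" using emeasure_space[of N' A] bN by (simp add: sM')
    moreover have "{x \<in> space M. (x, x) \<in> space M \<times> A} = A" using sets.sets_into_space[OF A] by auto
    moreover have "emeasure (M' \<Otimes>\<^sub>M N') (space M \<times> A) = emeasure N' A * b"
      using A bM by (subst N'.emeasure_pair_measure_Times) (auto simp: sM' mult.commute)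
    ultimately have "emeasure \<gamma> (space M \<times> A) = emeasure w A + emeasure N' A"
      using A by (subst e\<gamma>) (auto simp: scale)
    also have "\<dots> = emeasure N A" using wN[OF A] A by (simp add: eN' add_diff_inverse_ennreal)
    finally show ?thesis .
  qed
  have fst_eq: "distr \<gamma> M fst = M"
  proof (rule measure_eqI)
    fix A assume "A \<in> sets (distr \<gamma> M fst)"
    then have A: "A \<in> sets M" by simp
    have "fst -` A \<inter> space \<gamma> = A \<times> space M" using sets.sets_into_space[OF A] by (auto simp: sp\<gamma>)
    moreover have "fst \<in> \<gamma> \<rightarrow>\<^sub>M M" using measurable_cong_sets[OF s\<gamma> refl, of M] by (simp add: measurable_fst)
    ultimately show "emeasure (distr \<gamma> M fst) A = emeasure M A"
      using A by (simp add: emeasure_distr rect1)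
  qed simp
  have snd_eq: "distr \<gamma> N snd = N"
  proof (rule measure_eqI)
    fix A assume "A \<in> sets (distr \<gamma> N snd)"
    then have A: "A \<in> sets M" using assms(3) by simp
    have "snd -` A \<inter> space \<gamma> = space M \<times> A" using sets.sets_into_space[OF A] by (auto simp: sp\<gamma>)
    moreover have "snd \<in> \<gamma> \<rightarrow>\<^sub>M N" using measurable_cong_sets[OF s\<gamma> assms(3)] by (simp add: measurable_snd)
    ultimately show "emeasure (distr \<gamma> N snd) A = emeasure N A"
      using A assms(3) by (simp add: emeasure_distr rect2)
  qed simp
  have "\<gamma> \<in> couplings M N"
    using fst_eq snd_eq s\<gamma> assms(3) by (auto simp: couplings_def cong: sets_pair_measure_cong)
  moreover have "(\<integral>\<^sup>+p. c p \<partial>\<gamma>) \<le> C * \<beta>"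
  proof -
    \<comment> \<open>The cost vanishes on the diagonal, so only the independent part charges \<open>?D\<close>.\<close>
    let ?D = "{p \<in> space M \<times> space M. c p \<noteq> 0}"
    have D: "?D \<in> sets (M \<Otimes>\<^sub>M M)"
      using c(1) by (simp flip: space_pair_measure)
    have null: "emeasure M (space M - B) = 0" "emeasure N (space M - B) = 0"
      using B M.emeasure_space_1 N.emeasure_space_1
        emeasure_compl[of B M] emeasure_compl[of B N] by (auto simp: assms(3) sp)
    have "AE p in \<gamma>. fst p \<in> B"
    proof (rule AE_I')
      show "(space M - B) \<times> space M \<in> null_sets \<gamma>"
        using B(1) null by (auto simp: null_sets_def s\<gamma> rect1 sets.compl_sets)
      show "{p \<in> space \<gamma>. fst p \<notin> B} \<subseteq> (space M - B) \<times> space M" by (auto simp: sp\<gamma>)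
    qed
    moreover have "AE p in \<gamma>. snd p \<in> B"
    proof (rule AE_I')
      show "space M \<times> (space M - B) \<in> null_sets \<gamma>"
        using B(1) null by (auto simp: null_sets_def s\<gamma> rect2 sets.compl_sets)
      show "{p \<in> space \<gamma>. snd p \<notin> B} \<subseteq> space M \<times> (space M - B)" by (auto simp: sp\<gamma>)
    qed
    ultimately have "AE p in \<gamma>. c p \<le> C * indicator ?D p"
      using AE_space by eventually_elim (use C in \<open>auto simp: sp\<gamma> indicator_def split: if_splits\<close>)
    then have "(\<integral>\<^sup>+p. c p \<partial>\<gamma>) \<le> (\<integral>\<^sup>+p. C * indicator ?D p \<partial>\<gamma>)"
      by (rule nn_integral_mono_AE)
    also have "\<dots> = C * emeasure \<gamma> ?D"
      using D by (simp add: nn_integral_cmult_indicator s\<gamma>)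
    also have "emeasure \<gamma> ?D = 1 / b * emeasure (M' \<Otimes>\<^sub>M N') ?D"
      using D c(2) by (simp add: e\<gamma>)
    also have "\<dots> \<le> 1 / b * emeasure (M' \<Otimes>\<^sub>M N') (space M \<times> space M)"
      using sMN by (intro mult_left_mono emeasure_mono) (auto simp flip: space_pair_measure)
    also have "emeasure (M' \<Otimes>\<^sub>M N') (space M \<times> space M) = b * b"
      using bM bN by (subst N'.emeasure_pair_measure_Times) (auto simp: sM')
    also have "1 / b * (b * b) = b" by (rule scale) simp
    also have "C * b \<le> C * \<beta>" using b by (intro mult_left_mono) auto
    finally show ?thesis by (simp add: mult_left_mono)
  qed
  ultimately show ?thesis by blast
qed

section \<open>The exponential mechanism\<close>

lemma divide_left_antimono_ennreal: "b \<le> b' \<Longrightarrow> a / b' \<le> a / (b :: ennreal)"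
proof -
  assume "b \<le> b'"
  then have "inverse b' \<le> inverse b"
    by (cases b rule: ennreal_cases; cases b' rule: ennreal_cases; cases "b = 0")
       (auto simp: inverse_ennreal top_unique less_le intro!: le_imp_inverse_le ennreal_leI)
  then show ?thesis unfolding divide_ennreal_def by (rule mult_left_mono) simp
qed

text \<open>
  The unnormalized mass of \<open>S\<close>. The factor \<open>1 / 2\<close> in the exponent leaves one half of the privacy budget
  for the numerator and one half for the normalizer.
\<close>

definition gibbs_weight :: "'x measure \<Rightarrow> 'x set \<Rightarrow> real \<Rightarrow> ('x \<Rightarrow> real) \<Rightarrow> 'x set \<Rightarrow> ennreal" where
  "gibbs_weight \<nu> B \<epsilon> u S = (\<integral>\<^sup>+x. ennreal (exp (- (\<epsilon> / 2) * u x)) * indicator (S \<inter> B) x \<partial>\<nu>)"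

definition exponential_mechanism ::
  "'x measure \<Rightarrow> 'x set \<Rightarrow> real \<Rightarrow> ('d \<Rightarrow> 'x \<Rightarrow> real) \<Rightarrow> 'd \<Rightarrow> 'x measure" where
  "exponential_mechanism \<nu> B \<epsilon> u X =
     density \<nu> (\<lambda>x. ennreal (exp (- (\<epsilon> / 2) * u X x)) * indicator B x / gibbs_weight \<nu> B \<epsilon> (u X) B)"

lemma sets_exponential_mechanism [simp]: "sets (exponential_mechanism \<nu> B \<epsilon> u X) = sets \<nu>"
  by (simp add: exponential_mechanism_def)

lemma emeasure_exponential_mechanism:
  assumes [measurable]: "u X \<in> borel_measurable \<nu>" "B \<in> sets \<nu>" "S \<in> sets \<nu>"
  shows "emeasure (exponential_mechanism \<nu> B \<epsilon> u X) S
    = gibbs_weight \<nu> B \<epsilon> (u X) S / gibbs_weight \<nu> B \<epsilon> (u X) B"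
proof -
  have "emeasure (exponential_mechanism \<nu> B \<epsilon> u X) S =
      (\<integral>\<^sup>+x. ennreal (exp (- (\<epsilon> / 2) * u X x)) * indicator (S \<inter> B) x / gibbs_weight \<nu> B \<epsilon> (u X) B \<partial>\<nu>)"
    unfolding exponential_mechanism_def
    by (subst emeasure_density)
       (auto intro!: nn_integral_cong simp: indicator_def)
  also have "\<dots> = gibbs_weight \<nu> B \<epsilon> (u X) S / gibbs_weight \<nu> B \<epsilon> (u X) B"
    unfolding gibbs_weight_def by (subst nn_integral_divide) auto
  finally show ?thesis .
qed

lemma gibbs_weight_pos:
  assumes [measurable]: "u \<in> borel_measurable \<nu>" "B \<in> sets \<nu>" and "0 < emeasure \<nu> B"
  shows "0 < gibbs_weight \<nu> B \<epsilon> u B"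
proof (rule ccontr)
  assume "\<not> 0 < gibbs_weight \<nu> B \<epsilon> u B"
  then have "(\<integral>\<^sup>+x. ennreal (exp (- (\<epsilon> / 2) * u x)) * indicator (B \<inter> B) x \<partial>\<nu>) = 0"
    by (simp add: gibbs_weight_def)
  then have "AE x in \<nu>. ennreal (exp (- (\<epsilon> / 2) * u x)) * indicator (B \<inter> B) x = 0"
    by (subst (asm) nn_integral_0_iff_AE) auto
  then have "AE x in \<nu>. x \<notin> B"
    by eventually_elim (auto simp: indicator_def split: if_splits)
  then have "emeasure \<nu> B = 0"
    using AE_iff_null_sets[of B \<nu>] by (auto simp: null_sets_def)
  then show False using assms(3) by simp
qed

lemma gibbs_weight_le:
  assumes "B \<in> sets \<nu>" "S \<in> sets \<nu>" "0 \<le> \<epsilon>" "\<And>x. x \<in> B \<Longrightarrow> x \<in> S \<Longrightarrow> v \<le> u x"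
  shows "gibbs_weight \<nu> B \<epsilon> u S \<le> ennreal (exp (- (\<epsilon> / 2) * v)) * emeasure \<nu> (S \<inter> B)"
proof -
  have "gibbs_weight \<nu> B \<epsilon> u S \<le> (\<integral>\<^sup>+x. ennreal (exp (- (\<epsilon> / 2) * v)) * indicator (S \<inter> B) x \<partial>\<nu>)"
    unfolding gibbs_weight_def using assms(3,4)
    by (intro nn_integral_mono) (auto simp: indicator_def ennreal_leI mult_left_mono)
  also have "\<dots> = ennreal (exp (- (\<epsilon> / 2) * v)) * emeasure \<nu> (S \<inter> B)"
    using assms by (intro nn_integral_cmult_indicator) auto
  finally show ?thesis .
qed

lemma gibbs_weight_perturb:
  assumes [measurable]: "u' \<in> borel_measurable \<nu>" "B \<in> sets \<nu>" "S \<in> sets \<nu>" and "0 \<le> \<epsilon>"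
    and u: "\<And>x. x \<in> B \<Longrightarrow> u' x \<le> u x + h"
  shows "gibbs_weight \<nu> B \<epsilon> u S \<le> ennreal (exp (\<epsilon> * h / 2)) * gibbs_weight \<nu> B \<epsilon> u' S"
proof -
  have "exp (- (\<epsilon> / 2) * u x) \<le> exp (\<epsilon> * h / 2) * exp (- (\<epsilon> / 2) * u' x)" if "x \<in> B" for x
  proof -
    have "(\<epsilon> / 2) * u' x \<le> (\<epsilon> / 2) * (u x + h)" using u[OF that] \<open>0 \<le> \<epsilon>\<close> by (intro mult_left_mono) auto
    then show ?thesis by (simp add: algebra_simps flip: exp_add)
  qed
  then have "gibbs_weight \<nu> B \<epsilon> u S \<le>
      (\<integral>\<^sup>+x. ennreal (exp (\<epsilon> * h / 2)) * (ennreal (exp (- (\<epsilon> / 2) * u' x)) * indicator (S \<inter> B) x) \<partial>\<nu>)"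
    unfolding gibbs_weight_def
    by (intro nn_integral_mono) (auto simp: indicator_def ennreal_leI simp flip: ennreal_mult)
  also have "\<dots> = ennreal (exp (\<epsilon> * h / 2)) * gibbs_weight \<nu> B \<epsilon> u' S"
    unfolding gibbs_weight_def by (intro nn_integral_cmult) measurable
  finally show ?thesis .
qed

lemma gibbs_weight_fin:
  assumes "B \<in> sets \<nu>" "emeasure \<nu> B < \<infinity>" "0 \<le> \<epsilon>" "\<And>x. x \<in> B \<Longrightarrow> 0 \<le> u x"
  shows "gibbs_weight \<nu> B \<epsilon> u B < \<infinity>"
  using gibbs_weight_le[of B \<nu> B \<epsilon> 0 u] assms by (auto intro: le_less_trans)

lemma prob_space_exponential_mechanism:
  assumes [measurable]: "u X \<in> borel_measurable \<nu>" "B \<in> sets \<nu>" and "0 < emeasure \<nu> B" "emeasure \<nu> B < \<infinity>" 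
    "0 \<le> \<epsilon>" "\<And>x. x \<in> B \<Longrightarrow> 0 \<le> u X x"
  shows "prob_space (exponential_mechanism \<nu> B \<epsilon> u X)"
proof
  have "gibbs_weight \<nu> B \<epsilon> (u X) (space \<nu>) = gibbs_weight \<nu> B \<epsilon> (u X) B"
    using sets.sets_into_space[OF assms(2)] by (simp add: gibbs_weight_def Int_absorb1)
  moreover have "gibbs_weight \<nu> B \<epsilon> (u X) B \<noteq> 0" "gibbs_weight \<nu> B \<epsilon> (u X) B \<noteq> \<top>"
    using gibbs_weight_pos[of "u X" \<nu> B \<epsilon>] gibbs_weight_fin[of B \<nu> \<epsilon> "u X"] assms by auto
  moreover have "space (exponential_mechanism \<nu> B \<epsilon> u X) = space \<nu>"
    by (simp add: exponential_mechanism_def)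
  ultimately show "emeasure (exponential_mechanism \<nu> B \<epsilon> u X) (space (exponential_mechanism \<nu> B \<epsilon> u X)) = 1"
    using assms(1,2) by (simp add: emeasure_exponential_mechanism top.not_eq_extremum)
qed

lemma measurable_exponential_mechanism:
  assumes "sigma_finite_measure \<nu>" and u: "(\<lambda>(X, x). u X x) \<in> borel_measurable (N \<Otimes>\<^sub>M \<nu>)"
    and B [measurable]: "B \<in> sets \<nu>" and "0 < emeasure \<nu> B" "emeasure \<nu> B < \<infinity>" "0 \<le> \<epsilon>"
    "\<And>X x. X \<in> space N \<Longrightarrow> x \<in> B \<Longrightarrow> 0 \<le> u X x"
  shows "exponential_mechanism \<nu> B \<epsilon> u \<in> N \<rightarrow>\<^sub>M prob_algebra \<nu>"
proof -
  interpret \<nu>: sigma_finite_measure \<nu> by fact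
  have uX: "u X \<in> borel_measurable \<nu>" if "X \<in> space N" for X
    using measurable_Pair2[OF u that] by simp
  have w: "(\<lambda>X. gibbs_weight \<nu> B \<epsilon> (u X) S) \<in> borel_measurable N" if [measurable]: "S \<in> sets \<nu>" for S
  proof -
    note u [measurable]
    have "(\<lambda>(X, x). ennreal (exp (- (\<epsilon> / 2) * u X x)) * indicator (S \<inter> B) x) \<in> borel_measurable (N \<Otimes>\<^sub>M \<nu>)"
      by measurable
    then show ?thesis unfolding gibbs_weight_def by (rule \<nu>.borel_measurable_nn_integral)
  qed
  have "exponential_mechanism \<nu> B \<epsilon> u \<in> N \<rightarrow>\<^sub>M subprob_algebra \<nu>"
  proof (rule measurable_subprob_algebra)
    fix S assume S: "S \<in> sets \<nu>"
    have "(\<lambda>X. gibbs_weight \<nu> B \<epsilon> (u X) S / gibbs_weight \<nu> B \<epsilon> (u X) B) \<in> borel_measurable N"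
      by (intro borel_measurable_divide_ennreal w S B)
    then show "(\<lambda>X. emeasure (exponential_mechanism \<nu> B \<epsilon> u X) S) \<in> borel_measurable N"
      by (subst measurable_cong[where g="\<lambda>X. gibbs_weight \<nu> B \<epsilon> (u X) S / gibbs_weight \<nu> B \<epsilon> (u X) B"])
         (auto simp: emeasure_exponential_mechanism uX B S)
  next
    fix X assume "X \<in> space N"
    then show "subprob_space (exponential_mechanism \<nu> B \<epsilon> u X)"
      using assms uX by (intro prob_space_imp_subprob_space prob_space_exponential_mechanism) auto
  qed simp
  then show ?thesis
    using assms uX by (intro measurable_prob_algebraI prob_space_exponential_mechanism) auto
qed

text \<open>
  If the scores differ by at most \<open>h\<close>, then the numerator and the normalizer each change by a factor of
  at most \<open>exp (\<epsilon> h / 2)\<close>.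
\<close>

lemma exponential_mechanism_private:
  assumes u: "u X \<in> borel_measurable \<nu>" "u X' \<in> borel_measurable \<nu>"
    and B: "B \<in> sets \<nu>" "0 < emeasure \<nu> B" "emeasure \<nu> B < \<infinity>" and S: "S \<in> sets \<nu>" and "0 \<le> \<epsilon>"
    and nonneg: "\<And>x. x \<in> B \<Longrightarrow> 0 \<le> u X x" "\<And>x. x \<in> B \<Longrightarrow> 0 \<le> u X' x"
    and h: "\<And>x. x \<in> B \<Longrightarrow> \<bar>u X x - u X' x\<bar> \<le> h"
  shows "measure (exponential_mechanism \<nu> B \<epsilon> u X) S \<le> exp (\<epsilon> * h) * measure (exponential_mechanism \<nu> B \<epsilon> u X') S"
proof -
  interpret X: prob_space "exponential_mechanism \<nu> B \<epsilon> u X"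
    using assms by (intro prob_space_exponential_mechanism) auto
  interpret X': prob_space "exponential_mechanism \<nu> B \<epsilon> u X'"
    using assms by (intro prob_space_exponential_mechanism) auto
  let ?w = "gibbs_weight \<nu> B \<epsilon>"
  have pos: "?w (u X) B \<noteq> 0" "?w (u X) B \<noteq> \<top>" "?w (u X') B \<noteq> 0" "?w (u X') B \<noteq> \<top>"
    using gibbs_weight_pos[of "u X" \<nu> B \<epsilon>] gibbs_weight_fin[of B \<nu> \<epsilon> "u X"]
      gibbs_weight_pos[of "u X'" \<nu> B \<epsilon>] gibbs_weight_fin[of B \<nu> \<epsilon> "u X'"] assms by auto
  have num: "?w (u X) S \<le> ennreal (exp (\<epsilon> * h / 2)) * ?w (u X') S"
    using h by (intro gibbs_weight_perturb u B S \<open>0 \<le> \<epsilon>\<close>) (auto simp: abs_le_iff algebra_simps)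
  have den: "?w (u X') B \<le> ennreal (exp (\<epsilon> * h / 2)) * ?w (u X) B"
    using h by (intro gibbs_weight_perturb u B S \<open>0 \<le> \<epsilon>\<close>) (auto simp: abs_le_iff algebra_simps)
  have "?w (u X) S / ?w (u X) B = ?w (u X) S * ?w (u X') B / (?w (u X) B * ?w (u X') B)"
    using pos by (simp add: ennreal_divide_times ennreal_times_divide divide_mult_eq mult.commute)
  also have "\<dots> \<le> (ennreal (exp (\<epsilon> * h / 2)) * ?w (u X') S) * (ennreal (exp (\<epsilon> * h / 2)) * ?w (u X) B)
      / (?w (u X) B * ?w (u X') B)"
    by (intro divide_right_mono_ennreal mult_mono num den) auto
  also have "(ennreal (exp (\<epsilon> * h / 2)) * ?w (u X') S) * (ennreal (exp (\<epsilon> * h / 2)) * ?w (u X) B)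
      = ?w (u X) B * (ennreal (exp (\<epsilon> * h)) * ?w (u X') S)"
  proof -
    have "ennreal (exp (\<epsilon> * h)) = ennreal (exp (\<epsilon> * h / 2)) * ennreal (exp (\<epsilon> * h / 2))"
      by (simp flip: exp_add ennreal_mult)
    then show ?thesis by (simp add: mult_ac)
  qed
  also have "\<dots> / (?w (u X) B * ?w (u X') B) = ennreal (exp (\<epsilon> * h)) * (?w (u X') S / ?w (u X') B)"
    using pos divide_mult_eq[of "?w (u X) B" "ennreal (exp (\<epsilon> * h)) * ?w (u X') S" "?w (u X') B"]
    by (simp add: ennreal_times_divide mult.commute mult.left_commute)
  finally have "emeasure (exponential_mechanism \<nu> B \<epsilon> u X) S
      \<le> ennreal (exp (\<epsilon> * h)) * emeasure (exponential_mechanism \<nu> B \<epsilon> u X') S"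
    by (simp add: emeasure_exponential_mechanism u B S)
  then show ?thesis
    by (simp add: X.emeasure_eq_measure X'.emeasure_eq_measure ennreal_le_iff flip: ennreal_mult)
qed

text \<open>
  On a set \<open>I\<close> of zero score the density is the reciprocal of the normalizer. The part of the normalizer
  outside \<open>K\<close> is exponentially small, so the density is almost \<open>1 / \<nu> (K \<inter> B)\<close>.
\<close>

lemma exponential_mechanism_ge:
  assumes u: "u X \<in> borel_measurable \<nu>" and B: "B \<in> sets \<nu>" and K: "K \<in> sets \<nu>" and I: "I \<in> sets \<nu>" "I \<subseteq> B"
    and S: "S \<in> sets \<nu>" and "0 \<le> \<epsilon>"
    and nonneg: "\<And>x. x \<in> B \<Longrightarrow> 0 \<le> u X x" and zero: "\<And>x. x \<in> I \<Longrightarrow> u X x = 0"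
    and large: "\<And>x. x \<in> B \<Longrightarrow> x \<notin> K \<Longrightarrow> v \<le> u X x"
  shows "emeasure \<nu> (S \<inter> I) / (emeasure \<nu> (K \<inter> B) + ennreal (exp (- (\<epsilon> / 2) * v)) * emeasure \<nu> B)
    \<le> emeasure (exponential_mechanism \<nu> B \<epsilon> u X) S"
proof -
  let ?w = "gibbs_weight \<nu> B \<epsilon>"
  note [measurable] = u B K I S
  have "emeasure \<nu> (S \<inter> I) = (\<integral>\<^sup>+x. indicator (S \<inter> I) x \<partial>\<nu>)" by simp
  also have "\<dots> \<le> ?w (u X) S"
    unfolding gibbs_weight_def using I(2) zero
    by (intro nn_integral_mono) (auto simp: indicator_def)
  finally have num: "emeasure \<nu> (S \<inter> I) \<le> ?w (u X) S" .
  have "?w (u X) B = ?w (u X) (K \<inter> B) + ?w (u X) (B - K)"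
    unfolding gibbs_weight_def
    by (subst nn_integral_add[symmetric]) (auto intro!: nn_integral_cong simp: indicator_def)
  also have "\<dots> \<le> ennreal (exp (- (\<epsilon> / 2) * 0)) * emeasure \<nu> (K \<inter> B \<inter> B)
      + ennreal (exp (- (\<epsilon> / 2) * v)) * emeasure \<nu> ((B - K) \<inter> B)"
    using nonneg large \<open>0 \<le> \<epsilon>\<close> by (intro add_mono gibbs_weight_le) auto
  also have "\<dots> \<le> emeasure \<nu> (K \<inter> B) + ennreal (exp (- (\<epsilon> / 2) * v)) * emeasure \<nu> B"
    by (intro add_mono mult_left_mono emeasure_mono) (auto simp: Int_assoc)
  finally have "?w (u X) B \<le> emeasure \<nu> (K \<inter> B) + ennreal (exp (- (\<epsilon> / 2) * v)) * emeasure \<nu> B" .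
  then show ?thesis
    unfolding emeasure_exponential_mechanism[of u X, OF u B S] using num
    by (intro order.trans[OF divide_right_mono_ennreal[OF num] divide_left_antimono_ennreal])
qed

section \<open>Quantiles and the floating body\<close>

lemma (in prob_space) exists_level_above:
  assumes Y: "Y \<in> borel_measurable M" and "c < 1"
  shows "\<exists>t\<ge>(0::real). c < prob {\<omega> \<in> space M. Y \<omega> \<le> t}"
proof -
  interpret R: real_distribution "distr M borel Y"
    using Y by (intro real_distribution_distr) auto
  have "\<forall>\<^sub>F t in at_top. c < cdf (distr M borel Y) t"
    using R.cdf_lim_at_top_prob \<open>c < 1\<close> by (rule order_tendstoD)
  then have "\<forall>\<^sub>F t in at_top. c < cdf (distr M borel Y) t \<and> t \<ge> 0"
    using eventually_ge_at_top by (rule eventually_conj)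
  then obtain t where "c < cdf (distr M borel Y) t" "t \<ge> 0"
    using eventually_happens'[OF trivial_limit_at_top_linorder] by blast
  then show ?thesis
    using Y by (auto simp: cdf_def measure_distr vimage_def Int_def conj_commute)
qed

lemma (in prob_space) exists_level_below:
  assumes Y: "Y \<in> borel_measurable M" and "0 < c"
  shows "\<exists>t::real. prob {\<omega> \<in> space M. Y \<omega> \<le> t} < c"
proof -
  interpret R: real_distribution "distr M borel Y"
    using Y by (intro real_distribution_distr) auto
  have "\<forall>\<^sub>F t in at_bot. cdf (distr M borel Y) t < c"
    using R.cdf_lim_at_bot \<open>0 < c\<close> by (rule order_tendstoD)
  then obtain t where "cdf (distr M borel Y) t < c"
    using eventually_happens'[OF trivial_limit_at_bot_linorder] by blast
  then show ?thesis
    using Y by (auto simp: cdf_def measure_distr vimage_def Int_def conj_commute)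
qed

lemma (in prob_space) quantile_leI:
  assumes [measurable]: "Y \<in> borel_measurable M" and "0 < q"
    and "q \<le> prob {\<omega> \<in> space M. Y \<omega> \<le> t}"
  shows "quantile M Y q \<le> t"
proof -
  obtain b where b: "prob {\<omega> \<in> space M. Y \<omega> \<le> b} < q"
    using exists_level_below[of Y q] assms by blast
  have "b \<le> s" if s: "q \<le> prob {\<omega> \<in> space M. Y \<omega> \<le> s}" for s
  proof (rule ccontr)
    assume "\<not> b \<le> s"
    then have "prob {\<omega> \<in> space M. Y \<omega> \<le> s} \<le> prob {\<omega> \<in> space M. Y \<omega> \<le> b}"
      by (intro finite_measure_mono) auto
    then show False using s b by simp
  qed
  then have "bdd_below {t. q \<le> prob {\<omega> \<in> space M. Y \<omega> \<le> t}}"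
    by (intro bdd_belowI[of _ b]) auto
  then show ?thesis unfolding quantile_def by (intro cInf_lower) (use assms in auto)
qed

lemma (in prob_space) prob_ge_above_quantile:
  assumes [measurable]: "Y \<in> borel_measurable M" and "q < 1" "quantile M Y q < t"
  shows "q \<le> prob {\<omega> \<in> space M. Y \<omega> \<le> t}"
proof -
  obtain s where "q < prob {\<omega> \<in> space M. Y \<omega> \<le> s}"
    using exists_level_above[of Y q] assms by blast
  then have "{t. q \<le> prob {\<omega> \<in> space M. Y \<omega> \<le> t}} \<noteq> {}" by (auto intro: less_imp_le)
  from cInf_lessD[OF this] assms obtain s
    where s: "q \<le> prob {\<omega> \<in> space M. Y \<omega> \<le> s}" "s < t"
    unfolding quantile_def by blast
  then have "prob {\<omega> \<in> space M. Y \<omega> \<le> s} \<le> prob {\<omega> \<in> space M. Y \<omega> \<le> t}"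
    by (intro finite_measure_mono) auto
  then show ?thesis using s by simp
qed

text \<open>
  Integrate the density over \<open>{a<..b}\<close>.
\<close>

lemma (in prob_space) prob_increment_ge:
  assumes f: "distributed M lborel Y f" and "a \<le> b" "0 \<le> L"
    and L: "\<And>t. t \<in> {a..b} \<Longrightarrow> ennreal L \<le> f t"
  shows "prob {\<omega> \<in> space M. Y \<omega> \<le> a} + L * (b - a) \<le> prob {\<omega> \<in> space M. Y \<omega> \<le> b}"
proof -
  have [measurable]: "Y \<in> borel_measurable M" using distributed_measurable[OF f] by simp
  have "ennreal (L * (b - a)) = (\<integral>\<^sup>+t. ennreal L * indicator {a<..b} t \<partial>lborel)"
    using assms by (subst nn_integral_cmult_indicator) (auto simp: ennreal_mult)
  also have "\<dots> \<le> (\<integral>\<^sup>+t. f t * indicator {a<..b} t \<partial>lborel)"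
    using L by (intro nn_integral_mono) (auto simp: indicator_def)
  also have "\<dots> = emeasure M (Y -` {a<..b} \<inter> space M)"
    using distributed_emeasure[OF f, of "{a<..b}"] by simp
  also have "\<dots> = ennreal (prob (Y -` {a<..b} \<inter> space M))" by (rule emeasure_eq_measure)
  finally have "L * (b - a) \<le> prob (Y -` {a<..b} \<inter> space M)"
    by (simp add: ennreal_le_iff)
  moreover have "prob {\<omega> \<in> space M. Y \<omega> \<le> b}
      = prob {\<omega> \<in> space M. Y \<omega> \<le> a} + prob (Y -` {a<..b} \<inter> space M)"
  proof -
    have "{\<omega> \<in> space M. Y \<omega> \<le> b} = {\<omega> \<in> space M. Y \<omega> \<le> a} \<union> (Y -` {a<..b} \<inter> space M)"
      using \<open>a \<le> b\<close> by auto
    then show ?thesis by (simp only:) (rule finite_measure_Union; auto)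
  qed
  ultimately show ?thesis by simp
qed

text \<open>
  Laws on \<open>\<real>\<^sup>d\<close> all of whose one-dimensional marginals have density at least \<open>L\<close> within distance \<open>r\<close> of their
  \<open>q\<close>-quantile. This is the hypothesis that converts differences of probabilities into differences of
  thresholds and back.
\<close>

locale quantile_window = prob_space D for D :: "(nat \<Rightarrow> real) measure" +
  fixes d :: nat and q r L :: real
  assumes sets_D [measurable_cong]: "sets D = sets (rvec d)"
    and q: "0 < q" "q < 1" and r: "0 < r" and L: "0 < L"
    and dense: "\<And>\<theta>. \<theta> \<in> vsphere d \<Longrightarrow> \<exists>f. distributed D lborel (\<lambda>x. vinner d x \<theta>) f \<and>
      (\<forall>t\<in>{quantile D (\<lambda>x. vinner d x \<theta>) q - r..quantile D (\<lambda>x. vinner d x \<theta>) q + r}. ennreal L \<le> f t)"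
begin

abbreviation Q :: "(nat \<Rightarrow> real) \<Rightarrow> real" where
  "Q \<theta> \<equiv> quantile D (\<lambda>x. vinner d x \<theta>) q"

lemma measurable_marginal: "\<theta> \<in> vsphere d \<Longrightarrow> (\<lambda>x. vinner d x \<theta>) \<in> borel_measurable D"
  by (rule measurable_vinner) (auto simp: vsphere_def measurable_ident_sets sets_D)

text \<open>
  The quantile is an infimum, so the level \<open>q\<close> is only known to be reached strictly above it. Half of the
  distance \<open>t\<close> is spent on this, which explains the factor \<open>1 / 2\<close>.
\<close>

lemma prob_above_quantile:
  assumes \<theta>: "\<theta> \<in> vsphere d" and t: "0 < t" "t \<le> r"
  shows "q + L * t / 2 \<le> prob {x \<in> space D. vinner d x \<theta> \<le> Q \<theta> + t}"
proof -
  obtain f where f: "distributed D lborel (\<lambda>x. vinner d x \<theta>) f"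
    "\<forall>t\<in>{Q \<theta> - r..Q \<theta> + r}. ennreal L \<le> f t" using dense[OF \<theta>] by blast
  have "prob {x \<in> space D. vinner d x \<theta> \<le> Q \<theta> + t / 2} + L * (Q \<theta> + t - (Q \<theta> + t / 2))
      \<le> prob {x \<in> space D. vinner d x \<theta> \<le> Q \<theta> + t}"
    using t L f(2) by (intro prob_increment_ge[OF f(1)]) auto
  moreover have "q \<le> prob {x \<in> space D. vinner d x \<theta> \<le> Q \<theta> + t / 2}"
    using t q measurable_marginal[OF \<theta>] by (intro prob_ge_above_quantile) auto
  ultimately show ?thesis by (simp add: algebra_simps)
qed

lemma prob_below_quantile:
  assumes \<theta>: "\<theta> \<in> vsphere d" and t: "0 < t" "t \<le> r"
  shows "prob {x \<in> space D. vinner d x \<theta> \<le> Q \<theta> - t} \<le> q - L * t / 2"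
proof -
  obtain f where f: "distributed D lborel (\<lambda>x. vinner d x \<theta>) f"
    "\<forall>t\<in>{Q \<theta> - r..Q \<theta> + r}. ennreal L \<le> f t" using dense[OF \<theta>] by blast
  have "prob {x \<in> space D. vinner d x \<theta> \<le> Q \<theta> - t} + L * (Q \<theta> - t / 2 - (Q \<theta> - t))
      \<le> prob {x \<in> space D. vinner d x \<theta> \<le> Q \<theta> - t / 2}"
    using t L f(2) by (intro prob_increment_ge[OF f(1)]) auto
  moreover have "\<not> q \<le> prob {x \<in> space D. vinner d x \<theta> \<le> Q \<theta> - t / 2}"
    using quantile_leI[OF measurable_marginal[OF \<theta>] q(1), of "Q \<theta> - t / 2"] t by linarith
  ultimately show ?thesis by (simp add: algebra_simps)
qed

text \<open>
  A density of at least \<open>L\<close> on an interval of length \<open>2 r\<close> cannot integrate to more than one.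
\<close>

lemma mass_window:
  assumes "vsphere d \<noteq> {}"
  shows "2 * L * r \<le> 1"
proof -
  obtain \<theta> where \<theta>: "\<theta> \<in> vsphere d" using assms by blast
  obtain f where f: "distributed D lborel (\<lambda>x. vinner d x \<theta>) f"
    "\<forall>t\<in>{Q \<theta> - r..Q \<theta> + r}. ennreal L \<le> f t" using dense[OF \<theta>] by blast
  have "prob {x \<in> space D. vinner d x \<theta> \<le> Q \<theta> - r} + L * (Q \<theta> + r - (Q \<theta> - r))
      \<le> prob {x \<in> space D. vinner d x \<theta> \<le> Q \<theta> + r}"
    using r L f(2) by (intro prob_increment_ge[OF f(1)]) auto
  also have "\<dots> \<le> 1" by (rule prob_le_1)
  finally have "L * (Q \<theta> + r - (Q \<theta> - r)) \<le> 1"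
    using measure_nonneg[of D "{x \<in> space D. vinner d x \<theta> \<le> Q \<theta> - r}"] by linarith
  then show ?thesis by (simp add: algebra_simps)
qed

text \<open>
  Where \<open>vnorm d x \<le> p\<close>, the two marginals differ by at most \<open>\<delta> p\<close>. The probability of the remaining points
  is at most \<open>L s / 2\<close>, and this is the probability gained by raising the threshold by \<open>s\<close>.
\<close>

lemma quantile_perturb:
  assumes \<theta>: "\<theta> \<in> vsphere d" "\<theta>' \<in> vsphere d" and s: "0 < s" "s \<le> r" and "0 \<le> p"
    and p: "1 - L * s / 2 \<le> prob {x \<in> space D. vnorm d x \<le> p}"
    and \<delta>: "vnorm d (\<lambda>i. \<theta>' i - \<theta> i) \<le> \<delta>"
  shows "Q \<theta>' \<le> Q \<theta> + s + \<delta> * p"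
proof (rule quantile_leI[OF measurable_marginal[OF \<theta>(2)] q(1)])
  let ?A = "{x \<in> space D. vinner d x \<theta> \<le> Q \<theta> + s}" and ?B = "{x \<in> space D. vnorm d x \<le> p}"
  have [measurable]: "?A \<in> events" "{x \<in> space D. vinner d x \<theta>' \<le> Q \<theta> + s + \<delta> * p} \<in> events"
    using measurable_marginal \<theta> by auto
  have [measurable]: "?B \<in> events" by measurable
  have "q \<le> prob ?A + prob ?B - 1"
    using p prob_above_quantile[OF \<theta>(1) s] by simp
  also have "\<dots> \<le> prob (?A \<inter> ?B)"
  proof -
    have "prob ?A + prob ?B = prob (?A \<union> ?B) + prob (?A \<inter> ?B)" 
      using finite_measure_Union'[of ?A ?B] finite_measure_Diff'[of ?B ?A] by (simp add: Int_commute)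
    then show ?thesis using prob_le_1[of "?A \<union> ?B"] by linarith
  qed
  also have "\<dots> \<le> prob {x \<in> space D. vinner d x \<theta>' \<le> Q \<theta> + s + \<delta> * p}"
  proof (rule finite_measure_mono, intro subsetI)
    fix x assume x: "x \<in> ?A \<inter> ?B"
    have "vinner d x \<theta>' - vinner d x \<theta> \<le> vnorm d x * vnorm d (\<lambda>i. \<theta>' i - \<theta> i)"
      using vinner_le_vnorm[of d x "\<lambda>i. \<theta>' i - \<theta> i"] by (simp add: vinner_diff_right)
    also have "\<dots> \<le> p * \<delta>" using x \<delta> \<open>0 \<le> p\<close> by (intro mult_mono) auto
    finally show "x \<in> {x \<in> space D. vinner d x \<theta>' \<le> Q \<theta> + s + \<delta> * p}"
      using x by (simp add: mult.commute)
  qed measurable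
  finally show "q \<le> prob {x \<in> space D. vinner d x \<theta>' \<le> Q \<theta> + s + \<delta> * p}" .
qed

definition outer_polytope :: "(nat \<Rightarrow> real) set \<Rightarrow> real \<Rightarrow> (nat \<Rightarrow> real) set" where
  "outer_polytope \<Theta> t = {x \<in> space (rvec d). \<forall>\<theta>\<in>\<Theta>. vinner d x \<theta> \<le> Q \<theta> + t}"

lemma sets_outer_polytope:
  assumes "finite \<Theta>" "\<Theta> \<subseteq> vsphere d"
  shows "outer_polytope \<Theta> t \<in> sets (rvec d)"
  unfolding outer_polytope_def
proof (rule sets.sets_Collect_finite_All[OF _ assms(1)])
  fix \<theta> assume "\<theta> \<in> \<Theta>"
  then have "\<theta> \<in> space (rvec d)" using assms(2) by (auto simp: vsphere_def)
  then have "(\<lambda>x. vinner d x \<theta>) \<in> borel_measurable (rvec d)" by (intro measurable_vinner) auto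
  then show "{x \<in> space (rvec d). vinner d x \<theta> \<le> Q \<theta> + t} \<in> sets (rvec d)" by measurable
qed

text \<open>
  A finite net of constraints implies all constraints up to \<open>2 t\<close>: one \<open>t\<close> is the slack of the polytope, and
  passing to the nearest direction of the net costs \<open>t / 2\<close> by \<open>quantile_perturb\<close> and another \<open>\<delta> (p + \<rho>)\<close>.
\<close>

lemma outer_polytope_margin:
  assumes \<Theta>: "\<Theta> \<subseteq> vsphere d"
    and net: "\<And>\<theta>. \<theta> \<in> vsphere d \<Longrightarrow> \<exists>\<theta>'\<in>\<Theta>. vnorm d (\<lambda>i. \<theta> i - \<theta>' i) \<le> \<delta>"
    and t: "0 < t" "t \<le> r" and "0 \<le> p" and p: "1 - L * t / 4 \<le> prob {x \<in> space D. vnorm d x \<le> p}"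
    and \<delta>: "\<delta> * (p + \<rho>) \<le> t / 2"
    and x: "x \<in> outer_polytope \<Theta> t" "vnorm d x \<le> \<rho>" and \<theta>: "\<theta> \<in> vsphere d"
  shows "vinner d x \<theta> \<le> Q \<theta> + 2 * t"
proof -
  obtain \<theta>' where \<theta>': "\<theta>' \<in> \<Theta>" "vnorm d (\<lambda>i. \<theta> i - \<theta>' i) \<le> \<delta>" using net[OF \<theta>] by blast
  then have "vnorm d (\<lambda>i. \<theta>' i - \<theta> i) \<le> \<delta>" by (simp add: vnorm_def power2_commute)
  then have "Q \<theta>' \<le> Q \<theta> + t / 2 + \<delta> * p"
    using \<theta> \<theta>' \<Theta> t p \<open>0 \<le> p\<close> by (intro quantile_perturb) auto
  moreover have "vinner d x \<theta> - vinner d x \<theta>' \<le> \<delta> * \<rho>"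
  proof -
    have "vinner d x \<theta> - vinner d x \<theta>' \<le> vnorm d x * vnorm d (\<lambda>i. \<theta> i - \<theta>' i)"
      using vinner_le_vnorm[of d x "\<lambda>i. \<theta> i - \<theta>' i"] by (simp add: vinner_diff_right)
    also have "\<dots> \<le> \<rho> * \<delta>"
      using x \<theta>' vnorm_nonneg[of d x] by (intro mult_mono) (linarith | simp)+
    finally show ?thesis by (simp add: mult.commute)
  qed
  moreover have "vinner d x \<theta>' \<le> Q \<theta>' + t" using x \<theta>' by (simp add: outer_polytope_def)
  ultimately show ?thesis using \<delta> by (simp add: distrib_left)
qed

abbreviation "F \<equiv> floating_body d q D"

lemma floating_body_iff:
  "x \<in> F \<longleftrightarrow> x \<in> space (rvec d) \<and> (\<forall>\<theta>\<in>vsphere d. vinner d x \<theta> \<le> Q \<theta>)"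
  by (simp add: floating_body_def)

text \<open>
  Test the constraint in the direction of \<open>x\<close> itself.
\<close>

lemma floating_body_subset_ball:
  assumes "0 \<le> \<rho>" and \<rho>: "\<And>\<theta>. \<theta> \<in> vsphere d \<Longrightarrow> Q \<theta> \<le> \<rho>"
  shows "F \<subseteq> vcball d (\<lambda>_. 0) \<rho>"
proof
  fix x assume x: "x \<in> F"
  have "vnorm d x \<le> \<rho>"
  proof (cases "vnorm d x = 0")
    case False
    define \<theta> where "\<theta> = (\<lambda>i\<in>{..<d}. x i / vnorm d x)"
    have "vinner d x \<theta> = vinner d x x / vnorm d x"
      by (simp add: vinner_def \<theta>_def sum_divide_distrib)
    then have 1: "vinner d x \<theta> = vnorm d x" using False by (simp add: vinner_self power2_eq_square)
    have "(vnorm d \<theta>)\<^sup>2 = vinner d x x / (vnorm d x)\<^sup>2"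
      unfolding vinner_self[symmetric, of d \<theta>]
      by (simp add: vinner_def \<theta>_def sum_divide_distrib power2_eq_square)
    then have "(vnorm d \<theta>)\<^sup>2 = 1" using False by (simp add: vinner_self)
    then have "vnorm d \<theta> = 1" using vnorm_nonneg[of d \<theta>] by (simp add: power2_eq_1_iff)
    then have "\<theta> \<in> vsphere d" by (simp add: vsphere_def space_rvec \<theta>_def)
    then have "vinner d x \<theta> \<le> Q \<theta>" "Q \<theta> \<le> \<rho>" using x \<rho> by (auto simp: floating_body_iff)
    then show ?thesis using 1 by simp
  qed (use assms in simp)
  then show "x \<in> vcball d (\<lambda>_. 0) \<rho>" using x by (simp add: vcball_def floating_body_iff)
qed

text \<open>
  The definition intersects uncountably many half-spaces. By \<open>outer_polytope_margin\<close> the same set is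
  the intersection of countably many polytopes, for nets that become finer and slacks that tend to zero.
\<close>

lemma sets_floating_body:
  assumes "0 \<le> \<rho>" and \<rho>: "\<And>\<theta>. \<theta> \<in> vsphere d \<Longrightarrow> Q \<theta> \<le> \<rho>"
  shows "F \<in> sets (rvec d)"
proof -
  define t where "t j = r / real (Suc j)" for j
  have t: "0 < t j" "t j \<le> r" for j
    using r by (auto simp: t_def divide_le_eq mult_left_le)
  have "\<exists>\<Theta>. finite \<Theta> \<and> \<Theta> \<subseteq> vsphere d \<and>
      (\<forall>x \<in> outer_polytope \<Theta> (t j) \<inter> vcball d (\<lambda>_. 0) \<rho>. \<forall>\<theta>\<in>vsphere d. vinner d x \<theta> \<le> Q \<theta> + 2 * t j)" for j
  proof -
    have "\<exists>p\<ge>0. 1 - L * t j / 4 < prob {x \<in> space D. vnorm d x \<le> p}"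
      using t[of j] L by (intro exists_level_above) (auto simp: measurable_ident_sets sets_D)
    then obtain p where p: "0 \<le> p" "1 - L * t j / 4 \<le> prob {x \<in> space D. vnorm d x \<le> p}"
      by (auto intro: less_imp_le)
    define k where "k = Suc (nat \<lceil>2 * real d * (p + \<rho>) / t j\<rceil>)"
    have k: "2 * real d * (p + \<rho>) / t j \<le> real k" "0 < k" unfolding k_def by linarith+
    obtain \<Theta> where \<Theta>: "finite \<Theta>" "\<Theta> \<subseteq> vsphere d"
      "\<And>\<theta>. \<theta> \<in> vsphere d \<Longrightarrow> \<exists>\<theta>'\<in>\<Theta>. vnorm d (\<lambda>i. \<theta> i - \<theta>' i) \<le> real d / real k"
      by (rule sphere_net[OF k(2)]) blast
    have "real d / real k * (p + \<rho>) \<le> t j / 2"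
      using k t(1)[of j] by (simp add: field_simps)
    then have "vinner d x \<theta> \<le> Q \<theta> + 2 * t j"
      if "x \<in> outer_polytope \<Theta> (t j) \<inter> vcball d (\<lambda>_. 0) \<rho>" "\<theta> \<in> vsphere d" for x \<theta>
      using that by (intro outer_polytope_margin[OF \<Theta>(2,3) t p]) (auto simp: vcball_def)
    then show ?thesis using \<Theta> by blast
  qed
  then obtain \<Theta> where \<Theta>: "\<And>j. finite (\<Theta> j)" "\<And>j. \<Theta> j \<subseteq> vsphere d"
    and m: "\<And>j x \<theta>. x \<in> outer_polytope (\<Theta> j) (t j) \<inter> vcball d (\<lambda>_. 0) \<rho> \<Longrightarrow> \<theta> \<in> vsphere d
      \<Longrightarrow> vinner d x \<theta> \<le> Q \<theta> + 2 * t j" by metis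
  have "F = (\<Inter>j. outer_polytope (\<Theta> j) (t j) \<inter> vcball d (\<lambda>_. 0) \<rho>)" (is "_ = ?I")
  proof (intro set_eqI iffI)
    fix x assume "x \<in> F"
    moreover have "vinner d x \<theta> \<le> Q \<theta> + t j" if "\<theta> \<in> \<Theta> j" for j \<theta>
    proof -
      have "vinner d x \<theta> \<le> Q \<theta>"
        using \<open>x \<in> F\<close> that \<Theta>(2)[of j] by (auto simp: floating_body_iff)
      then show ?thesis using t(1)[of j] by linarith
    qed
    ultimately show "x \<in> ?I"
      using floating_body_subset_ball[OF assms] by (auto simp: floating_body_iff outer_polytope_def)
  next
    fix x assume x: "x \<in> ?I"
    have "vinner d x \<theta> \<le> Q \<theta>" if \<theta>: "\<theta> \<in> vsphere d" for \<theta>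
    proof (rule field_le_epsilon)
      fix e :: real assume "0 < e"
      obtain j where "2 * r / e < real (Suc j)"
        by (meson less_SucI of_nat_less_iff order_less_trans reals_Archimedean2 lessI)
      then have "2 * t j \<le> e" using \<open>0 < e\<close> by (simp add: t_def field_simps)
      then show "vinner d x \<theta> \<le> Q \<theta> + e" using m[OF _ \<theta>, of x j] x by force
    qed
    then show "x \<in> F" using x by (auto simp: floating_body_iff vcball_def)
  qed
  also have "\<dots> \<in> sets (rvec d)"
    using \<Theta> by (intro sets.countable_INT) (auto intro!: sets.Int sets_outer_polytope)
  finally show ?thesis .
qed

end

section \<open>Empirical depth\<close>

lemma (in prob_space) indep_vars_coordinates:
  assumes "0 < n"
  shows "prob_space.indep_vars (PiM {..<n} (\<lambda>_. M)) (\<lambda>_. M) (\<lambda>i X. X i) {..<n::nat}"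
proof -
  interpret P: prob_space "PiM {..<n} (\<lambda>_. M)"
    by (intro prob_space_PiM prob_space_axioms)
  have "distr (PiM {..<n} (\<lambda>_. M)) (PiM {..<n} (\<lambda>_. M)) (\<lambda>X. \<lambda>i\<in>{..<n}. X i) = PiM {..<n} (\<lambda>_. M)"
    by (subst distr_cong[where g="\<lambda>x. x" and L="PiM {..<n} (\<lambda>_. M)" and N="PiM {..<n} (\<lambda>_. M)"])
       (auto simp: space_PiM PiE_restrict)
  also have "\<dots> = PiM {..<n} (\<lambda>i. distr (PiM {..<n} (\<lambda>_. M)) M (\<lambda>X. X i))"
    by (intro PiM_cong refl sym[OF distr_PiM_component] prob_space_axioms) auto
  finally show ?thesis
    using assms by (subst P.indep_vars_iff_distr_eq_PiM') auto
qed

text \<open>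
  Hoeffding's inequality for the indicators of \<open>A\<close> along an i.i.d. sample.
\<close>

lemma (in prob_space) empirical_frequency_tails:
  fixes n :: nat
  assumes A: "A \<in> events" and n: "0 < n" and e: "0 \<le> e"
  defines "P \<equiv> PiM {..<n} (\<lambda>_. M)"
  shows "measure P {X \<in> space P. real n * prob A + e \<le> (\<Sum>i<n. indicator A (X i))} \<le> exp (- 2 * e\<^sup>2 / n)"
    and "measure P {X \<in> space P. (\<Sum>i<n. indicator A (X i)) \<le> real n * prob A - e} \<le> exp (- 2 * e\<^sup>2 / n)"
proof -
  interpret P: prob_space P
    unfolding P_def by (intro prob_space_PiM prob_space_axioms)
  have dist: "distr P M (\<lambda>X. X i) = M" if "i < n" for i
    unfolding P_def using that by (intro distr_PiM_component prob_space_axioms) auto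
  have c: "(\<lambda>X. X i) \<in> P \<rightarrow>\<^sub>M M" if "i < n" for i
    unfolding P_def using that by (intro measurable_component_singleton) auto
  have m: "(\<lambda>X. indicator A (X i) :: real) \<in> borel_measurable P" if "i < n" for i
    using measurable_compose[OF c[OF that] borel_measurable_indicator[OF A]] by simp
  have d: "distr P borel (\<lambda>X. indicator A (X i) :: real) = distr M borel (indicator A)" if "i < n" for i
    using dist[OF that] c[OF that] A
      distr_distr[of "indicator A :: _ \<Rightarrow> real" M borel "\<lambda>X. X i" P] by (simp add: comp_def)
  interpret H: Hoeffding_ineq_iid P "{..<n}" "\<lambda>i X. indicator A (X i)" "\<lambda>X. indicator A (X 0)" 0 1
      "P.expectation (\<lambda>X. indicator A (X 0))"
  proof unfold_locales
    show "P.indep_vars (\<lambda>_. borel) (\<lambda>i X. indicator A (X i) :: real) {..<n}"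
      using A unfolding P_def
      by (intro prob_space.indep_vars_compose2[OF prob_space_PiM indep_vars_coordinates[OF n]]
          prob_space_axioms) auto
    show "distr P borel (\<lambda>X. indicator A (X i) :: real) = distr P borel (\<lambda>X. indicator A (X 0))"
      if "i \<in> {..<n}" for i using that n by (simp add: d)
    show "P.random_variable borel (\<lambda>X. indicator A (X 0) :: real)" using m n by auto
  qed auto
  have ne: "{..<n} \<noteq> {}" using n by auto
  have "P.expectation (\<lambda>X. indicator A (X 0)) = prob A"
  proof -
    have "P.expectation (\<lambda>X. indicator A (X 0)) = integral\<^sup>L (distr P M (\<lambda>X. X 0)) (indicator A :: _ \<Rightarrow> real)"
      using c[OF n] A by (intro integral_distr[symmetric]) auto
    then show ?thesis using A by (simp add: dist[OF n] Int_absorb2 sets.sets_into_space)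
  qed
  then show "measure P {X \<in> space P. real n * prob A + e \<le> (\<Sum>i<n. indicator A (X i))} \<le> exp (- 2 * e\<^sup>2 / n)"
    "measure P {X \<in> space P. (\<Sum>i<n. indicator A (X i)) \<le> real n * prob A - e} \<le> exp (- 2 * e\<^sup>2 / n)"
    using H.Hoeffding_ineq_ge[OF e zero_less_one ne] H.Hoeffding_ineq_le[OF e zero_less_one ne] by simp_all
qed

definition count_below :: "nat \<Rightarrow> nat \<Rightarrow> (nat \<Rightarrow> nat \<Rightarrow> real) \<Rightarrow> (nat \<Rightarrow> real) \<Rightarrow> real \<Rightarrow> real" where
  "count_below n d X \<theta> s = (\<Sum>i<n. of_bool (vinner d (X i) \<theta> \<le> s))"

text \<open>
  The open half-space beyond \<open>x\<close> in direction \<open>\<theta>\<close> contains all but \<open>count_below n d X \<theta> (vinner d x \<theta>)\<close>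
  data points, so the depth of \<open>x\<close>, counted with open half-spaces, is less than \<open>n (1 - q)\<close> exactly when one of these
  counts exceeds \<open>n q\<close>. The score is this shortfall, restricted to the directions in \<open>\<Theta>\<close> and truncated at zero.
  \<open>Max\<close> of the empty set is unspecified, so bounds on the score from above need a nonempty \<open>\<Theta>\<close>.
\<close>

definition depth_excess ::
  "nat \<Rightarrow> nat \<Rightarrow> real \<Rightarrow> (nat \<Rightarrow> real) set \<Rightarrow> (nat \<Rightarrow> nat \<Rightarrow> real) \<Rightarrow> (nat \<Rightarrow> real) \<Rightarrow> real" where
  "depth_excess n d q \<Theta> X x =
     max 0 (Max ((\<lambda>\<theta>. count_below n d X \<theta> (vinner d x \<theta>) - real n * q) ` \<Theta>))"

lemma count_below_mono: "s \<le> t \<Longrightarrow> count_below n d X \<theta> s \<le> count_below n d X \<theta> t"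
  unfolding count_below_def by (intro sum_mono) auto

text \<open>
  A data point contributes differently to the two counts only if it was changed.
\<close>

lemma count_below_hamming:
  "count_below n d X \<theta> s \<le> count_below n d X' \<theta> s + real (hamming_dist n X X')"
proof -
  have "count_below n d X \<theta> s \<le> (\<Sum>i<n. of_bool (vinner d (X' i) \<theta> \<le> s) + of_bool (X i \<noteq> X' i))"
    unfolding count_below_def by (intro sum_mono) auto
  also have "\<dots> = count_below n d X' \<theta> s + real (card ({..<n} \<inter> {i. X i \<noteq> X' i}))"
    by (simp add: sum.distrib count_below_def)
  also have "{..<n} \<inter> {i. X i \<noteq> X' i} = {i. i < n \<and> X i \<noteq> X' i}" by auto
  finally show ?thesis by (simp add: hamming_dist_def)
qed

lemma hamming_dist_sym: "hamming_dist n X X' = hamming_dist n X' X"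
  by (auto simp: hamming_dist_def intro!: arg_cong[of _ _ card])

lemma depth_excess_nonneg [simp]: "0 \<le> depth_excess n d q \<Theta> X x"
  by (simp add: depth_excess_def)

lemma depth_excess_ge:
  assumes "finite \<Theta>" "\<theta> \<in> \<Theta>"
  shows "count_below n d X \<theta> (vinner d x \<theta>) - real n * q \<le> depth_excess n d q \<Theta> X x"
proof -
  have "count_below n d X \<theta> (vinner d x \<theta>) - real n * q
      \<le> Max ((\<lambda>\<theta>. count_below n d X \<theta> (vinner d x \<theta>) - real n * q) ` \<Theta>)"
    using assms by (intro Max_ge) auto
  then show ?thesis by (simp add: depth_excess_def)
qed

lemma depth_excess_le:
  assumes "finite \<Theta>" "\<Theta> \<noteq> {}" "0 \<le> v"
    and "\<And>\<theta>. \<theta> \<in> \<Theta> \<Longrightarrow> count_below n d X \<theta> (vinner d x \<theta>) - real n * q \<le> v"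
  shows "depth_excess n d q \<Theta> X x \<le> v"
  unfolding depth_excess_def using assms by (intro max.boundedI Max.boundedI) auto

lemma depth_excess_sensitivity:
  assumes \<Theta>: "finite \<Theta>" "\<Theta> \<noteq> {}"
  shows "\<bar>depth_excess n d q \<Theta> X x - depth_excess n d q \<Theta> X' x\<bar> \<le> real (hamming_dist n X X')"
proof -
  have "depth_excess n d q \<Theta> X x \<le> depth_excess n d q \<Theta> X' x + real (hamming_dist n X X')" for X X'
  proof (rule depth_excess_le[OF \<Theta>])
    fix \<theta> assume "\<theta> \<in> \<Theta>"
    then show "count_below n d X \<theta> (vinner d x \<theta>) - real n * q
        \<le> depth_excess n d q \<Theta> X' x + real (hamming_dist n X X')"
      using count_below_hamming[of n d X \<theta> "vinner d x \<theta>" X'] depth_excess_ge[OF \<Theta>(1), of \<theta> n d X' x q]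
      by simp
  qed simp
  from this[of X X'] this[of X' X] show ?thesis by (simp add: hamming_dist_sym[of n X' X] abs_le_iff)
qed

lemma measurable_depth_excess:
  assumes "finite \<Theta>" "\<Theta> \<subseteq> vsphere d"
  shows "(\<lambda>(X, x). depth_excess n d q \<Theta> X x)
    \<in> borel_measurable (PiM {..<n} (\<lambda>_. rvec d) \<Otimes>\<^sub>M lebesgue_rvec d)"
proof -
  let ?P = "PiM {..<n} (\<lambda>_. rvec d) \<Otimes>\<^sub>M lebesgue_rvec d"
  have id: "snd \<in> ?P \<rightarrow>\<^sub>M rvec d"
    using measurable_snd[of "PiM {..<n} (\<lambda>_. rvec d)" "lebesgue_rvec d"]
      measurable_cong_sets[OF refl sets_lebesgue_rvec[of d]] by auto
  have c: "(\<lambda>p. fst p i) \<in> ?P \<rightarrow>\<^sub>M rvec d" if "i < n" for i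
    using that by (intro measurable_compose[OF measurable_fst measurable_component_singleton]) auto
  have "(\<lambda>p. count_below n d (fst p) \<theta> (vinner d (snd p) \<theta>) - real n * q) \<in> borel_measurable ?P"
    if "\<theta> \<in> \<Theta>" for \<theta>
  proof -
    have \<theta>: "(\<lambda>_. \<theta>) \<in> ?P \<rightarrow>\<^sub>M rvec d" using that assms(2) by (auto simp: vsphere_def)
    have "Measurable.pred ?P (\<lambda>p. vinner d (fst p i) \<theta> \<le> vinner d (snd p) \<theta>)" if "i < n" for i
      using measurable_vinner[OF c[OF that] \<theta>] measurable_vinner[OF id \<theta>] by measurable
    then have "(\<lambda>p. of_bool (vinner d (fst p i) \<theta> \<le> vinner d (snd p) \<theta>) :: real) \<in> borel_measurable ?P"
      if "i < n" for i
      using that unfolding of_bool_def by (intro measurable_If borel_measurable_const predE)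
    then show ?thesis unfolding count_below_def
      by (intro borel_measurable_diff borel_measurable_sum borel_measurable_const) simp
  qed
  then show ?thesis unfolding depth_excess_def case_prod_beta
    using assms by (intro borel_measurable_max borel_measurable_Max) auto
qed

context quantile_window
begin

text \<open>
  Counts are monotone in the threshold. Control at two thresholds per direction therefore bounds the
  score at every point of the space.
\<close>

definition typical_samples :: "nat \<Rightarrow> (nat \<Rightarrow> real) set \<Rightarrow> real \<Rightarrow> (nat \<Rightarrow> nat \<Rightarrow> real) set" where
  "typical_samples n \<Theta> t = {X \<in> space (PiM {..<n} (\<lambda>_. D)). \<forall>\<theta>\<in>\<Theta>.
     count_below n d X \<theta> (Q \<theta> - t) \<le> real n * q \<and>
     real n * q + real n * L * t / 4 \<le> count_below n d X \<theta> (Q \<theta> + t)}"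

lemma count_below_eq_indicator:
  assumes "X \<in> space (PiM {..<n} (\<lambda>_. D))"
  shows "count_below n d X \<theta> s = (\<Sum>i<n. indicator {x \<in> space D. vinner d x \<theta> \<le> s} (X i))"
  unfolding count_below_def using assms
  by (intro sum.cong) (auto simp: space_PiM PiE_def Pi_iff)

lemma measurable_count_below:
  assumes "\<theta> \<in> vsphere d"
  shows "(\<lambda>X. count_below n d X \<theta> s) \<in> borel_measurable (PiM {..<n} (\<lambda>_. D))"
proof -
  have "(\<lambda>X. vinner d (X i) \<theta>) \<in> borel_measurable (PiM {..<n} (\<lambda>_. D))" if "i < n" for i
    by (rule measurable_compose[OF _ measurable_marginal[OF assms]], rule measurable_component_singleton)
       (use that in simp)
  then have "Measurable.pred (PiM {..<n} (\<lambda>_. D)) (\<lambda>X. vinner d (X i) \<theta> \<le> s)" if "i < n" for i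
    using that by measurable
  then show ?thesis unfolding count_below_def of_bool_def
    by (intro borel_measurable_sum measurable_If borel_measurable_const) auto
qed

lemma sets_typical_samples:
  assumes "finite \<Theta>" "\<Theta> \<subseteq> vsphere d"
  shows "typical_samples n \<Theta> t \<in> sets (PiM {..<n} (\<lambda>_. D))"
  unfolding typical_samples_def
proof (rule sets.sets_Collect_finite_All[OF _ assms(1)])
  fix \<theta> assume "\<theta> \<in> \<Theta>"
  then have "\<theta> \<in> vsphere d" using assms(2) by auto
  note [measurable] = measurable_count_below[OF this]
  show "{X \<in> space (PiM {..<n} (\<lambda>_. D)). count_below n d X \<theta> (Q \<theta> - t) \<le> real n * q \<and>
      real n * q + real n * L * t / 4 \<le> count_below n d X \<theta> (Q \<theta> + t)} \<in> sets (PiM {..<n} (\<lambda>_. D))"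
    by measurable
qed

text \<open>
  The distribution function is at distance at least \<open>L t / 2\<close> from \<open>q\<close> at both thresholds, and the typical
  samples allow an error of at least \<open>L t / 4\<close>. Hence each of the two events per direction is a Hoeffding
  deviation by \<open>n L t / 4\<close>.
\<close>

lemma prob_typical_samples:
  assumes \<Theta>: "finite \<Theta>" "\<Theta> \<subseteq> vsphere d" and t: "0 < t" "t \<le> r" and n: "0 < n"
  shows "1 - 2 * real (card \<Theta>) * exp (- real n * (L * t)\<^sup>2 / 8)
    \<le> measure (PiM {..<n} (\<lambda>_. D)) (typical_samples n \<Theta> t)"
proof -
  define P where "P = PiM {..<n} (\<lambda>_. D)"
  interpret P: prob_space P unfolding P_def by (intro prob_space_PiM prob_space_axioms)
  define e where "e = real n * L * t / 4"
  define bad1 where "bad1 \<theta> = {X \<in> space P. real n * q < count_below n d X \<theta> (Q \<theta> - t)}" for \<theta>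
  define bad2 where "bad2 \<theta> = {X \<in> space P. count_below n d X \<theta> (Q \<theta> + t) < real n * q + e}" for \<theta>
  have e: "0 \<le> e" using L t by (simp add: e_def)
  have ex: "exp (- 2 * e\<^sup>2 / n) = exp (- real n * (L * t)\<^sup>2 / 8)"
    using n by (simp add: e_def power2_eq_square field_simps)
  have ev: "{x \<in> space D. vinner d x \<theta> \<le> s} \<in> events" if "\<theta> \<in> \<Theta>" for \<theta> s
    using measurable_marginal[of \<theta>] that \<Theta>(2) by auto
  have [measurable]: "bad1 \<theta> \<in> P.events" "bad2 \<theta> \<in> P.events" if "\<theta> \<in> \<Theta>" for \<theta>
    using measurable_count_below[of \<theta> n] that \<Theta>(2) unfolding bad1_def bad2_def P_def by auto
  have b1: "P.prob (bad1 \<theta>) \<le> exp (- real n * (L * t)\<^sup>2 / 8)" if \<theta>: "\<theta> \<in> \<Theta>" for \<theta>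
  proof -
    let ?A = "{x \<in> space D. vinner d x \<theta> \<le> Q \<theta> - t}"
    have "real n * prob ?A \<le> real n * (q - L * t / 2)"
      using \<theta> \<Theta>(2) t by (intro mult_left_mono prob_below_quantile) auto
    moreover have "real n * (q - L * t / 2) + e \<le> real n * q"
      using L t by (simp add: e_def field_simps)
    ultimately have "bad1 \<theta> \<subseteq> {X \<in> space P. real n * prob ?A + e \<le> (\<Sum>i<n. indicator ?A (X i))}"
      by (auto simp: bad1_def P_def count_below_eq_indicator)
    then have "P.prob (bad1 \<theta>) \<le> P.prob {X \<in> space P. real n * prob ?A + e \<le> (\<Sum>i<n. indicator ?A (X i))}"
    proof (rule P.finite_measure_mono)
      show "{X \<in> space P. real n * prob ?A + e \<le> (\<Sum>i<n. indicator ?A (X i))} \<in> P.events"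
        using measurable_count_below[of \<theta> n "Q \<theta> - t"] \<theta> \<Theta>(2) unfolding P_def
        by (simp add: count_below_eq_indicator[symmetric] subset_iff cong: conj_cong)
    qed
    also have "\<dots> \<le> exp (- real n * (L * t)\<^sup>2 / 8)"
      unfolding ex[symmetric] P_def by (rule empirical_frequency_tails(1)[OF ev[OF \<theta>] n e])
    finally show ?thesis .
  qed
  have b2: "P.prob (bad2 \<theta>) \<le> exp (- real n * (L * t)\<^sup>2 / 8)" if \<theta>: "\<theta> \<in> \<Theta>" for \<theta>
  proof -
    let ?A = "{x \<in> space D. vinner d x \<theta> \<le> Q \<theta> + t}"
    have "real n * (q + L * t / 2) \<le> real n * prob ?A"
      using \<theta> \<Theta>(2) t by (intro mult_left_mono prob_above_quantile) auto
    moreover have "real n * q + e \<le> real n * (q + L * t / 2) - e"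
      using L t by (simp add: e_def field_simps)
    ultimately have "bad2 \<theta> \<subseteq> {X \<in> space P. (\<Sum>i<n. indicator ?A (X i)) \<le> real n * prob ?A - e}"
      by (auto simp: bad2_def P_def count_below_eq_indicator)
    then have "P.prob (bad2 \<theta>) \<le> P.prob {X \<in> space P. (\<Sum>i<n. indicator ?A (X i)) \<le> real n * prob ?A - e}"
    proof (rule P.finite_measure_mono)
      show "{X \<in> space P. (\<Sum>i<n. indicator ?A (X i)) \<le> real n * prob ?A - e} \<in> P.events"
        using measurable_count_below[of \<theta> n "Q \<theta> + t"] \<theta> \<Theta>(2) unfolding P_def
        by (simp add: count_below_eq_indicator[symmetric] subset_iff cong: conj_cong)
    qed
    also have "\<dots> \<le> exp (- real n * (L * t)\<^sup>2 / 8)"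
      unfolding ex[symmetric] P_def by (rule empirical_frequency_tails(2)[OF ev[OF \<theta>] n e])
    finally show ?thesis .
  qed
  let ?U = "\<Union>\<theta>\<in>\<Theta>. bad1 \<theta> \<union> bad2 \<theta>"
  have U: "?U \<in> P.events" using \<Theta>(1) by (intro sets.finite_UN) auto
  have "P.prob ?U \<le> (\<Sum>\<theta>\<in>\<Theta>. P.prob (bad1 \<theta> \<union> bad2 \<theta>))"
    using \<Theta>(1) by (intro P.finite_measure_subadditive_finite) auto
  also have "\<dots> \<le> (\<Sum>\<theta>\<in>\<Theta>. 2 * exp (- real n * (L * t)\<^sup>2 / 8))"
  proof (intro sum_mono)
    fix \<theta> assume \<theta>: "\<theta> \<in> \<Theta>"
    have "P.prob (bad1 \<theta> \<union> bad2 \<theta>) \<le> P.prob (bad1 \<theta>) + P.prob (bad2 \<theta>)"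
      using \<theta> by (intro measure_Un_le) auto
    then show "P.prob (bad1 \<theta> \<union> bad2 \<theta>) \<le> 2 * exp (- real n * (L * t)\<^sup>2 / 8)"
      using b1[OF \<theta>] b2[OF \<theta>] by simp
  qed
  finally have "P.prob ?U \<le> 2 * real (card \<Theta>) * exp (- real n * (L * t)\<^sup>2 / 8)" by simp
  moreover have "typical_samples n \<Theta> t = space P - ?U"
    by (auto simp: typical_samples_def P_def[symmetric] bad1_def bad2_def e_def not_less)
  ultimately show ?thesis using P.prob_compl[OF U] by (simp add: P_def)
qed

end

section \<open>Accuracy of the depth mechanism\<close>

lemma ennsqrt_square: "(ennsqrt x)\<^sup>2 = x"
proof (cases x)
  case (real r)
  then show ?thesis by (simp add: ennsqrt_def ennreal_power)
qed (simp add: ennsqrt_def power2_eq_square)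

lemma W2_square_le:
  assumes "\<gamma> \<in> couplings M N"
    and "(\<integral>\<^sup>+(x, y). ennreal ((vnorm d (\<lambda>i. x i - y i))\<^sup>2) \<partial>\<gamma>) \<le> C"
  shows "(W2 d M N)\<^sup>2 \<le> C"
proof -
  let ?c = "\<integral>\<^sup>+(x, y). ennreal ((vnorm d (\<lambda>i. x i - y i))\<^sup>2) \<partial>\<gamma>"
  have "W2 d M N \<le> ennsqrt ?c" unfolding W2_def by (intro INF_lower assms(1))
  then have "(W2 d M N)\<^sup>2 \<le> (ennsqrt ?c)\<^sup>2" by (intro power_mono) auto
  also have "\<dots> = ?c" by (rule ennsqrt_square)
  finally show ?thesis using assms(2) by (rule order.trans)
qed

text \<open>
  The right-hand side is the common mass of the two laws in \<open>W2_depth_mechanism\<close>: the failure probability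
  costs a factor \<open>1 - \<mu>\<close>, the shrunk body a factor \<open>(1 - \<mu>)\<^sup>d\<close>, and the normalizer the denominator. It is
  at least \<open>(1 - \<mu>) ^ (2 d + 2)\<close>, and Bernoulli's inequality applies.
\<close>

lemma dilation_loss:
  fixes \<mu> :: real
  assumes "0 \<le> \<mu>" "\<mu> < 1" "1 \<le> d"
  shows "1 - 4 * real d * \<mu> \<le> (1 - \<mu>) * (1 - \<mu>) ^ d / (1 / (1 - \<mu>) ^ d + \<mu>)"
proof -
  define y where "y = (1 - \<mu>) ^ d"
  have y: "0 < y" "y \<le> 1" unfolding y_def using assms by (auto intro: power_le_one)
  have "1 - 4 * real d * \<mu> \<le> 1 + real (2 * d + 2) * (- \<mu>)"
    using assms by (simp add: algebra_simps mult_left_mono)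
  also have "\<dots> \<le> (1 + - \<mu>) ^ (2 * d + 2)"
    by (rule Bernoulli_inequality) (use assms in simp)
  also have "\<dots> = (1 - \<mu>)\<^sup>2 * y\<^sup>2"
    by (simp add: y_def power_add power_mult mult.commute power2_eq_square flip: power_mult_distrib)
  also have "\<dots> = (1 - \<mu>) * y * ((1 - \<mu>) * y)" by (simp add: power2_eq_square)
  also have "\<dots> \<le> (1 - \<mu>) * y * (1 / (1 / y + \<mu>))"
  proof (rule mult_left_mono)
    have "(1 - \<mu>) * y * (1 / y + \<mu>) = (1 - \<mu>) * (1 + \<mu> * y)" using y by (simp add: field_simps)
    also have "\<dots> \<le> (1 - \<mu>) * (1 + \<mu>)" using assms y by (intro mult_left_mono) (auto simp: mult_left_le)
    also have "\<dots> \<le> 1" by (simp add: algebra_simps)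
    finally have "(1 - \<mu>) * y * (1 / y + \<mu>) \<le> 1" .
    moreover have "0 < 1 / y + \<mu>" using y assms by (intro add_pos_nonneg) auto
    ultimately show "(1 - \<mu>) * y \<le> 1 / (1 / y + \<mu>)" by (simp add: le_divide_eq)
  qed (use assms y in auto)
  finally show ?thesis by (simp add: y_def)
qed

text \<open>
  The exponential mechanism for the depth score, with Lebesgue measure on a ball as base measure.
\<close>

definition depth_mechanism ::
  "nat \<Rightarrow> nat \<Rightarrow> real \<Rightarrow> real \<Rightarrow> real \<Rightarrow> (nat \<Rightarrow> real) set \<Rightarrow> (nat \<Rightarrow> nat \<Rightarrow> real) \<Rightarrow> (nat \<Rightarrow> real) measure" where
  "depth_mechanism n d q \<rho> \<epsilon> \<Theta> =
     exponential_mechanism (lebesgue_rvec d) (vcball d (\<lambda>_. 0) \<rho>) \<epsilon> (depth_excess n d q \<Theta>)"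

lemma emeasure_vcball_pos_finite:
  assumes "1 \<le> d" "0 < \<rho>"
  shows "0 < emeasure (lebesgue_rvec d) (vcball d (\<lambda>_. 0) \<rho>)"
    and "emeasure (lebesgue_rvec d) (vcball d (\<lambda>_. 0) \<rho>) < \<infinity>"
proof -
  have "0 < ennreal ((2 * \<rho> / real d) ^ d)" using assms by simp
  also have "\<dots> \<le> emeasure (lebesgue_rvec d) (vcball d (\<lambda>_. 0) \<rho>)"
    using assms by (intro emeasure_vcball_ge[of \<rho> d "\<lambda>_. 0"]) auto
  finally show "0 < emeasure (lebesgue_rvec d) (vcball d (\<lambda>_. 0) \<rho>)" .
  show "emeasure (lebesgue_rvec d) (vcball d (\<lambda>_. 0) \<rho>) < \<infinity>"
    using emeasure_vcball_le[of \<rho> d] assms by (auto simp: le_less_trans)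
qed

lemma depth_mechanism_randomized:
  assumes "1 \<le> d" "0 < \<rho>" "0 \<le> \<epsilon>" "finite \<Theta>" "\<Theta> \<subseteq> vsphere d"
  shows "depth_mechanism n d q \<rho> \<epsilon> \<Theta> \<in> randomized_algorithms n d"
proof -
  have "depth_mechanism n d q \<rho> \<epsilon> \<Theta> \<in> PiM {..<n} (\<lambda>_. rvec d) \<rightarrow>\<^sub>M prob_algebra (lebesgue_rvec d)"
    unfolding depth_mechanism_def using assms emeasure_vcball_pos_finite[of d \<rho>]
    by (intro measurable_exponential_mechanism sigma_finite_lebesgue_rvec measurable_depth_excess) auto
  moreover have "prob_algebra (lebesgue_rvec d) = prob_algebra (rvec d)"
    unfolding prob_algebra_def by (simp cong: subprob_algebra_cong)
  ultimately show ?thesis by (simp add: randomized_algorithms_def)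
qed

lemma measurable_depth_excess_sample:
  assumes "finite \<Theta>" "\<Theta> \<subseteq> vsphere d" "X \<in> space (PiM {..<n} (\<lambda>_. rvec d))"
  shows "depth_excess n d q \<Theta> X \<in> borel_measurable (lebesgue_rvec d)"
  using measurable_Pair2[OF measurable_depth_excess[OF assms(1,2)] assms(3), of q] by simp

lemma depth_mechanism_private:
  assumes "1 \<le> d" "0 < \<rho>" "0 \<le> \<epsilon>" "finite \<Theta>" "\<Theta> \<noteq> {}" "\<Theta> \<subseteq> vsphere d"
  shows "differentially_private n d \<epsilon> (depth_mechanism n d q \<rho> \<epsilon> \<Theta>)"
  unfolding differentially_private_def depth_mechanism_def
  using assms emeasure_vcball_pos_finite[of d \<rho>] depth_excess_sensitivity[of \<Theta>]
  by (intro ballI exponential_mechanism_private measurable_depth_excess_sample) auto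

context quantile_window
begin

text \<open>
  Apply the constraint of the floating body to the point \<open>c + s \<theta>\<close> of the ball.
\<close>

lemma inball_margin:
  assumes ball: "vcball d c s \<subseteq> F" and s: "0 \<le> s" and \<theta>: "\<theta> \<in> vsphere d"
  shows "vinner d c \<theta> + s \<le> Q \<theta>"
proof -
  let ?x = "\<lambda>i\<in>{..<d}. c i + s * \<theta> i"
  have "vnorm d (\<lambda>i. ?x i - c i) = vnorm d (\<lambda>i. s * \<theta> i)" by (simp add: vnorm_def)
  also have "\<dots> = s * vnorm d \<theta>"
    using s by (simp add: vnorm_def power_mult_distrib real_sqrt_mult flip: sum_distrib_left)
  also have "\<dots> = s" using \<theta> by (simp add: vsphere_def)
  finally have "?x \<in> F" using ball by (auto simp: vcball_def space_rvec)
  then have "vinner d ?x \<theta> \<le> Q \<theta>" using \<theta> by (simp add: floating_body_iff)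
  also have "vinner d ?x \<theta> = vinner d c \<theta> + s * vinner d \<theta> \<theta>"
    by (simp add: vinner_def algebra_simps sum.distrib sum_distrib_left)
  also have "vinner d \<theta> \<theta> = 1" using \<theta> by (simp add: vinner_self vsphere_def)
  finally show ?thesis by simp
qed

text \<open>
  A homothety towards the centre of an inscribed ball of radius \<open>s\<close> gains a margin \<open>\<mu> s\<close> in every
  direction, which pays for a violation of the constraints by \<open>\<mu> s\<close>.
\<close>

lemma contraction_into_floating_body:
  assumes ball: "vcball d c s \<subseteq> F" and s: "0 < s" and \<mu>: "0 \<le> \<mu>" "\<mu> \<le> 1"
    and x: "\<And>\<theta>. \<theta> \<in> vsphere d \<Longrightarrow> vinner d x \<theta> \<le> Q \<theta> + \<mu> * s"
  shows "vdilate d c (1 - \<mu>) x \<in> F"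
  unfolding floating_body_iff
proof (intro conjI ballI)
  fix \<theta> assume \<theta>: "\<theta> \<in> vsphere d"
  have "vinner d (vdilate d c (1 - \<mu>) x) \<theta> = \<mu> * vinner d c \<theta> + (1 - \<mu>) * vinner d x \<theta>"
    by (simp add: vinner_vdilate)
  also have "\<dots> \<le> \<mu> * (Q \<theta> - s) + (1 - \<mu>) * (Q \<theta> + \<mu> * s)"
    using inball_margin[OF ball _ \<theta>] s \<mu> x[OF \<theta>] by (intro add_mono mult_left_mono) auto
  also have "\<dots> = Q \<theta> - \<mu> * (\<mu> * s)" by (simp add: algebra_simps)
  also have "\<dots> \<le> Q \<theta>" using \<mu> s by simp
  finally show "vinner d (vdilate d c (1 - \<mu>) x) \<theta> \<le> Q \<theta>" .
qed simp

text \<open>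
  The same gain, read on the image of the floating body under the homothety of ratio \<open>1 - \<mu>\<close>.
\<close>

lemma shrunk_floating_body_margin:
  assumes ball: "vcball d c s \<subseteq> F" and s: "0 < s" and \<mu>: "0 \<le> \<mu>" "\<mu> < 1"
    and x: "x \<in> space (rvec d)" "vdilate d c (1 / (1 - \<mu>)) x \<in> F" and \<theta>: "\<theta> \<in> vsphere d"
  shows "vinner d x \<theta> \<le> Q \<theta> - \<mu> * s"
proof -
  let ?y = "vdilate d c (1 / (1 - \<mu>)) x"
  have "x = vdilate d c (1 - \<mu>) ?y" using vdilate_inverse[of "1 - \<mu>" x d c] \<mu> x by simp
  then have "vinner d x \<theta> = \<mu> * vinner d c \<theta> + (1 - \<mu>) * vinner d ?y \<theta>"
    using vinner_vdilate[of d c "1 - \<mu>" ?y \<theta>] by simp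
  also have "\<dots> \<le> \<mu> * (Q \<theta> - s) + (1 - \<mu>) * Q \<theta>"
    using inball_margin[OF ball _ \<theta>] s \<mu> x(2) \<theta>
    by (intro add_mono mult_left_mono) (auto simp: floating_body_iff)
  finally show ?thesis by (simp add: algebra_simps)
qed

lemma depth_excess_on_typical_samples:
  assumes X: "X \<in> typical_samples n \<Theta> t" and \<Theta>: "finite \<Theta>" "\<Theta> \<noteq> {}"
  shows "(\<And>\<theta>. \<theta> \<in> \<Theta> \<Longrightarrow> vinner d x \<theta> \<le> Q \<theta> - t) \<Longrightarrow> depth_excess n d q \<Theta> X x = 0"
    and "x \<in> space (rvec d) \<Longrightarrow> x \<notin> outer_polytope \<Theta> t \<Longrightarrow> real n * L * t / 4 \<le> depth_excess n d q \<Theta> X x"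
proof -
  assume x: "\<And>\<theta>. \<theta> \<in> \<Theta> \<Longrightarrow> vinner d x \<theta> \<le> Q \<theta> - t"
  have "depth_excess n d q \<Theta> X x \<le> 0"
  proof (rule depth_excess_le[OF \<Theta>])
    fix \<theta> assume \<theta>: "\<theta> \<in> \<Theta>"
    show "count_below n d X \<theta> (vinner d x \<theta>) - real n * q \<le> 0"
      using count_below_mono[OF x[OF \<theta>], of n d X \<theta>] X \<theta> by (fastforce simp: typical_samples_def)
  qed simp
  then show "depth_excess n d q \<Theta> X x = 0" using depth_excess_nonneg[of n d q \<Theta> X x] by linarith
next
  assume "x \<in> space (rvec d)" "x \<notin> outer_polytope \<Theta> t"
  then obtain \<theta> where \<theta>: "\<theta> \<in> \<Theta>" "Q \<theta> + t < vinner d x \<theta>" by (auto simp: outer_polytope_def not_le)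
  then have "real n * q + real n * L * t / 4 \<le> count_below n d X \<theta> (vinner d x \<theta>)"
    using X count_below_mono[of "Q \<theta> + t" "vinner d x \<theta>" n d X \<theta>] by (fastforce simp: typical_samples_def)
  then show "real n * L * t / 4 \<le> depth_excess n d q \<Theta> X x"
    using depth_excess_ge[OF \<Theta>(1) \<theta>(1), of n d X x q] by linarith
qed

text \<open>
  The common part of the two laws is a multiple of Lebesgue measure on the copy \<open>I\<close> of the floating body
  shrunk by \<open>1 - \<mu>\<close>. For typical samples the output density on \<open>I\<close> is the reciprocal of the normalizer, and
  the normalizer is at most \<open>z = v (1 / (1 - \<mu>)\<^sup>d + \<mu>)\<close>, where \<open>v\<close> is the volume of the floating body:
  the outer polytope lies in the copy \<open>J\<close> enlarged by \<open>1 / (1 - \<mu>)\<close>, and the hypothesis \<open>tail\<close> bounds the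
  rest by \<open>\<mu> v\<close>.
\<close>

lemma W2_depth_mechanism:
  fixes n :: nat and \<Theta> :: "(nat \<Rightarrow> real) set" and \<rho> \<epsilon> :: real
  defines "\<A> \<equiv> depth_mechanism n d q \<rho> \<epsilon> \<Theta>"
  assumes d: "1 \<le> d" and \<rho>: "0 < \<rho>" "\<And>\<theta>. \<theta> \<in> vsphere d \<Longrightarrow> Q \<theta> \<le> \<rho>"
    and s: "0 < s" "vcball d c s \<subseteq> F"
    and \<Theta>: "finite \<Theta>" "\<Theta> \<noteq> {}" "\<Theta> \<subseteq> vsphere d"
    and net: "\<And>\<theta>. \<theta> \<in> vsphere d \<Longrightarrow> \<exists>\<theta>'\<in>\<Theta>. vnorm d (\<lambda>i. \<theta> i - \<theta>' i) \<le> \<delta>"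
    and t: "0 < t" "t \<le> r"
    and p: "0 \<le> p" "1 - L * t / 4 \<le> prob {x \<in> space D. vnorm d x \<le> p}"
    and \<delta>: "\<delta> * (p + \<rho>) \<le> t / 2"
    and \<mu>: "\<mu> * s = 2 * t" "\<mu> < 1" and n: "0 < n" and \<epsilon>: "0 \<le> \<epsilon>"
    and fail: "2 * real (card \<Theta>) * exp (- real n * (L * t)\<^sup>2 / 8) \<le> \<mu>"
    and tail: "exp (- (\<epsilon> / 2) * (real n * L * t / 4)) * (2 * \<rho>) ^ d \<le> \<mu> * (2 * s / real d) ^ d"
  shows "(W2 d (output_law n \<A> D) (uniform_law d F))\<^sup>2 \<le> ennreal (4 * \<rho>\<^sup>2) * ennreal (4 * real d * \<mu>)"
proof -
  define \<nu> where "\<nu> = lebesgue_rvec d"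
  define B where "B = vcball d (\<lambda>_. 0) \<rho>"
  define P where "P = PiM {..<n} (\<lambda>_. D)"
  define M where "M = output_law n \<A> D"
  define N where "N = uniform_law d F"
  define K where "K = outer_polytope \<Theta> t"
  define G where "G = typical_samples n \<Theta> t"
  define I where "I = vdilate d c (1 / (1 - \<mu>)) -` F \<inter> space (rvec d)"
  define J where "J = vdilate d c (1 - \<mu>) -` F \<inter> space (rvec d)"
  define v where "v = measure \<nu> F"
  interpret P: prob_space P unfolding P_def by (intro prob_space_PiM prob_space_axioms)
  have s\<nu>: "sets \<nu> = sets (rvec d)" "space \<nu> = space (rvec d)" by (simp_all add: \<nu>_def)
  have \<mu>0: "0 < \<mu>" using \<mu>(1) s(1) t(1) by (smt (verit) mult_nonpos_nonneg)
  have F: "F \<in> sets \<nu>" using sets_floating_body[of \<rho>] \<rho> by (simp add: s\<nu>)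
  have FB: "F \<subseteq> B" unfolding B_def using floating_body_subset_ball[of \<rho>] \<rho> by simp
  have B: "B \<in> sets \<nu>" by (simp add: B_def s\<nu>)
  have K: "K \<in> sets \<nu>" unfolding K_def s\<nu> by (rule sets_outer_polytope[OF \<Theta>(1,3)])
  have I: "I \<in> sets \<nu>" and J: "J \<in> sets \<nu>"
    using measurable_sets[OF measurable_vdilate] F unfolding I_def J_def s\<nu> by auto
  have \<nu>B: "emeasure \<nu> B \<le> ennreal ((2 * \<rho>) ^ d)"
    unfolding \<nu>_def B_def using \<rho>(1) by (intro emeasure_vcball_le) simp
  have \<nu>F_fin: "emeasure \<nu> F < \<infinity>"
    using emeasure_mono[OF FB B] \<nu>B by (auto simp: le_less_trans)
  have \<nu>F: "emeasure \<nu> F = ennreal v" unfolding v_def using \<nu>F_fin by (intro emeasure_eq_ennreal_measure) auto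
  have v_ge: "(2 * s / real d) ^ d \<le> v"
    using emeasure_vcball_ge[of s d c F] s F d \<nu>F by (simp add: \<nu>_def ennreal_le_iff v_def)
  have v: "0 < v" using v_ge s d by (smt (verit) divide_pos_pos of_nat_0_less_iff zero_less_power less_le_trans zero_less_one)
  define z where "z = v * (1 / (1 - \<mu>) ^ d + \<mu>)"
  have z: "0 < z" "v \<le> z"
  proof -
    have "(1 - \<mu>) ^ d \<le> 1" "0 < (1 - \<mu>) ^ d" using \<mu> \<mu>0 by (auto intro: power_le_one)
    then have "1 \<le> 1 / (1 - \<mu>) ^ d" by simp
    then have 1: "1 \<le> 1 / (1 - \<mu>) ^ d + \<mu>" using \<mu>0 by linarith
    show "v \<le> z" unfolding z_def using v mult_left_mono[OF 1, of v] by simp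
    then show "0 < z" using v by linarith
  qed
  have IF: "x \<in> F" and margin: "\<And>\<theta>. \<theta> \<in> vsphere d \<Longrightarrow> vinner d x \<theta> \<le> Q \<theta> - 2 * t" if "x \<in> I" for x
  proof -
    show m: "vinner d x \<theta> \<le> Q \<theta> - 2 * t" if \<theta>: "\<theta> \<in> vsphere d" for \<theta>
      using shrunk_floating_body_margin[OF s(2,1) _ \<mu>(2) _ _ \<theta>, of x] \<mu>0 \<open>x \<in> I\<close> \<mu>(1)
      by (simp add: I_def)
    show "x \<in> F" unfolding floating_body_iff
    proof (intro conjI ballI)
      fix \<theta> assume "\<theta> \<in> vsphere d"
      from m[OF this] show "vinner d x \<theta> \<le> Q \<theta>" using t by linarith
    qed (use that in \<open>simp add: I_def\<close>)
  qed
  have KJ: "K \<inter> B \<subseteq> J"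
  proof
    fix x assume x: "x \<in> K \<inter> B"
    then have "vdilate d c (1 - \<mu>) x \<in> F"
      using outer_polytope_margin[OF \<Theta>(3) net t p \<delta>, of x] \<mu>0 \<mu> s
      by (intro contraction_into_floating_body[of c s]) (auto simp: K_def B_def vcball_def)
    then show "x \<in> J" using x by (auto simp: J_def B_def vcball_def)
  qed
  have \<nu>I: "emeasure \<nu> I = ennreal ((1 - \<mu>) ^ d * v)"
  proof -
    have "ennreal (1 / (1 - \<mu>) ^ d) * emeasure \<nu> I = ennreal v"
      using emeasure_vdilate_vimage[of "1 / (1 - \<mu>)" F d c] \<mu> F \<nu>F
      by (simp add: I_def \<nu>_def power_divide)
    then have "ennreal ((1 - \<mu>) ^ d) * (ennreal (1 / (1 - \<mu>) ^ d) * emeasure \<nu> I) = ennreal ((1 - \<mu>) ^ d) * ennreal v"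
      by simp
    then show ?thesis using \<mu> v
      by (simp add: mult.assoc[symmetric] flip: ennreal_mult)
  qed
  have \<nu>J: "emeasure \<nu> J = ennreal (v / (1 - \<mu>) ^ d)"
  proof -
    have "ennreal ((1 - \<mu>) ^ d) * emeasure \<nu> J = ennreal v"
      using emeasure_vdilate_vimage[of "1 - \<mu>" F d c] \<mu> F \<nu>F by (simp add: J_def \<nu>_def)
    then have "ennreal (1 / (1 - \<mu>) ^ d) * (ennreal ((1 - \<mu>) ^ d) * emeasure \<nu> J)
        = ennreal (1 / (1 - \<mu>) ^ d) * ennreal v" by simp
    then show ?thesis using \<mu> v by (simp add: mult.assoc[symmetric] flip: ennreal_mult)
  qed
  have normalizer: "emeasure \<nu> (K \<inter> B) + ennreal (exp (- (\<epsilon> / 2) * (real n * L * t / 4))) * emeasure \<nu> B \<le> ennreal z"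
  proof -
    let ?e = "exp (- (\<epsilon> / 2) * (real n * L * t / 4))"
    have "emeasure \<nu> (K \<inter> B) \<le> ennreal (v / (1 - \<mu>) ^ d)"
      using emeasure_mono[OF KJ J] \<nu>J by simp
    moreover have "ennreal ?e * emeasure \<nu> B \<le> ennreal ?e * ennreal ((2 * \<rho>) ^ d)"
      by (intro mult_left_mono \<nu>B) auto
    moreover have "\<dots> \<le> ennreal (\<mu> * v)"
    proof -
      have "\<mu> * (2 * s / real d) ^ d \<le> \<mu> * v" using v_ge \<mu>0 by (intro mult_left_mono) auto
      then show ?thesis using tail \<rho>(1) by (simp add: ennreal_leI flip: ennreal_mult)
    qed
    ultimately have "emeasure \<nu> (K \<inter> B) + ennreal ?e * emeasure \<nu> B
        \<le> ennreal (v / (1 - \<mu>) ^ d) + ennreal (\<mu> * v)"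
      by (intro add_mono) auto
    also have "\<dots> = ennreal (v / (1 - \<mu>) ^ d + \<mu> * v)"
      using v \<mu>0 \<mu> by (intro ennreal_plus[symmetric]) auto
    finally show ?thesis by (simp add: z_def algebra_simps)
  qed
  have sP: "sets P = sets (PiM {..<n} (\<lambda>_. rvec d))"
    unfolding P_def by (intro sets_PiM_cong) (auto simp: sets_D)
  have \<nu>B0: "0 < emeasure \<nu> B" and \<nu>B1: "emeasure \<nu> B < \<infinity>"
    using emeasure_vcball_pos_finite[OF d \<rho>(1)] by (simp_all add: \<nu>_def B_def)
  have kernel: "\<A> \<in> P \<rightarrow>\<^sub>M prob_algebra (rvec d)"
    using depth_mechanism_randomized[OF d \<rho>(1) \<epsilon> \<Theta>(1,3), of n q]
    by (subst measurable_cong_sets[OF sP refl]) (simp add: \<A>_def randomized_algorithms_def)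
  have PP: "P \<in> space (prob_algebra P)" by (simp add: space_prob_algebra P.prob_space_axioms)
  have M_eq: "emeasure M S = (\<integral>\<^sup>+X. emeasure (\<A> X) S \<partial>P)" if "S \<in> sets (rvec d)" for S
    unfolding M_def output_law_def P_def[symmetric]
    by (rule emeasure_bind_prob_algebra[OF PP kernel that])
  have sM: "sets M = sets (rvec d)" "prob_space M"
    unfolding M_def output_law_def P_def[symmetric]
    by (rule sets_bind'[OF PP kernel], rule prob_space_bind'[OF PP kernel])
  have spM: "space M = space (rvec d)" using sM(1) by (rule sets_eq_imp_space_eq)
  have u: "depth_excess n d q \<Theta> X \<in> borel_measurable \<nu>" if "X \<in> space P" for X
    using measurable_depth_excess_sample[OF \<Theta>(1,3), of X n q] that sets_eq_imp_space_eq[OF sP]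
    by (simp add: \<nu>_def)
  have N_eq: "emeasure N S = emeasure \<nu> (F \<inter> S) / ennreal v" if "S \<in> sets (rvec d)" for S
    using that F \<nu>F by (simp add: N_def uniform_law_def \<nu>_def emeasure_uniform_measure)
  have sN: "sets N = sets (rvec d)" by (simp add: N_def uniform_law_def)
  have N: "prob_space N"
    unfolding N_def uniform_law_def using \<nu>F v by (intro prob_space_uniform_measure) (auto simp: \<nu>_def)
  \<comment> \<open>From below, \<open>1 - \<mu>\<close> bounds the probability of typical samples and \<open>1 / z\<close> their output density on \<open>I\<close>.\<close>
  define w where "w = scale_measure (ennreal ((1 - \<mu>) / z)) (density \<nu> (indicator I))"
  have sw: "sets w = sets (rvec d)" by (simp add: w_def s\<nu>)
  have w_eq: "emeasure w S = ennreal ((1 - \<mu>) / z) * emeasure \<nu> (S \<inter> I)" if "S \<in> sets (rvec d)" for S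
    using that I emeasure_restricted[of I \<nu> S] by (simp add: w_def s\<nu> Int_commute)
  have wM: "emeasure w S \<le> emeasure M S" if S: "S \<in> sets (rvec d)" for S
  proof -
    have G: "G \<in> sets P" unfolding G_def P_def by (rule sets_typical_samples[OF \<Theta>(1,3)])
    have "1 - \<mu> \<le> P.prob G"
      using prob_typical_samples[OF \<Theta>(1,3) t n] fail by (simp add: P_def G_def)
    then have PG: "ennreal (1 - \<mu>) \<le> emeasure P G"
      by (simp add: P.emeasure_eq_measure ennreal_leI)
    have "emeasure w S = ennreal (1 - \<mu>) * (emeasure \<nu> (S \<inter> I) / ennreal z)"
      using \<mu> z S by (simp add: w_eq ennreal_divide_times divide_ennreal[symmetric])
    also have "\<dots> \<le> emeasure P G * (emeasure \<nu> (S \<inter> I) / ennreal z)"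
      by (intro mult_right_mono PG) auto
    also have "\<dots> = (\<integral>\<^sup>+X. (emeasure \<nu> (S \<inter> I) / ennreal z) * indicator G X \<partial>P)"
      by (subst nn_integral_cmult_indicator[OF G]) (rule mult.commute)
    also have "\<dots> \<le> (\<integral>\<^sup>+X. emeasure (\<A> X) S \<partial>P)"
    proof (rule nn_integral_mono)
      fix X assume X: "X \<in> space P"
      show "emeasure \<nu> (S \<inter> I) / ennreal z * indicator G X \<le> emeasure (\<A> X) S"
      proof (cases "X \<in> G")
        case True
        have "emeasure \<nu> (S \<inter> I) / ennreal z \<le> emeasure \<nu> (S \<inter> I) /
            (emeasure \<nu> (K \<inter> B) + ennreal (exp (- (\<epsilon> / 2) * (real n * L * t / 4))) * emeasure \<nu> B)"
          by (rule divide_left_antimono_ennreal[OF normalizer])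
        also have "\<dots> \<le> emeasure (\<A> X) S"
          unfolding \<A>_def depth_mechanism_def \<nu>_def[symmetric] B_def[symmetric]
        proof (rule exponential_mechanism_ge[where u="depth_excess n d q \<Theta>" and X=X,
              OF u[OF X] B K I _ _ \<epsilon>])
          show "I \<subseteq> B" using IF FB by blast
          show "S \<in> sets \<nu>" using S by (simp add: s\<nu>)
          show "depth_excess n d q \<Theta> X x = 0" if "x \<in> I" for x
          proof (rule depth_excess_on_typical_samples(1)[OF True[unfolded G_def] \<Theta>(1,2)])
            fix \<theta> assume "\<theta> \<in> \<Theta>"
            then have "\<theta> \<in> vsphere d" using \<Theta>(3) by blast
            from margin[OF that this] show "vinner d x \<theta> \<le> Q \<theta> - t" using t by linarith
          qed
          show "real n * L * t / 4 \<le> depth_excess n d q \<Theta> X x" if "x \<in> B" "x \<notin> K" for x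
            using that depth_excess_on_typical_samples(2)[OF True[unfolded G_def] \<Theta>(1,2), of x]
            by (simp add: B_def K_def vcball_def)
        qed simp
        finally show ?thesis using True by simp
      qed simp
    qed
    also have "\<dots> = emeasure M S" by (rule M_eq[OF S, symmetric])
    finally show ?thesis .
  qed
  have wN: "emeasure w S \<le> emeasure N S" if S: "S \<in> sets (rvec d)" for S
  proof -
    have "(1 - \<mu>) / z \<le> 1 / v" using \<mu>0 v z by (intro frac_le) auto
    then have "emeasure w S \<le> ennreal (1 / v) * emeasure \<nu> (F \<inter> S)"
      using IF S F by (auto simp: w_eq s\<nu> intro!: mult_mono ennreal_leI emeasure_mono)
    also have "\<dots> = emeasure N S"
      using S v by (simp add: N_eq divide_ennreal[symmetric] ennreal_divide_times)
    finally show ?thesis .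
  qed
  have w1: "1 - ennreal (4 * real d * \<mu>) \<le> emeasure w (space M)"
  proof -
    have "1 - 4 * real d * \<mu> \<le> (1 - \<mu>) * (1 - \<mu>) ^ d / (1 / (1 - \<mu>) ^ d + \<mu>)"
      using \<mu>0 \<mu> d by (intro dilation_loss) auto
    also have "\<dots> = (1 - \<mu>) / z * ((1 - \<mu>) ^ d * v)" using v by (simp add: z_def)
    finally have le: "1 - 4 * real d * \<mu> \<le> (1 - \<mu>) / z * ((1 - \<mu>) ^ d * v)" .
    have "1 - ennreal (4 * real d * \<mu>) = ennreal (1 - 4 * real d * \<mu>)"
      using \<mu>0 by (simp add: ennreal_minus flip: ennreal_1)
    also have "\<dots> \<le> ennreal ((1 - \<mu>) / z * ((1 - \<mu>) ^ d * v))" by (rule ennreal_leI[OF le])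
    also have "\<dots> = ennreal ((1 - \<mu>) / z) * ennreal ((1 - \<mu>) ^ d * v)"
      using \<mu> z v by (intro ennreal_mult) auto
    also have "\<dots> = ennreal ((1 - \<mu>) / z) * emeasure \<nu> (space M \<inter> I)"
      using sets.sets_into_space[OF I] by (simp add: \<nu>I spM s\<nu> Int_absorb1)
    also have "\<dots> = emeasure w (space M)" using sM by (simp add: w_eq spM)
    finally show ?thesis .
  qed
  let ?c = "\<lambda>(x, y). ennreal ((vnorm d (\<lambda>i. x i - y i))\<^sup>2)"
  have "\<exists>\<gamma>\<in>couplings M N. (\<integral>\<^sup>+p. ?c p \<partial>\<gamma>) \<le> ennreal (4 * \<rho>\<^sup>2) * ennreal (4 * real d * \<mu>)"
  proof (rule coupling_of_common_part[where w=w and B=B])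
    show "?c \<in> borel_measurable (M \<Otimes>\<^sub>M M)"
    proof -
      have "fst \<in> M \<Otimes>\<^sub>M M \<rightarrow>\<^sub>M rvec d" "snd \<in> M \<Otimes>\<^sub>M M \<rightarrow>\<^sub>M rvec d"
        using measurable_cong_sets[OF refl sM(1), of "M \<Otimes>\<^sub>M M"] by auto
      from measurable_vnorm_diff[OF this] show ?thesis by (simp add: case_prod_beta)
    qed
    show "?c (x, x) = 0" for x by (simp add: vnorm_def)
    show "emeasure M B = 1"
    proof -
      have "emeasure (\<A> X) B = 1" if "X \<in> space P" for X
        using u[OF that] B gibbs_weight_pos[OF u[OF that] B \<nu>B0, of \<epsilon>]
          gibbs_weight_fin[of B \<nu> \<epsilon> "depth_excess n d q \<Theta> X"] \<nu>B1 \<epsilon>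
        unfolding \<A>_def depth_mechanism_def \<nu>_def[symmetric] B_def[symmetric]
        by (simp add: emeasure_exponential_mechanism)
      then have "(\<integral>\<^sup>+X. emeasure (\<A> X) B \<partial>P) = (\<integral>\<^sup>+X. 1 \<partial>P)"
        by (rule nn_integral_cong)
      then have "emeasure M B = (\<integral>\<^sup>+X. 1 \<partial>P)" using B by (simp only: M_eq s\<nu>)
      then show ?thesis using P.emeasure_space_1 by simp
    qed
    show "emeasure N B = 1"
      using B FB v by (simp add: N_eq s\<nu> Int_absorb2 \<nu>F)
    show "?c (x, y) \<le> ennreal (4 * \<rho>\<^sup>2)" if "x \<in> B" "y \<in> B" for x y
    proof -
      have "vnorm d (\<lambda>i. x i - y i) \<le> 2 * \<rho>"
        using vnorm_triangle[of d x y] that by (simp add: B_def vcball_def)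
      then have "(vnorm d (\<lambda>i. x i - y i))\<^sup>2 \<le> (2 * \<rho>)\<^sup>2" by (intro power_mono) auto
      then show ?thesis by (simp add: power_mult_distrib ennreal_leI)
    qed
  qed (use sM sN N sw wM wN w1 B in \<open>simp_all add: s\<nu>\<close>)
  then show ?thesis unfolding M_def[symmetric] N_def[symmetric] by (blast intro: W2_square_le)
qed

end

section \<open>Logarithmic budget and sample size\<close>

text \<open>
  A pure power of \<open>Z\<close>, without a constant factor, so that such bounds can be multiplied without
  bookkeeping. Constants are absorbed by increasing the exponent, since \<open>Z\<close> is at least \<open>2\<close>.
\<close>

lemma poly_le_power:
  fixes p :: "real poly"
  shows "\<exists>N. \<forall>x Z. 2 \<le> Z \<longrightarrow> \<bar>x\<bar> \<le> Z \<longrightarrow> \<bar>poly p x\<bar> \<le> Z ^ N"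
proof (induction p)
  case 0
  then show ?case by (auto intro!: exI[of _ 0])
next
  case (pCons a p)
  then obtain N where N: "\<And>x Z. 2 \<le> Z \<Longrightarrow> \<bar>x\<bar> \<le> Z \<Longrightarrow> \<bar>poly p x\<bar> \<le> Z ^ N" by blast
  obtain k where k: "\<bar>a\<bar> < 2 ^ k" using real_arch_pow[of 2 "\<bar>a\<bar>"] by auto
  show ?case
  proof (intro exI[of _ "k + N + 2"] allI impI)
    fix x Z :: real assume Z: "2 \<le> Z" "\<bar>x\<bar> \<le> Z"
    have "\<bar>a\<bar> \<le> Z ^ k" using k power_mono[of 2 Z k] Z by linarith
    also have "\<dots> \<le> Z ^ (k + N + 1)" using Z by (intro power_increasing) auto
    finally have 1: "\<bar>a\<bar> \<le> Z ^ (k + N + 1)" .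
    have "\<bar>x * poly p x\<bar> \<le> Z * Z ^ N" unfolding abs_mult using N[OF Z] Z by (intro mult_mono) auto
    also have "\<dots> = Z ^ (N + 1)" by simp
    also have "\<dots> \<le> Z ^ (k + N + 1)" using Z by (intro power_increasing) auto
    finally have 2: "\<bar>x * poly p x\<bar> \<le> Z ^ (k + N + 1)" .
    have "\<bar>poly (pCons a p) x\<bar> \<le> 2 * Z ^ (k + N + 1)" using 1 2 by (simp add: abs_le_iff)
    also have "\<dots> \<le> Z * Z ^ (k + N + 1)" using Z by (intro mult_right_mono) auto
    finally show "\<bar>poly (pCons a p) x\<bar> \<le> Z ^ (k + N + 2)" by simp
  qed
qed

lemma poly_poly_le_power:
  fixes P :: "real poly poly"
  shows "\<exists>N. \<forall>x y Z. 2 \<le> Z \<longrightarrow> \<bar>x\<bar> \<le> Z \<longrightarrow> \<bar>y\<bar> \<le> Z \<longrightarrow> \<bar>poly (poly P [:x:]) y\<bar> \<le> Z ^ N"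
proof (induction P)
  case 0
  then show ?case by (auto intro!: exI[of _ 0])
next
  case (pCons a P)
  then obtain N where N: "\<And>x y Z. 2 \<le> Z \<Longrightarrow> \<bar>x\<bar> \<le> Z \<Longrightarrow> \<bar>y\<bar> \<le> Z \<Longrightarrow> \<bar>poly (poly P [:x:]) y\<bar> \<le> Z ^ N"
    by blast
  obtain k where k: "\<And>y Z. 2 \<le> Z \<Longrightarrow> \<bar>y\<bar> \<le> Z \<Longrightarrow> \<bar>poly a y\<bar> \<le> Z ^ k" using poly_le_power[of a] by blast
  show ?case
  proof (intro exI[of _ "k + N + 2"] allI impI)
    fix x y Z :: real assume Z: "2 \<le> Z" "\<bar>x\<bar> \<le> Z" "\<bar>y\<bar> \<le> Z"
    have "\<bar>poly a y\<bar> \<le> Z ^ k" by (rule k[OF Z(1,3)])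
    also have "\<dots> \<le> Z ^ (k + N + 1)" using Z by (intro power_increasing) auto
    finally have 1: "\<bar>poly a y\<bar> \<le> Z ^ (k + N + 1)" .
    have "\<bar>x * poly (poly P [:x:]) y\<bar> \<le> Z * Z ^ N"
      unfolding abs_mult using N[OF Z] Z by (intro mult_mono) auto
    also have "\<dots> = Z ^ (N + 1)" by simp
    also have "\<dots> \<le> Z ^ (k + N + 1)" using Z by (intro power_increasing) auto
    finally have 2: "\<bar>x * poly (poly P [:x:]) y\<bar> \<le> Z ^ (k + N + 1)" .
    have "\<bar>poly (poly (pCons a P) [:x:]) y\<bar> \<le> 2 * Z ^ (k + N + 1)" using 1 2 by (simp add: abs_le_iff)
    also have "\<dots> \<le> Z * Z ^ (k + N + 1)" using Z by (intro mult_right_mono) auto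
    finally show "\<bar>poly (poly (pCons a P) [:x:]) y\<bar> \<le> Z ^ (k + N + 2)" by simp
  qed
qed

text \<open>
  The number of cells per coordinate of the net and the ratio of the radii are bounded by a power of \<open>Z\<close>
  with an exponent that depends only on \<open>P\<close>. The bound \<open>p\<close> on the norm of a data point comes from an
  auxiliary sample size \<open>m\<close> that depends only on \<open>L\<close> and \<open>t\<close>. Thus the net does not depend on the number \<open>n\<close>
  of samples, and \<open>n\<close> can be chosen afterwards.
\<close>

lemma net_resolution_le_power:
  fixes P :: "real poly poly" and d N0 :: nat and Rmax Rmin r L \<alpha> Z :: real
  assumes N0: "\<forall>x y Z. 2 \<le> Z \<longrightarrow> \<bar>x\<bar> \<le> Z \<longrightarrow> \<bar>y\<bar> \<le> Z \<longrightarrow> \<bar>poly (poly P [:x:]) y\<bar> \<le> Z ^ N0"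
    and Z: "18 \<le> Z" and d: "1 \<le> d" and pos: "0 < Rmax" "0 < Rmin" "0 < r" "0 < L" "0 < \<alpha>"
    and le: "real d \<le> Z" "Rmax + r + 1 \<le> Z" "1 / Rmin \<le> Z" "1 / L \<le> Z" "1 / \<alpha> \<le> Z"
  defines "R \<equiv> Rmax + r + 1"
  defines "t \<equiv> \<alpha> * Rmin / (32 * R\<^sup>2)" and "\<mu> \<equiv> \<alpha> / (16 * R\<^sup>2)"
  defines "m \<equiv> nat \<lceil>4 / (L * t)\<rceil>"
  defines "p \<equiv> \<bar>poly (poly P [:real m:]) (real d)\<bar>"
  defines "k \<equiv> nat \<lceil>2 * real d * (p + Rmax) / t\<rceil>"
  shows "2 * (2 * real k + 1) / \<mu> \<le> Z ^ (9 * N0 + 16)"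
    and "Rmax * real d / (Rmin * \<mu>) \<le> Z ^ (9 * N0 + 16)"
proof -
  have R: "1 \<le> R" "R \<le> Z" using pos le by (simp_all add: R_def)
  have t: "0 < t" using pos R by (simp add: t_def)
  have Zpow: "Z ^ i * Z ^ j = Z ^ (i + j)" for i j by (simp add: power_add)
  have Zmono: "i \<le> j \<Longrightarrow> Z ^ i \<le> Z ^ j" for i j using Z by (intro power_increasing) auto
  have Z1: "1 \<le> Z ^ i" for i using Z by (intro one_le_power) auto
  have dbl: "2 * Z ^ i \<le> Z ^ j" "6 * Z ^ i \<le> Z ^ j" if "j = Suc i" for i j
    using Z Z1[of i] that by (auto intro!: mult_right_mono)
  have R2: "R\<^sup>2 \<le> Z ^ 2" using R by (intro power_mono) auto
  have t1: "1 / t \<le> Z ^ 6"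
  proof -
    have "1 / t = 32 * (R\<^sup>2 * (1 / \<alpha> * (1 / Rmin)))" by (simp add: t_def)
    also have "\<dots> \<le> (Z * Z) * (Z ^ 2 * (Z * Z))"
    proof (intro mult_mono R2 le)
      have "18 * 18 \<le> Z * Z" using Z by (intro mult_mono) auto
      then show "32 \<le> Z * Z" by simp
    qed (use pos Z in auto)
    finally show ?thesis by (simp add: eval_nat_numeral)
  qed
  have \<mu>1: "1 / \<mu> \<le> Z ^ 4"
  proof -
    have "1 / \<mu> = 16 * (R\<^sup>2 * (1 / \<alpha>))" by (simp add: \<mu>_def)
    also have "\<dots> \<le> Z * (Z ^ 2 * Z)"
      using Z pos by (intro mult_mono R2 le) auto
    finally show ?thesis by (simp add: eval_nat_numeral)
  qed
  have ceil: "real (nat \<lceil>x\<rceil>) \<le> x + 1" if "0 \<le> x" for x :: real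
    using that by linarith
  have m: "real m \<le> Z ^ 9"
  proof -
    have "4 / (L * t) = 4 * (1 / L * (1 / t))" by simp
    also have "\<dots> \<le> 4 * (Z * Z ^ 6)" using le t1 pos t Z by (intro mult_left_mono mult_mono) auto
    also have "\<dots> \<le> 6 * Z ^ 7" using Z1[of 7] by (simp add: eval_nat_numeral)
    also have "\<dots> \<le> Z ^ 8" using dbl(2)[of 8 7] by simp
    finally have "4 / (L * t) \<le> Z ^ 8" .
    moreover have "real m \<le> 4 / (L * t) + 1"
      unfolding m_def using pos t by (intro ceil) simp
    ultimately have "real m \<le> Z ^ 8 + 1" by linarith
    also have "\<dots> \<le> 2 * Z ^ 8" using Z1[of 8] by simp
    finally show ?thesis using dbl(1)[of 9 8] by simp
  qed
  have p: "p \<le> Z ^ (9 * N0)"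
  proof -
    have "Z \<le> Z ^ 9" using Zmono[of 1 9] by simp
    then have "p \<le> (Z ^ 9) ^ N0" unfolding p_def using Z le m by (intro N0[rule_format]) auto
    then show ?thesis by (simp add: power_mult)
  qed
  have p0: "0 \<le> p" by (simp add: p_def)
  have k: "real k \<le> Z ^ (9 * N0 + 11)"
  proof -
    have "Z ^ 1 \<le> Z ^ (9 * N0 + 1)" by (rule Zmono) simp
    then have "Rmax \<le> Z ^ (9 * N0 + 1)" using pos le unfolding power_one_right by linarith
    moreover have "p \<le> Z ^ (9 * N0 + 1)" using p Zmono[of "9 * N0" "9 * N0 + 1"] by linarith
    ultimately have "p + Rmax \<le> Z ^ (9 * N0 + 2)" using dbl(1)[of "9 * N0 + 2" "9 * N0 + 1"] by simp
    then have "real d * ((p + Rmax) * (1 / t)) \<le> Z * (Z ^ (9 * N0 + 2) * Z ^ 6)"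
      using le t1 t pos Z by (intro mult_mono) (auto simp: p_def)
    also have "\<dots> = Z ^ (9 * N0 + 9)" by (simp add: Zpow add.commute flip: power_Suc)
    finally have "2 * (real d * ((p + Rmax) * (1 / t))) \<le> 2 * Z ^ (9 * N0 + 9)" by (rule mult_left_mono) simp
    then have "2 * real d * (p + Rmax) / t \<le> 2 * Z ^ (9 * N0 + 9)" by simp
    then have "2 * real d * (p + Rmax) / t \<le> Z ^ (9 * N0 + 10)"
      using dbl(1)[of "9 * N0 + 10" "9 * N0 + 9"] by simp
    moreover have "real k \<le> 2 * real d * (p + Rmax) / t + 1"
      unfolding k_def using pos t p0 by (intro ceil) simp
    ultimately have "real k \<le> Z ^ (9 * N0 + 10) + 1" by linarith
    then show ?thesis using dbl(1)[of "9 * N0 + 11" "9 * N0 + 10"] Z1[of "9 * N0 + 10"] by simp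
  qed
  show "2 * (2 * real k + 1) / \<mu> \<le> Z ^ (9 * N0 + 16)"
  proof -
    have "2 * (2 * real k + 1) \<le> Z ^ (9 * N0 + 12)"
      using k Z1[of "9 * N0 + 11"] dbl(2)[of "9 * N0 + 12" "9 * N0 + 11"] by simp
    then have "2 * (2 * real k + 1) * (1 / \<mu>) \<le> Z ^ (9 * N0 + 12) * Z ^ 4"
      using \<mu>1 Z pos R by (intro mult_mono) (auto simp: \<mu>_def)
    then show ?thesis by (simp add: Zpow add.commute)
  qed
  show "Rmax * real d / (Rmin * \<mu>) \<le> Z ^ (9 * N0 + 16)"
  proof -
    have "Rmax * (real d * (1 / Rmin * (1 / \<mu>))) \<le> Z * (Z * (Z * Z ^ 4))"
      using le \<mu>1 pos Z R by (intro mult_mono) (auto simp: \<mu>_def)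
    also have "\<dots> = Z ^ 7" by (simp add: eval_nat_numeral)
    also have "\<dots> \<le> Z ^ (9 * N0 + 16)" by (rule Zmono) simp
    finally show ?thesis by simp
  qed
qed

text \<open>
  The first summand on the left is of order \<open>R\<^sup>4 / Rmin\<^sup>2 * d / (\<alpha>\<^sup>2 L\<^sup>2)\<close>, below the first term on the
  right. For the second one, of order \<open>d / (\<epsilon> L \<alpha>)\<close>, write the right-hand side as at least
  \<open>x\<^sup>2 + y\<^sup>2 \<ge> x y\<close> with \<open>x = d / (\<alpha>\<^sup>7 L)\<close> and \<open>y = d\<^sup>2 / \<epsilon>\<close>. The bound \<open>4 \<alpha> L \<le> 1\<close> comes from
  \<open>mass_window\<close>.
\<close>

lemma sample_size_le:
  fixes d :: nat and R Rmin L \<epsilon> \<alpha> :: real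
  assumes d: "1 \<le> d" and R: "1 \<le> R" "0 < Rmin" "Rmin \<le> R" and L: "0 < L" "4 * \<alpha> * L \<le> 1"
    and \<alpha>: "0 < \<alpha>" "\<alpha> < 1 / 2" and \<epsilon>: "0 < \<epsilon>"
  defines "t \<equiv> \<alpha> * Rmin / (32 * R\<^sup>2)"
  shows "real d * (8 / (L * t)\<^sup>2 + 8 / (\<epsilon> * L * t))
    \<le> 8448 * (R ^ 4 / Rmin ^ 2 * (real d ^ 2 / (\<alpha> ^ 14 * L ^ 2) + real d ^ 4 / (\<epsilon> ^ 2 * \<alpha> ^ 8 * L)))"
    and "1 \<le> 8 / (L * t)\<^sup>2"
proof -
  define x where "x = real d / (\<alpha> ^ 7 * L)"
  define y where "y = real d ^ 2 / \<epsilon>"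
  define g where "g = R ^ 4 / Rmin ^ 2"
  have g: "0 < g" using R by (simp add: g_def)
  have x2: "x\<^sup>2 = real d ^ 2 / (\<alpha> ^ 14 * L ^ 2)" by (simp add: x_def power_divide power_mult_distrib flip: power_mult)
  have y2: "y\<^sup>2 \<le> real d ^ 4 / (\<epsilon> ^ 2 * \<alpha> ^ 8 * L)"
  proof -
    have "\<alpha> ^ 8 * L = \<alpha> ^ 7 * (\<alpha> * L)" by (simp add: eval_nat_numeral)
    also have "\<dots> \<le> 1 * 1" using \<alpha> L by (intro mult_mono power_le_one) auto
    finally have "\<epsilon> ^ 2 * \<alpha> ^ 8 * L \<le> \<epsilon> ^ 2" using \<epsilon> by (simp add: mult_left_le mult.assoc)
    then have "real d ^ 4 / \<epsilon> ^ 2 \<le> real d ^ 4 / (\<epsilon> ^ 2 * \<alpha> ^ 8 * L)"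
      using \<epsilon> \<alpha> L by (intro divide_left_mono) auto
    then show ?thesis by (simp add: y_def power_divide flip: power_mult)
  qed
  have "real d * (8 / (L * t)\<^sup>2) = 8192 * (g * (real d / (\<alpha>\<^sup>2 * L\<^sup>2)))"
    using R L \<alpha> by (simp add: t_def g_def power_divide power_mult_distrib field_simps flip: power_mult)
  also have "\<dots> \<le> 8192 * (g * x\<^sup>2)"
  proof -
    have "\<alpha> ^ 14 \<le> \<alpha>\<^sup>2" using \<alpha> by (intro power_decreasing) auto
    moreover have "real d \<le> real d ^ 2" using d by (simp add: self_le_power)
    ultimately have "real d / (\<alpha>\<^sup>2 * L\<^sup>2) \<le> real d ^ 2 / (\<alpha> ^ 14 * L\<^sup>2)"
      using \<alpha> L by (intro frac_le mult_right_mono) auto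
    then show ?thesis unfolding x2 using g by (intro mult_left_mono) auto
  qed
  finally have 1: "real d * (8 / (L * t)\<^sup>2) \<le> 8192 * (g * x\<^sup>2)" .
  have "real d * (8 / (\<epsilon> * L * t)) = 256 * (R\<^sup>2 / Rmin * (real d / (\<epsilon> * L * \<alpha>)))"
    using R L \<alpha> \<epsilon> by (simp add: t_def field_simps)
  also have "\<dots> \<le> 256 * (g * (x\<^sup>2 + y\<^sup>2))"
  proof (intro mult_left_mono mult_mono)
    have "1 \<le> R\<^sup>2 / Rmin" using R by (simp add: power2_eq_square mult_le_cancel_left1 order.trans[OF R(3)])
    then have "R\<^sup>2 / Rmin \<le> (R\<^sup>2 / Rmin)\<^sup>2" by (simp add: self_le_power)
    then show "R\<^sup>2 / Rmin \<le> g" by (simp add: g_def power_divide flip: power_mult)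
    have "real d / (\<epsilon> * L * \<alpha>) \<le> real d ^ 3 / (\<epsilon> * L * \<alpha> ^ 7)"
      using d \<epsilon> L \<alpha> power_decreasing[of 1 7 \<alpha>] by (intro frac_le mult_left_mono) (auto simp: self_le_power)
    also have "\<dots> = x * y" by (simp add: x_def y_def eval_nat_numeral mult_ac)
    also have "\<dots> \<le> x\<^sup>2 + y\<^sup>2"
    proof -
      have "0 \<le> x * y" using \<epsilon> L \<alpha> by (simp add: x_def y_def)
      then show ?thesis using sum_squares_bound[of x y] by linarith
    qed
    finally show "real d / (\<epsilon> * L * \<alpha>) \<le> x\<^sup>2 + y\<^sup>2" .
  qed (use g \<epsilon> L \<alpha> R in auto)
  also have "\<dots> \<le> 256 * (g * (x\<^sup>2 + real d ^ 4 / (\<epsilon> ^ 2 * \<alpha> ^ 8 * L)))"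
    using y2 g by (intro mult_left_mono) auto
  finally have 2: "real d * (8 / (\<epsilon> * L * t)) \<le> 256 * (g * (x\<^sup>2 + real d ^ 4 / (\<epsilon> ^ 2 * \<alpha> ^ 8 * L)))" .
  have 3: "0 \<le> g * (real d ^ 4 / (\<epsilon> ^ 2 * \<alpha> ^ 8 * L))" using g \<epsilon> \<alpha> L by simp
  show "real d * (8 / (L * t)\<^sup>2 + 8 / (\<epsilon> * L * t))
    \<le> 8448 * (R ^ 4 / Rmin ^ 2 * (real d ^ 2 / (\<alpha> ^ 14 * L ^ 2) + real d ^ 4 / (\<epsilon> ^ 2 * \<alpha> ^ 8 * L)))"
  proof -
    have sum: "u1 + u2 \<le> 8448 * (a + b)" if "u1 \<le> 8192 * a" "u2 \<le> 256 * (a + b)" "0 \<le> b" for u1 u2 a b :: real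
      using that by simp
    show ?thesis
      using sum[OF 1 2[unfolded distrib_left[of g]] 3]
      unfolding g_def[symmetric] x2[symmetric] distrib_left[of g] distrib_left[of "real d"] .
  qed
  have "L * t = (\<alpha> * L) * (Rmin / R\<^sup>2) / 32" by (simp add: t_def mult_ac)
  also have "\<dots> \<le> 1 * 1 / 32"
  proof (intro divide_right_mono mult_mono)
    have "R \<le> R\<^sup>2" using R by (simp add: power2_eq_square)
    then show "Rmin / R\<^sup>2 \<le> 1" using R by (simp add: divide_le_eq)
  qed (use L \<alpha> R in auto)
  finally have "L * t \<le> 1" by simp
  moreover have "0 < L * t" using L \<alpha> R by (simp add: t_def)
  ultimately have "(L * t)\<^sup>2 \<le> 1" "0 < (L * t)\<^sup>2" by (auto intro: power_le_one)
  then show "1 \<le> 8 / (L * t)\<^sup>2" by (simp add: le_divide_eq)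
qed

text \<open>
  All error terms have the form \<open>A\<^sup>d exp (- B)\<close>, and this is the requirement on \<open>B\<close> that makes them at most one.
\<close>

lemma exp_sample_size:
  fixes Z A B :: real
  assumes "0 < Z" "0 \<le> A" "A \<le> Z ^ N" "real d * real N * ln Z \<le> B"
  shows "A ^ d * exp (- B) \<le> 1"
proof -
  have "A ^ d \<le> (Z ^ N) ^ d" using assms by (intro power_mono) auto
  also have "\<dots> = exp (real d * real N * ln Z)"
    using assms(1) by (simp add: exp_of_nat_mult mult.assoc flip: power_mult)
  also have "\<dots> \<le> exp B" using assms by simp
  finally show ?thesis by (simp add: exp_minus field_simps)
qed

text \<open>
  The union bound over a net of \<open>c\<close> directions.
\<close>

lemma net_failure_le:
  fixes c \<mu> B Z :: real
  assumes "0 < \<mu>" "\<mu> < 1" "1 \<le> d" "0 < Z" and c: "0 \<le> c" "c \<le> (2 * real k + 1) ^ d"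
    and budget: "2 * (2 * real k + 1) / \<mu> \<le> Z ^ N" "real d * real N * ln Z \<le> B"
  shows "2 * c * exp (- B) \<le> \<mu>"
proof -
  have "(2 / \<mu>) ^ d * ((2 * real k + 1) ^ d * exp (- B)) = (2 * (2 * real k + 1) / \<mu>) ^ d * exp (- B)"
    by (simp only: power_mult_distrib[symmetric] mult.assoc[symmetric]) simp
  also have "\<dots> \<le> 1" using assms by (intro exp_sample_size[of Z _ N]) auto
  finally have 1: "(2 / \<mu>) ^ d * ((2 * real k + 1) ^ d * exp (- B)) \<le> 1" .
  have "2 / \<mu> * (c * exp (- B)) \<le> (2 / \<mu>) ^ d * ((2 * real k + 1) ^ d * exp (- B))"
    using assms by (intro mult_mono self_le_power) auto
  also note 1
  finally show ?thesis using assms by (simp add: field_simps)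
qed

text \<open>
  The mass far from the floating body, relative to the cube inscribed in its inner ball.
\<close>

lemma volume_tail_le:
  fixes Rmax Rmin \<mu> B Z :: real
  assumes "0 < \<mu>" "\<mu> < 1" "1 \<le> d" "0 < Z" "0 < Rmax" "0 < Rmin"
    and budget: "Rmax * real d / (Rmin * \<mu>) \<le> Z ^ N" "real d * real N * ln Z \<le> B"
  shows "exp (- B) * (2 * Rmax) ^ d \<le> \<mu> * (2 * Rmin / real d) ^ d"
proof -
  let ?x = "Rmax * real d / (Rmin * \<mu>)" and ?v = "(2 * Rmin / real d) ^ d"
  have 1: "?x ^ d * exp (- B) \<le> 1" using assms by (intro exp_sample_size[of Z _ N]) auto
  have "2 * Rmax = ?x * (2 * Rmin / real d) * \<mu>" using assms by simp
  then have "(2 * Rmax) ^ d = ?x ^ d * ?v * \<mu> ^ d" by (simp only: power_mult_distrib)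
  then have "exp (- B) * (2 * Rmax) ^ d = ?x ^ d * exp (- B) * (?v * \<mu> ^ d)" by simp
  also have "\<dots> \<le> 1 * (?v * \<mu>)"
    using 1 assms power_decreasing[of 1 d \<mu>] by (intro mult_mono) auto
  finally show ?thesis by (simp add: mult.commute)
qed

text \<open>
  A single power of the logarithm is needed, so the exponent \<open>20000 N\<close> of the logarithm is far from
  sharp; it is the multiplicative constant, which \<open>soft_O\<close> also uses as exponent. Rounding up to an
  integer costs a factor \<open>2\<close>, since the rounded number is at least one.
\<close>

lemma sample_size_le_soft_O:
  fixes d :: nat and R Rmin L \<epsilon> \<alpha> r l :: real
  assumes d: "1 \<le> d" and R: "1 \<le> R" "0 < Rmin" "Rmin \<le> R" and L: "0 < L" "4 * \<alpha> * L \<le> 1"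
    and \<alpha>: "0 < \<alpha>" "\<alpha> < 1 / 2" and \<epsilon>: "0 < \<epsilon>"
    and Z: "1 \<le> ln (2 + (\<Sum>x\<leftarrow>ps. x + 1 / x))" and N: "1 \<le> N"
    and n: "real n \<le> real d * (8 / (L * (\<alpha> * Rmin / (32 * R\<^sup>2)))\<^sup>2 + 8 / (\<epsilon> * L * (\<alpha> * Rmin / (32 * R\<^sup>2))))
        * (real N * ln (2 + (\<Sum>x\<leftarrow>ps. x + 1 / x))) + 1"
  shows "real n \<le> soft_O (20000 * real N) ps
     (R ^ 4 / Rmin ^ 2 * (real d ^ 2 / (\<alpha> ^ 14 * L ^ 2) + real d ^ 4 / (\<epsilon> ^ 2 * \<alpha> ^ 8 * L)
       + real d ^ 4 / (\<epsilon> ^ 2 * \<alpha> ^ 2 * (min r Rmin) ^ 2 * L)))"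
proof -
  let ?h = "real d ^ 2 / (\<alpha> ^ 14 * L ^ 2) + real d ^ 4 / (\<epsilon> ^ 2 * \<alpha> ^ 8 * L)"
  define t where "t = \<alpha> * Rmin / (32 * R\<^sup>2)"
  define g where "g = R ^ 4 / Rmin ^ 2 * (?h + real d ^ 4 / (\<epsilon> ^ 2 * \<alpha> ^ 2 * (min r Rmin) ^ 2 * L))"
  define z where "z = ln (2 + (\<Sum>x\<leftarrow>ps. x + 1 / x))"
  define A where "A = 8 / (L * t)\<^sup>2 + 8 / (\<epsilon> * L * t)"
  note sz = sample_size_le[OF d R L \<alpha> \<epsilon>, folded t_def]
  have z: "1 \<le> z" using Z by (simp add: z_def)
  have gh: "R ^ 4 / Rmin ^ 2 * ?h \<le> g" unfolding g_def using R L \<alpha> \<epsilon> by (intro mult_left_mono) auto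
  have "0 \<le> R ^ 4 / Rmin ^ 2 * ?h" using R L \<alpha> \<epsilon> by (intro mult_nonneg_nonneg add_nonneg_nonneg) auto
  then have g0: "0 \<le> g" using gh by linarith
  have Ng: "0 \<le> real N * z" using z by simp
  have dA: "real d * A \<le> 8448 * g" unfolding A_def using sz(1) gh by linarith
  have "0 < t" using R \<alpha> by (simp add: t_def)
  then have A1: "1 \<le> A" unfolding A_def using sz(2) L \<epsilon> by (intro add_increasing2) auto
  have "1 * 1 * (1 * 1) \<le> real d * A * (real N * z)"
    using A1 d z N by (intro mult_mono) auto
  then have "real n \<le> 2 * (real d * A * (real N * z))"
    using n unfolding t_def[symmetric] A_def[symmetric] z_def[symmetric] by linarith
  also have "\<dots> \<le> 2 * (8448 * g * (real N * z))"
    using dA Ng by (intro mult_left_mono mult_right_mono) auto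
  also have "\<dots> = 16896 * (g * (real N * z))" by simp
  also have "\<dots> \<le> 20000 * (g * (real N * z))"
    using mult_nonneg_nonneg[OF g0 Ng] by (intro mult_right_mono) auto
  also have "\<dots> = 20000 * real N * g * z" by simp
  also have "\<dots> \<le> 20000 * real N * g * (z powr (20000 * real N))"
  proof (rule mult_left_mono)
    have "z powr 1 \<le> z powr (20000 * real N)" using z N by (intro powr_mono) auto
    then show "z \<le> z powr (20000 * real N)" using z by simp
  qed (use g0 in simp)
  finally show ?thesis by (simp add: soft_O_def z_def g_def)
qed

section \<open>The sampling theorem\<close>

lemma vsphere_nonempty:
  assumes "1 \<le> d"
  shows "vsphere d \<noteq> {}"
proof -
  let ?e = "\<lambda>i\<in>{..<d}. if i = 0 then 1 else (0::real)"
  have "(\<Sum>i<d. (?e i)\<^sup>2) = (\<Sum>i<d. if i = 0 then 1 else 0)" by (intro sum.cong) auto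
  also have "\<dots> = 1" using assms by simp
  finally have "?e \<in> vsphere d" by (simp add: vsphere_def vnorm_def space_rvec)
  then show ?thesis by blast
qed

text \<open>
  Two opposite directions show that the width of the ball is at most that of the slab.
\<close>

lemma (in quantile_window) inradius_le:
  assumes ball: "vcball d c s \<subseteq> F" and s: "0 \<le> s" and d: "1 \<le> d"
    and \<rho>: "\<And>\<theta>. \<theta> \<in> vsphere d \<Longrightarrow> Q \<theta> \<le> \<rho>"
  shows "s \<le> \<rho>"
proof -
  obtain \<theta> where \<theta>: "\<theta> \<in> vsphere d" using vsphere_nonempty[OF d] by blast
  let ?\<theta> = "\<lambda>i\<in>{..<d}. - \<theta> i"
  have \<theta>': "?\<theta> \<in> vsphere d" using \<theta> by (simp add: vsphere_def vnorm_def space_rvec)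
  have "vinner d c ?\<theta> = - vinner d c \<theta>" by (simp add: vinner_def sum_negf)
  then show ?thesis
    using inball_margin[OF ball s \<theta>] inball_margin[OF ball s \<theta>'] \<rho>[OF \<theta>] \<rho>[OF \<theta>'] by linarith
qed

lemma admissible_quantile_window:
  assumes "D \<in> admissible P d q Rmax Rmin r L" "0 < q" "q < 1" "0 < r" "0 < L"
  shows "quantile_window D d q r L"
  using assms unfolding admissible_def quantile_window_def quantile_window_axioms_def by blast

text \<open>
  The event that all \<open>m\<close> points are short is contained in the event that the first one is.
\<close>

lemma admissible_norm_tail:
  assumes D: "D \<in> admissible P d q Rmax Rmin r L" and m: "1 \<le> m"
  shows "1 - exp (- real m) \<le> measure D {x \<in> space D. vnorm d x \<le> \<bar>poly (poly P [:real m:]) (real d)\<bar>}"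
proof -
  interpret D: prob_space D using D by (simp add: admissible_def)
  let ?M = "PiM {..<m} (\<lambda>_. D)" and ?b = "poly (poly P [:real m:]) (real d)"
  interpret M: prob_space ?M by (intro prob_space_PiM D.prob_space_axioms)
  have sD: "sets D = sets (rvec d)" using D by (simp add: admissible_def)
  have E: "{x \<in> space D. vnorm d x \<le> \<bar>?b\<bar>} \<in> sets D"
    using measurable_vnorm[of "\<lambda>x. x" D d] measurable_ident_sets[OF sD] by measurable
  have c: "(\<lambda>X. X 0) \<in> ?M \<rightarrow>\<^sub>M D" using m by (intro measurable_component_singleton) auto
  have "1 - exp (- real m) \<le> M.prob {X \<in> space ?M. \<forall>i<m. vnorm d (X i) \<le> ?b}"
    using D m by (simp add: admissible_def)
  also have "\<dots> \<le> M.prob ((\<lambda>X. X 0) -` {x \<in> space D. vnorm d x \<le> \<bar>?b\<bar>} \<inter> space ?M)"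
  proof (rule M.finite_measure_mono)
    show "{X \<in> space ?M. \<forall>i<m. vnorm d (X i) \<le> ?b} \<subseteq> (\<lambda>X. X 0) -` {x \<in> space D. vnorm d x \<le> \<bar>?b\<bar>} \<inter> space ?M"
      using m measurable_space[OF c] by force
  qed (rule measurable_sets[OF c E])
  also have "\<dots> = measure (distr ?M D (\<lambda>X. X 0)) {x \<in> space D. vnorm d x \<le> \<bar>?b\<bar>}"
    by (rule measure_distr[OF c E, symmetric])
  also have "distr ?M D (\<lambda>X. X 0) = D"
    using m by (intro distr_PiM_component D.prob_space_axioms) auto
  finally show ?thesis .
qed

text \<open>
  Each of the other terms \<open>y + 1 / y\<close> is at least \<open>2\<close>.
\<close>

lemma parameters_le_sum:
  fixes xs :: "real list"
  assumes "\<And>y. y \<in> set xs \<Longrightarrow> 0 < y" "x \<in> set xs"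
  shows "x + 1 / x + 2 * (real (length xs) - 1) \<le> (\<Sum>x\<leftarrow>xs. x + 1 / x)"
  using assms
proof (induction xs)
  case (Cons y ys)
  have two: "2 \<le> z + 1 / z" if "0 < z" for z :: real
  proof -
    have "0 \<le> (z - 1)\<^sup>2 / z" using that by simp
    also have "(z - 1)\<^sup>2 / z = z + 1 / z - 2" using that by (simp add: power2_eq_square field_simps)
    finally show ?thesis by simp
  qed
  have all: "2 * real (length zs) \<le> (\<Sum>x\<leftarrow>zs. x + 1 / x)" if "\<And>z. z \<in> set zs \<Longrightarrow> 0 < z" for zs
    using that
  proof (induction zs)
    case (Cons z zs)
    then show ?case using two[of z] by simp
  qed simp
  show ?case
  proof (cases "x = y")
    case True
    then show ?thesis using all[of ys] Cons.prems by simp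
  next
    case False
    then show ?thesis using Cons two[of y] by simp
  qed
qed simp

theorem corollary16:
  "\<exists>a>0. \<exists>b>0. \<forall>P :: real poly poly. \<exists>C>0.
     \<forall>(d::nat) (q::real) (Rmax::real) (Rmin::real) (r::real) (L::real) (\<epsilon>::real) (\<alpha>::real).
       d \<ge> 1 \<and> 1/2 < q \<and> q < 1 \<and> Rmax > 0 \<and> Rmin > 0 \<and> r > 0 \<and> L > 0 \<and> \<epsilon> > 0 \<and>
       0 < \<alpha> \<and> \<alpha> < Min {1, r, Rmin} / 2 \<longrightarrow>
       (let laws = {D \<in> admissible P d q Rmax Rmin r L.
                      vcball d (steiner_point d (floating_body d q D)) Rmin \<subseteq> floating_body d q D}
        in \<exists>n::nat. n > 0 \<and>
             (laws \<noteq> {} \<longrightarrow>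
                real n \<le> soft_O C [real d, q, Rmax, Rmin, r, L, \<epsilon>, \<alpha>]
                  ((Rmax + r + 1) powr a / Rmin powr b *
                   (real d ^ 2 / (\<alpha> ^ 14 * L ^ 2)
                    + real d ^ 4 / (\<epsilon> ^ 2 * \<alpha> ^ 8 * L)
                    + real d ^ 4 / (\<epsilon> ^ 2 * \<alpha> ^ 2 * (min r Rmin) ^ 2 * L)))) \<and>
             (\<exists>\<A> \<in> randomized_algorithms n d. differentially_private n d \<epsilon> \<A> \<and>
                (\<forall>D\<in>laws.
                   (W2 d (output_law n \<A> D) (uniform_law d (floating_body d q D))) ^ 2 / ennreal (real d)
                     \<le> ennreal \<alpha>)))" (is "\<exists>a>0. \<exists>b>0. \<forall>P. \<exists>C>0. ?claim a b P C")
proof (rule exI[of _ 4], rule conjI, simp, rule exI[of _ 2], rule conjI, simp, rule allI)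
  \<comment> \<open>The exponents \<open>4\<close> and \<open>2\<close> are those of \<open>R\<close> and \<open>1 / Rmin\<close> in \<open>1 / t\<^sup>2\<close> below.\<close>
  fix P :: "real poly poly"
  obtain N0 where N0: "\<forall>x y Z. 2 \<le> Z \<longrightarrow> \<bar>x\<bar> \<le> Z \<longrightarrow> \<bar>y\<bar> \<le> Z \<longrightarrow> \<bar>poly (poly P [:x:]) y\<bar> \<le> Z ^ N0"
    using poly_poly_le_power[of P] by blast
  define N where "N = 9 * N0 + 16"
  have N1: "1 \<le> N" by (simp add: N_def)
  have "?claim 4 2 P (20000 * real N)"
  proof (intro allI impI, goal_cases)
    case H: (1 d q Rmax Rmin r L \<epsilon> \<alpha>)
    define laws where "laws = {D \<in> admissible P d q Rmax Rmin r L.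
       vcball d (steiner_point d (floating_body d q D)) Rmin \<subseteq> floating_body d q D}"
    have d: "1 \<le> d" and q: "0 < q" "q < 1"
      and pos: "0 < Rmax" "0 < Rmin" "0 < r" "0 < L" "0 < \<epsilon>" "0 < \<alpha>" using H by auto
    have \<alpha>: "\<alpha> < 1 / 2" "\<alpha> < r / 2" "\<alpha> < Rmin / 2"
      using H Min_le[of "{1, r, Rmin}" 1] Min_le[of "{1, r, Rmin}" r] Min_le[of "{1, r, Rmin}" Rmin] by auto
    define R where "R = Rmax + r + 1"
    \<comment> \<open>The cost \<open>4 Rmax\<^sup>2 * 4 d \<mu>\<close> with \<open>\<mu> = 2 t / Rmin\<close> is at most \<open>d \<alpha>\<close> for this \<open>t\<close>.\<close>
    define t where "t = \<alpha> * Rmin / (32 * R\<^sup>2)"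
    define \<mu> where "\<mu> = \<alpha> / (16 * R\<^sup>2)"
    \<comment> \<open>Large enough for \<open>exp (- m) \<le> L t / 4\<close>, because \<open>m \<le> exp m\<close>.\<close>
    define m where "m = nat \<lceil>4 / (L * t)\<rceil>"
    define p where "p = \<bar>poly (poly P [:real m:]) (real d)\<bar>"
    \<comment> \<open>The covering radius \<open>d / k\<close> of the net satisfies \<open>d / k * (p + Rmax) \<le> t / 2\<close>.\<close>
    define k where "k = nat \<lceil>2 * real d * (p + Rmax) / t\<rceil>"
    define ps where "ps = [real d, q, Rmax, Rmin, r, L, \<epsilon>, \<alpha>]"
    define Z where "Z = 2 + (\<Sum>x\<leftarrow>ps. x + 1 / x)"
    define l where "l = real N * ln Z"
    \<comment> \<open>The summands make the exponents in \<open>fail\<close> and \<open>tail\<close> at least \<open>d N ln Z\<close>.\<close>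
    define X where "X = real d * (8 / (L * t)\<^sup>2 + 8 / (\<epsilon> * L * t)) * l"
    define n where "n = nat \<lceil>X\<rceil>"
    have R: "1 \<le> R" "Rmax \<le> R" using pos by (simp_all add: R_def)
    have t: "0 < t" using pos R by (simp add: t_def)
    have \<mu>: "0 < \<mu>" "\<mu> < 1" "\<mu> * Rmin = 2 * t"
    proof -
      have "1 \<le> R\<^sup>2" using R by (simp add: one_le_power)
      then show "\<mu> < 1" using \<alpha> by (simp add: \<mu>_def divide_less_eq)
    qed (use pos R in \<open>simp_all add: \<mu>_def t_def\<close>)
    have ps: "0 < y" if "y \<in> set ps" for y using that pos q d by (auto simp: ps_def)
    have ps8: "length ps = 8" by (simp add: ps_def)
    have param: "x + 1 / x \<le> Z - 16" if "x \<in> set ps" for x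
      using parameters_le_sum[OF ps that] by (simp add: Z_def ps8)
    have param1: "x \<le> Z" "1 / x \<le> Z" if "x \<in> set ps" for x
      using param[OF that] ps[OF that] by (smt (verit) divide_pos_pos)+
    have Z: "18 \<le> Z"
    proof -
      have "q + 1 / q \<le> Z - 16" by (rule param) (simp add: ps_def)
      moreover have "0 \<le> (q - 1)\<^sup>2 / q" using q by simp
      moreover have "(q - 1)\<^sup>2 / q = q + 1 / q - 2" using q by (simp add: power2_eq_square field_simps)
      ultimately show ?thesis by linarith
    qed
    have RZ: "R \<le> Z"
    proof -
      let ?S = "\<lambda>ps :: real list. \<Sum>x\<leftarrow>ps. x + 1 / x"
      have "0 \<le> real d + 1 / real d" "0 \<le> q + 1 / q" "0 \<le> 1 / Rmax" "0 \<le> Rmin + 1 / Rmin" "0 \<le> 1 / r"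
        "0 \<le> L + 1 / L" "0 \<le> \<epsilon> + 1 / \<epsilon>" "0 \<le> \<alpha> + 1 / \<alpha>" using pos q d by auto
      moreover have "?S ps = (real d + 1 / real d) + (q + 1 / q) + (Rmax + 1 / Rmax) + (Rmin + 1 / Rmin)
          + (r + 1 / r) + (L + 1 / L) + (\<epsilon> + 1 / \<epsilon>) + (\<alpha> + 1 / \<alpha>)" by (simp add: ps_def)
      ultimately have "Rmax + r \<le> ?S ps" by linarith
      then show ?thesis by (simp add: Z_def R_def)
    qed
    have lnZ: "1 \<le> ln Z"
    proof -
      have "exp 1 \<le> Z" using exp_le Z by linarith
      then show ?thesis using Z by (simp add: ln_ge_iff)
    qed
    have l: "1 \<le> l" using lnZ N1 mult_mono[of 1 "real N" 1 "ln Z"] by (simp add: l_def)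
    have budget: "2 * (2 * real k + 1) / \<mu> \<le> Z ^ N" "Rmax * real d / (Rmin * \<mu>) \<le> Z ^ N"
    proof -
      have le: "real d \<le> Z" "1 / Rmin \<le> Z" "1 / L \<le> Z" "1 / \<alpha> \<le> Z"
        using param1[of "real d"] param1[of Rmin] param1[of L] param1[of \<alpha>] by (simp_all add: ps_def)
      note b = net_resolution_le_power[OF N0 Z d pos(1,2,3,4,6) le(1) RZ[unfolded R_def] le(2,3,4),
          folded R_def, folded t_def \<mu>_def, folded m_def, folded p_def, folded k_def, folded N_def]
      show "2 * (2 * real k + 1) / \<mu> \<le> Z ^ N" "Rmax * real d / (Rmin * \<mu>) \<le> Z ^ N"
        by (rule b(1), rule b(2))
    qed
    have p0: "0 \<le> p" by (simp add: p_def)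
    have k: "2 * real d * (p + Rmax) / t \<le> real k" "0 < k"
    proof -
      show "2 * real d * (p + Rmax) / t \<le> real k" unfolding k_def by linarith
      moreover have "0 < 2 * real d * (p + Rmax) / t" using d p0 pos t by simp
      ultimately show "0 < k" by (metis less_le_trans of_nat_0_less_iff)
    qed
    have Lt: "0 < L * t" "0 < \<epsilon> * L * t" using pos t by simp_all
    have X1: "real d * real N * ln Z \<le> X * ((L * t)\<^sup>2 / 8)" "real d * real N * ln Z \<le> X * (\<epsilon> * L * t / 8)"
    proof -
      have nn: "0 \<le> real d * l * (8 / (L * t)\<^sup>2)" "0 \<le> real d * l * (8 / (\<epsilon> * L * t))"
        using l Lt by (auto intro!: mult_nonneg_nonneg)
      have X: "X = real d * l * (8 / (L * t)\<^sup>2) + real d * l * (8 / (\<epsilon> * L * t))"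
        by (simp add: X_def distrib_left distrib_right mult_ac)
      have "real d * l * (8 / (L * t)\<^sup>2) * ((L * t)\<^sup>2 / 8) \<le> X * ((L * t)\<^sup>2 / 8)"
        using X nn by (intro mult_right_mono) auto
      then show "real d * real N * ln Z \<le> X * ((L * t)\<^sup>2 / 8)" using pos t by (simp add: l_def)
      have "real d * l * (8 / (\<epsilon> * L * t)) * (\<epsilon> * L * t / 8) \<le> X * (\<epsilon> * L * t / 8)"
        using X nn Lt by (intro mult_right_mono) auto
      then show "real d * real N * ln Z \<le> X * (\<epsilon> * L * t / 8)" using pos t by (simp add: l_def)
    qed
    have X0: "0 < X" unfolding X_def using Lt l d by (intro mult_pos_pos add_pos_pos) auto
    have n: "0 < n" "X \<le> real n" "real n \<le> X + 1"
      using X0 unfolding n_def by linarith+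
    obtain \<Theta> where \<Theta>: "finite \<Theta>" "\<Theta> \<subseteq> vsphere d" "card \<Theta> \<le> (2 * k + 1) ^ d"
      and net: "\<And>\<theta>. \<theta> \<in> vsphere d \<Longrightarrow> \<exists>\<theta>'\<in>\<Theta>. vnorm d (\<lambda>i. \<theta> i - \<theta>' i) \<le> real d / real k"
      by (rule sphere_net[OF k(2)]) blast
    have \<Theta>0: "\<Theta> \<noteq> {}" using vsphere_nonempty[OF d] net by blast
    have resolution: "real d / real k * (p + Rmax) \<le> t / 2"
      using k t by (simp add: field_simps)
    have fail: "2 * real (card \<Theta>) * exp (- real n * (L * t)\<^sup>2 / 8) \<le> \<mu>"
    proof -
      have "real (card \<Theta>) \<le> real ((2 * k + 1) ^ d)" using \<Theta>(3) by (simp only: of_nat_le_iff)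
      then have c: "real (card \<Theta>) \<le> (2 * real k + 1) ^ d" by (simp add: add.commute)
      have "X * ((L * t)\<^sup>2 / 8) \<le> real n * ((L * t)\<^sup>2 / 8)" using n by (intro mult_right_mono) auto
      then have "real d * real N * ln Z \<le> real n * (L * t)\<^sup>2 / 8" using X1(1) by simp
      from net_failure_le[OF \<mu>(1,2) d _ _ c budget(1) this] show ?thesis using Z by simp
    qed
    have tail: "exp (- (\<epsilon> / 2) * (real n * L * t / 4)) * (2 * Rmax) ^ d \<le> \<mu> * (2 * Rmin / real d) ^ d"
    proof -
      have "X * (\<epsilon> * L * t / 8) \<le> real n * (\<epsilon> * L * t / 8)" using n Lt by (intro mult_right_mono) auto
      then have "real d * real N * ln Z \<le> (\<epsilon> / 2) * (real n * L * t / 4)" using X1(2) by (simp add: mult_ac)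
      from volume_tail_le[OF \<mu>(1,2) d _ pos(1,2) budget(2) this] show ?thesis using Z by simp
    qed
    have laws: "quantile_window D d q r L" "\<And>\<theta>. \<theta> \<in> vsphere d \<Longrightarrow> quantile D (\<lambda>x. vinner d x \<theta>) q \<le> Rmax"
        "Rmin \<le> Rmax" if D: "D \<in> laws" for D
    proof -
      show window: "quantile_window D d q r L"
        using D q pos by (intro admissible_quantile_window[of D P d q Rmax Rmin]) (auto simp: laws_def)
      show Q: "quantile D (\<lambda>x. vinner d x \<theta>) q \<le> Rmax" if "\<theta> \<in> vsphere d" for \<theta>
        using D that by (auto simp: laws_def admissible_def)
      show "Rmin \<le> Rmax"
      proof (rule quantile_window.inradius_le[OF window _ _ d])
        show "vcball d (steiner_point d (floating_body d q D)) Rmin \<subseteq> floating_body d q D"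
          using D by (simp add: laws_def)
      qed (use pos Q in simp_all)
    qed
    have sample_size: "real n \<le> soft_O (20000 * real N) ps
        ((Rmax + r + 1) powr 4 / Rmin powr 2 *
          (real d ^ 2 / (\<alpha> ^ 14 * L ^ 2) + real d ^ 4 / (\<epsilon> ^ 2 * \<alpha> ^ 8 * L)
           + real d ^ 4 / (\<epsilon> ^ 2 * \<alpha> ^ 2 * (min r Rmin) ^ 2 * L)))"
      if D: "D \<in> laws" for D
    proof -
      have RR: "Rmin \<le> R" using laws(3)[OF D] R by linarith
      have "4 * \<alpha> * L \<le> 2 * L * r" using \<alpha>(2) pos mult_right_mono[of "4 * \<alpha>" "2 * r" L] by (simp add: mult_ac)
      also have "\<dots> \<le> 1" by (rule quantile_window.mass_window[OF laws(1)[OF D] vsphere_nonempty[OF d]])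
      finally have L1: "4 * \<alpha> * L \<le> 1" .
      have "real n \<le> soft_O (20000 * real N) ps
        (R ^ 4 / Rmin ^ 2 *
          (real d ^ 2 / (\<alpha> ^ 14 * L ^ 2) + real d ^ 4 / (\<epsilon> ^ 2 * \<alpha> ^ 8 * L)
           + real d ^ 4 / (\<epsilon> ^ 2 * \<alpha> ^ 2 * (min r Rmin) ^ 2 * L)))"
        using n(3) lnZ N1 unfolding X_def l_def Z_def t_def
        by (intro sample_size_le_soft_O[OF d R(1) pos(2) RR pos(4) L1 pos(6) \<alpha>(1) pos(5)])
      moreover have "(Rmax + r + 1) powr 4 = R ^ 4" "Rmin powr 2 = Rmin ^ 2"
        using R pos unfolding R_def by simp_all
      ultimately show ?thesis by (simp only:)
    qed
    have accuracy: "(W2 d (output_law n (depth_mechanism n d q Rmax \<epsilon> \<Theta>) D)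
        (uniform_law d (floating_body d q D)))\<^sup>2 / ennreal (real d) \<le> ennreal \<alpha>" if D: "D \<in> laws" for D
    proof -
      interpret quantile_window D d q r L by (rule laws(1)[OF D])
      have tr: "t \<le> r"
      proof -
        have "Rmin \<le> R\<^sup>2" using laws(3)[OF D] R self_le_power[of R 2] by linarith
        then have "\<alpha> * Rmin \<le> \<alpha> * (32 * R\<^sup>2)" using pos by (intro mult_left_mono) auto
        then have "t \<le> \<alpha>" using R by (simp add: t_def divide_le_eq)
        then show ?thesis using \<alpha> pos by linarith
      qed
      have m: "1 \<le> m" "4 / (L * t) \<le> real m"
      proof -
        show "4 / (L * t) \<le> real m" unfolding m_def by linarith
        moreover have "0 < 4 / (L * t)" using Lt by simp
        ultimately show "1 \<le> m" by (metis less_le_trans of_nat_0_less_iff Suc_leI One_nat_def)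
      qed
      have "1 - L * t / 4 \<le> prob {x \<in> space D. vnorm d x \<le> p}"
      proof -
        have "real m \<le> exp (real m)" using exp_ge_add_one_self[of "real m"] by linarith
        then have "4 / (L * t) \<le> exp (real m)" using m by linarith
        then have "exp (- real m) \<le> L * t / 4" using Lt by (simp add: exp_minus field_simps)
        moreover have "1 - exp (- real m) \<le> prob {x \<in> space D. vnorm d x \<le> p}"
          unfolding p_def using D m by (intro admissible_norm_tail) (auto simp: laws_def)
        ultimately show ?thesis by linarith
      qed
      then have "(W2 d (output_law n (depth_mechanism n d q Rmax \<epsilon> \<Theta>) D) (uniform_law d F))\<^sup>2
          \<le> ennreal (4 * Rmax\<^sup>2) * ennreal (4 * real d * \<mu>)"
        using D pos n(1) by (intro W2_depth_mechanism[where s=Rmin and t=t and p=p and \<delta>="real d / real k"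
            and c="steiner_point d F"] d laws(2)[OF D] \<Theta> \<Theta>0 net t tr p0 resolution \<mu> fail tail) (auto simp: laws_def)
      also have "\<dots> = ennreal (16 * Rmax\<^sup>2 * \<mu>) * ennreal (real d)"
        using \<mu> by (simp add: mult_ac flip: ennreal_mult)
      finally have "(W2 d (output_law n (depth_mechanism n d q Rmax \<epsilon> \<Theta>) D) (uniform_law d F))\<^sup>2 / ennreal (real d)
          \<le> ennreal (16 * Rmax\<^sup>2 * \<mu>)"
        using d by (intro divide_le_posI_ennreal) (auto simp: mult.commute)
      also have "\<dots> \<le> ennreal \<alpha>"
      proof (rule ennreal_leI)
        have "Rmax\<^sup>2 \<le> R\<^sup>2" using R pos by (intro power_mono) auto
        then have "Rmax\<^sup>2 * \<alpha> \<le> R\<^sup>2 * \<alpha>" using pos by (intro mult_right_mono) auto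
        then show "16 * Rmax\<^sup>2 * \<mu> \<le> \<alpha>" using R by (simp add: \<mu>_def field_simps)
      qed
      finally show ?thesis .
    qed
    show ?case
      unfolding Let_def laws_def[symmetric] ps_def[symmetric]
      using n(1) sample_size accuracy depth_mechanism_randomized[OF d pos(1) less_imp_le[OF pos(5)] \<Theta>(1,2), of n q]
        depth_mechanism_private[OF d pos(1) less_imp_le[OF pos(5)] \<Theta>(1) \<Theta>0 \<Theta>(2), of n q]
      by blast
  qed
  then show "\<exists>C>0. ?claim 4 2 P C" using N1 by (intro exI[of _ "20000 * real N"]) simp
qed

end
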